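(* Let $\mathcal{G}=\mathcal{G}_1\times\mathcal{G}_2$ be a direct product of Lie algebras over a field $K$. Then $\mathcal{U}(S(\mathcal{G}))\simeq\mathcal{U}(S(\mathcal{G}_1))\otimes_K\mathcal{U}(S(\mathcal{G}_2))$, a tensor product of algebras.
   Context: For a Lie algebra $\mathcal{G}$ over $K$ with basis $\{x_i\}_{i\in I}$, the symmetric algebra $S(\mathcal{G})$ is a Poisson algebra whose bracket is determined by $\{x_i,x_j\}=[x_i,x_j]\in\mathcal{G}\subseteq S(\mathcal{G})$. A Poisson algebra $\mathcal{P}$ is a commutative associative unital $K$-algebra with a $K$-bilinear Lie bracket $\{\cdot,\cdot\}$ satisfying $\{a,xy\}=\{a,x\}y+x\{a,y\}$. The Poisson enveloping algebra of $\mathcal{P}$ is the universal triple $(\mathcal{U}(\mathcal{P}),\alpha,\beta)$ with $\mathcal{U}(\mathcal{P})$ an associative algebra, $\alpha:\mathcal{P}\to\mathcal{U}(\mathcal{P})$ an algebra homomorphism, $\beta:\mathcal{P}\to\mathcal{U}(\mathcal{P})$ a Lie algebra homomorphism such that $[\beta(a),\alpha(b)]=\alpha(\{a,b\})$ and $\beta(ab)=\beta(a)\alpha(b)+\alpha(a)\beta(b)$ for all $a,b\in\mathcal{P}$. *)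

theory Defs
  imports
    "HOL.Vector_Spaces"
    "HOL-Library.Multiset"
    "HOL-Library.Poly_Mapping"
    "HOL-Library.Product_Plus"
    "HOL-Algebra.QuotRing"
    "HOL-Algebra.Module"
begin

section \<open>Associative algebras over a field\<close>

text \<open>
  The ground field is a type \<open>'k\<close> of class \<open>field\<close>; algebras have explicit carriers and use the
  records of HOL-Algebra. (The locale \<open>algebra\<close> of HOL-Algebra is for commutative algebras only.)
\<close>

locale assoc_algebra = ring A for A :: "('k::field, 'a, 'z) module_scheme" (structure) +
  assumes smult_closed [simp, intro]: "x \<in> carrier A \<Longrightarrow> c \<odot> x \<in> carrier A"
    and smult_l_distr: "x \<in> carrier A \<Longrightarrow> (c + d) \<odot> x = c \<odot> x \<oplus> d \<odot> x"
    and smult_r_distr: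
      "\<lbrakk>x \<in> carrier A; y \<in> carrier A\<rbrakk> \<Longrightarrow> c \<odot> (x \<oplus> y) = c \<odot> x \<oplus> c \<odot> y"
    and smult_assoc: "x \<in> carrier A \<Longrightarrow> (c * d) \<odot> x = c \<odot> (d \<odot> x)"
    and smult_one [simp]: "x \<in> carrier A \<Longrightarrow> 1 \<odot> x = x"
    and smult_mult_left:
      "\<lbrakk>x \<in> carrier A; y \<in> carrier A\<rbrakk> \<Longrightarrow> (c \<odot> x) \<otimes> y = c \<odot> (x \<otimes> y)"
    and smult_mult_right:
      "\<lbrakk>x \<in> carrier A; y \<in> carrier A\<rbrakk> \<Longrightarrow> x \<otimes> (c \<odot> y) = c \<odot> (x \<otimes> y)"

definition alg_hom ::
    "('k, 'a, 'z) module_scheme \<Rightarrow> ('k, 'b, 'y) module_scheme \<Rightarrow> ('a \<Rightarrow> 'b) set" where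
  "alg_hom A B = {h \<in> ring_hom A B. \<forall>c. \<forall>x \<in> carrier A. h (c \<odot>\<^bsub>A\<^esub> x) = c \<odot>\<^bsub>B\<^esub> h x}"

definition alg_isomorphic ::
    "('k, 'a, 'z) module_scheme \<Rightarrow> ('k, 'b, 'y) module_scheme \<Rightarrow> bool" (infix \<open>\<cong>\<^sub>a\<close> 50) where
  "A \<cong>\<^sub>a B \<longleftrightarrow> (\<exists>h \<in> alg_hom A B. bij_betw h (carrier A) (carrier B))"

definition quotient_algebra ::
    "('k, 'a, 'z) module_scheme \<Rightarrow> 'a set \<Rightarrow> ('k, 'a set) module" where
  "quotient_algebra A I =
    \<lparr>carrier = carrier (A Quot I), mult = mult (A Quot I), one = one (A Quot I),
     zero = zero (A Quot I), add = add (A Quot I),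
     smult = (\<lambda>c X. \<Union>x\<in>X. I +>\<^bsub>A\<^esub> (c \<odot>\<^bsub>A\<^esub> x))\<rparr>"

text \<open>
  The monoid algebra \<open>K[M]\<close>: finitely supported functions on \<open>M\<close> with the convolution product.
  It serves for free algebras (\<open>M\<close> a monoid of words), polynomial algebras (\<open>M\<close> a monoid of
  multisets) and tensor products (\<open>M = A \<times> B\<close>).
\<close>

definition monoid_algebra :: "('m, 'z) monoid_scheme \<Rightarrow> ('k::field, 'm \<Rightarrow>\<^sub>0 'k) module" where
  "monoid_algebra M =
    \<lparr>carrier = {f. Poly_Mapping.keys f \<subseteq> carrier M},
     mult = (\<lambda>f g. \<Sum>x\<in>Poly_Mapping.keys f. \<Sum>y\<in>Poly_Mapping.keys g.
       Poly_Mapping.single (x \<otimes>\<^bsub>M\<^esub> y) (Poly_Mapping.lookup f x * Poly_Mapping.lookup g y)),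
     one = Poly_Mapping.single \<one>\<^bsub>M\<^esub> 1,
     zero = 0,
     add = (+),
     smult = (\<lambda>c. Poly_Mapping.map ((*) c))\<rparr>"

abbreviation monomial :: "'m \<Rightarrow> 'm \<Rightarrow>\<^sub>0 'k::field" where
  "monomial x \<equiv> Poly_Mapping.single x 1"

section \<open>Tensor product of algebras\<close>

text \<open>
  The basis element \<open>(a, b)\<close> of \<open>K[A \<times> B]\<close> stands for \<open>a \<otimes> b\<close>, so the product of the monoid
  algebra is \<open>(a \<otimes> b)(a' \<otimes> b') = aa' \<otimes> bb'\<close>. The linear span of the bilinearity relations is
  stable under multiplication by basis elements, so it coincides with the two-sided ideal
  generated by them.
\<close>

definition tensor_relations ::
    "('k::field, 'a, 'z) module_scheme \<Rightarrow> ('k, 'b, 'y) module_scheme \<Rightarrow> ('a \<times> 'b \<Rightarrow>\<^sub>0 'k) set" where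
  "tensor_relations A B =
    {monomial (a \<oplus>\<^bsub>A\<^esub> a', b) - (monomial (a, b) + monomial (a', b)) | a a' b.
       a \<in> carrier A \<and> a' \<in> carrier A \<and> b \<in> carrier B} \<union>
    {monomial (a, b \<oplus>\<^bsub>B\<^esub> b') - (monomial (a, b) + monomial (a, b')) | a b b'.
       a \<in> carrier A \<and> b \<in> carrier B \<and> b' \<in> carrier B} \<union>
    {monomial (c \<odot>\<^bsub>A\<^esub> a, b) - Poly_Mapping.single (a, b) c | c a b.
       a \<in> carrier A \<and> b \<in> carrier B} \<union>
    {monomial (a, c \<odot>\<^bsub>B\<^esub> b) - Poly_Mapping.single (a, b) c | c a b.
       a \<in> carrier A \<and> b \<in> carrier B}"

definition alg_tensor ::
    "('k::field, 'a, 'z) module_scheme \<Rightarrow> ('k, 'b, 'y) module_scheme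
      \<Rightarrow> ('k, ('a \<times> 'b \<Rightarrow>\<^sub>0 'k) set) module" (infixr \<open>\<otimes>\<^sub>a\<close> 70) where
  "A \<otimes>\<^sub>a B = quotient_algebra (monoid_algebra (A \<times>\<times> B))
     (Idl\<^bsub>monoid_algebra (A \<times>\<times> B)\<^esub> (tensor_relations A B))"

section \<open>Lie algebras and their direct products\<close>

locale lie_algebra = vector_space scale
  for scale :: "'k::field \<Rightarrow> 'g::ab_group_add \<Rightarrow> 'g" +
  fixes lie :: "'g \<Rightarrow> 'g \<Rightarrow> 'g"
  assumes lie_add_left: "lie (x + y) z = lie x z + lie y z"
    and lie_add_right: "lie x (y + z) = lie x y + lie x z"
    and lie_scale_left: "lie (scale c x) y = scale c (lie x y)"
    and lie_scale_right: "lie x (scale c y) = scale c (lie x y)"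
    and lie_self: "lie x x = 0"
    and lie_jacobi: "lie x (lie y z) + lie y (lie z x) + lie z (lie x y) = 0"

definition prod_scale ::
    "('k \<Rightarrow> 'a \<Rightarrow> 'a) \<Rightarrow> ('k \<Rightarrow> 'b \<Rightarrow> 'b) \<Rightarrow> 'k \<Rightarrow> 'a \<times> 'b \<Rightarrow> 'a \<times> 'b" where
  "prod_scale s1 s2 c x = (s1 c (fst x), s2 c (snd x))"

definition prod_lie ::
    "('a \<Rightarrow> 'a \<Rightarrow> 'a) \<Rightarrow> ('b \<Rightarrow> 'b \<Rightarrow> 'b) \<Rightarrow> 'a \<times> 'b \<Rightarrow> 'a \<times> 'b \<Rightarrow> 'a \<times> 'b" where
  "prod_lie l1 l2 x y = (l1 (fst x) (fst y), l2 (snd x) (snd y))"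

lemma lie_algebra_prod:
  assumes "lie_algebra s1 l1" "lie_algebra s2 l2"
  shows "lie_algebra (prod_scale s1 s2) (prod_lie l1 l2)"
proof -
  interpret A: lie_algebra s1 l1 by fact
  interpret B: lie_algebra s2 l2 by fact
  show ?thesis
    by unfold_locales
      (auto simp: prod_scale_def prod_lie_def prod_eq_iff
        A.scale_right_distrib A.scale_left_distrib B.scale_right_distrib B.scale_left_distrib
        A.lie_add_left A.lie_add_right A.lie_scale_left A.lie_scale_right A.lie_self A.lie_jacobi
        B.lie_add_left B.lie_add_right B.lie_scale_left B.lie_scale_right B.lie_self B.lie_jacobi)
qed

section \<open>Poisson algebras and Poisson enveloping algebras\<close>

record ('k, 'a) poisson = "('k, 'a) module" +
  pbracket :: "'a \<Rightarrow> 'a \<Rightarrow> 'a" (\<open>\<lbrace>_,/ _\<rbrace>\<index>\<close>)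

locale poisson_algebra = assoc_algebra P + cring P
  for P :: "('k::field, 'a, 'z) poisson_scheme" (structure) +
  assumes pbracket_closed [simp, intro]:
      "\<lbrakk>a \<in> carrier P; b \<in> carrier P\<rbrakk> \<Longrightarrow> \<lbrace>a, b\<rbrace> \<in> carrier P"
    and pbracket_add_left:
      "\<lbrakk>a \<in> carrier P; b \<in> carrier P; c \<in> carrier P\<rbrakk> \<Longrightarrow> \<lbrace>a \<oplus> b, c\<rbrace> = \<lbrace>a, c\<rbrace> \<oplus> \<lbrace>b, c\<rbrace>"
    and pbracket_add_right:
      "\<lbrakk>a \<in> carrier P; b \<in> carrier P; c \<in> carrier P\<rbrakk> \<Longrightarrow> \<lbrace>a, b \<oplus> c\<rbrace> = \<lbrace>a, b\<rbrace> \<oplus> \<lbrace>a, c\<rbrace>"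
    and pbracket_smult_left:
      "\<lbrakk>a \<in> carrier P; b \<in> carrier P\<rbrakk> \<Longrightarrow> \<lbrace>k \<odot> a, b\<rbrace> = k \<odot> \<lbrace>a, b\<rbrace>"
    and pbracket_smult_right:
      "\<lbrakk>a \<in> carrier P; b \<in> carrier P\<rbrakk> \<Longrightarrow> \<lbrace>a, k \<odot> b\<rbrace> = k \<odot> \<lbrace>a, b\<rbrace>"
    and pbracket_self: "a \<in> carrier P \<Longrightarrow> \<lbrace>a, a\<rbrace> = \<zero>"
    and pbracket_jacobi:
      "\<lbrakk>a \<in> carrier P; b \<in> carrier P; c \<in> carrier P\<rbrakk> \<Longrightarrow>
        \<lbrace>a, \<lbrace>b, c\<rbrace>\<rbrace> \<oplus> \<lbrace>b, \<lbrace>c, a\<rbrace>\<rbrace> \<oplus> \<lbrace>c, \<lbrace>a, b\<rbrace>\<rbrace> = \<zero>"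
    and pbracket_leibniz:
      "\<lbrakk>a \<in> carrier P; x \<in> carrier P; y \<in> carrier P\<rbrakk> \<Longrightarrow>
        \<lbrace>a, x \<otimes> y\<rbrace> = \<lbrace>a, x\<rbrace> \<otimes> y \<oplus> x \<otimes> \<lbrace>a, y\<rbrace>"

definition poisson_compatible ::
    "('k::field, 'p, 'z) poisson_scheme \<Rightarrow> ('k, 'u, 'y) module_scheme
      \<Rightarrow> ('p \<Rightarrow> 'u) \<Rightarrow> ('p \<Rightarrow> 'u) \<Rightarrow> bool" where
  "poisson_compatible P U \<alpha> \<beta> \<longleftrightarrow>
    \<alpha> \<in> alg_hom P U \<and>
    \<beta> \<in> carrier P \<rightarrow> carrier U \<and>
    (\<forall>a\<in>carrier P. \<forall>b\<in>carrier P. \<beta> (a \<oplus>\<^bsub>P\<^esub> b) = \<beta> a \<oplus>\<^bsub>U\<^esub> \<beta> b) \<and>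
    (\<forall>c. \<forall>a\<in>carrier P. \<beta> (c \<odot>\<^bsub>P\<^esub> a) = c \<odot>\<^bsub>U\<^esub> \<beta> a) \<and>
    (\<forall>a\<in>carrier P. \<forall>b\<in>carrier P. \<beta> \<lbrace>a, b\<rbrace>\<^bsub>P\<^esub> = \<beta> a \<otimes>\<^bsub>U\<^esub> \<beta> b \<ominus>\<^bsub>U\<^esub> \<beta> b \<otimes>\<^bsub>U\<^esub> \<beta> a) \<and>
    (\<forall>a\<in>carrier P. \<forall>b\<in>carrier P. \<beta> a \<otimes>\<^bsub>U\<^esub> \<alpha> b \<ominus>\<^bsub>U\<^esub> \<alpha> b \<otimes>\<^bsub>U\<^esub> \<beta> a = \<alpha> \<lbrace>a, b\<rbrace>\<^bsub>P\<^esub>) \<and>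
    (\<forall>a\<in>carrier P. \<forall>b\<in>carrier P.
      \<beta> (a \<otimes>\<^bsub>P\<^esub> b) = \<beta> a \<otimes>\<^bsub>U\<^esub> \<alpha> b \<oplus>\<^bsub>U\<^esub> \<alpha> a \<otimes>\<^bsub>U\<^esub> \<beta> b)"

text \<open>
  The universal property defining the Poisson enveloping algebra. HOL cannot quantify over all
  types inside a formula, so the type \<open>'b\<close> of the test algebras is a parameter;
  \<open>poisson_env_universal\<close> below holds for every \<open>'b\<close>.
\<close>

definition universal_poisson_triple ::
    "'b itself \<Rightarrow> ('k::field, 'p, 'z) poisson_scheme \<Rightarrow> ('k, 'u) module
      \<Rightarrow> ('p \<Rightarrow> 'u) \<Rightarrow> ('p \<Rightarrow> 'u) \<Rightarrow> bool" where
  "universal_poisson_triple T P U \<alpha> \<beta> \<longleftrightarrow>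
    assoc_algebra U \<and> poisson_compatible P U \<alpha> \<beta> \<and>
    (\<forall>(B :: ('k, 'b) module) \<gamma> \<delta>. assoc_algebra B \<and> poisson_compatible P B \<gamma> \<delta> \<longrightarrow>
      (\<exists>!h. h \<in> alg_hom U B \<and> h \<in> extensional (carrier U) \<and>
        (\<forall>a\<in>carrier P. h (\<alpha> a) = \<gamma> a \<and> h (\<beta> a) = \<delta> a)))"

datatype 'p env_gen = Alpha 'p | Beta 'p

definition free_algebra :: "'x set \<Rightarrow> ('k::field, 'x list \<Rightarrow>\<^sub>0 'k) module" where
  "free_algebra X = monoid_algebra \<lparr>carrier = lists X, mult = (@), one = []\<rparr>"

definition poisson_env_relations ::
    "('k::field, 'p, 'z) poisson_scheme \<Rightarrow> ('p env_gen list \<Rightarrow>\<^sub>0 'k) set" where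
  "poisson_env_relations P =
    {monomial [Alpha (a \<oplus>\<^bsub>P\<^esub> b)] - (monomial [Alpha a] + monomial [Alpha b]) | a b.
       a \<in> carrier P \<and> b \<in> carrier P} \<union>
    {monomial [Alpha (c \<odot>\<^bsub>P\<^esub> a)] - Poly_Mapping.single [Alpha a] c | c a. a \<in> carrier P} \<union>
    {monomial [Alpha (a \<otimes>\<^bsub>P\<^esub> b)] - monomial [Alpha a, Alpha b] | a b.
       a \<in> carrier P \<and> b \<in> carrier P} \<union>
    {monomial [Alpha \<one>\<^bsub>P\<^esub>] - monomial []} \<union>
    {monomial [Beta (a \<oplus>\<^bsub>P\<^esub> b)] - (monomial [Beta a] + monomial [Beta b]) | a b.
       a \<in> carrier P \<and> b \<in> carrier P} \<union>
    {monomial [Beta (c \<odot>\<^bsub>P\<^esub> a)] - Poly_Mapping.single [Beta a] c | c a. a \<in> carrier P} \<union>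
    {monomial [Beta \<lbrace>a, b\<rbrace>\<^bsub>P\<^esub>] - (monomial [Beta a, Beta b] - monomial [Beta b, Beta a]) | a b.
       a \<in> carrier P \<and> b \<in> carrier P} \<union>
    {monomial [Alpha \<lbrace>a, b\<rbrace>\<^bsub>P\<^esub>] - (monomial [Beta a, Alpha b] - monomial [Alpha b, Beta a]) | a b.
       a \<in> carrier P \<and> b \<in> carrier P} \<union>
    {monomial [Beta (a \<otimes>\<^bsub>P\<^esub> b)] - (monomial [Beta a, Alpha b] + monomial [Alpha a, Beta b]) | a b.
       a \<in> carrier P \<and> b \<in> carrier P}"

definition poisson_env_free ::
    "('k::field, 'p, 'z) poisson_scheme \<Rightarrow> ('k, 'p env_gen list \<Rightarrow>\<^sub>0 'k) module" where
  "poisson_env_free P = free_algebra (Alpha ` carrier P \<union> Beta ` carrier P)"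

definition poisson_env_ideal ::
    "('k::field, 'p, 'z) poisson_scheme \<Rightarrow> ('p env_gen list \<Rightarrow>\<^sub>0 'k) set" where
  "poisson_env_ideal P = Idl\<^bsub>poisson_env_free P\<^esub> (poisson_env_relations P)"

text \<open>
  The Poisson enveloping algebra. Words in the generators \<open>Alpha a\<close>, \<open>Beta a\<close> (\<open>a\<close> in the
  carrier), modulo exactly the identities of \<open>poisson_compatible\<close>.
\<close>

definition poisson_env ::
    "('k::field, 'p, 'z) poisson_scheme \<Rightarrow> ('k, ('p env_gen list \<Rightarrow>\<^sub>0 'k) set) module" where
  "poisson_env P = quotient_algebra (poisson_env_free P) (poisson_env_ideal P)"

definition poisson_env_alpha ::
    "('k::field, 'p, 'z) poisson_scheme \<Rightarrow> 'p \<Rightarrow> ('p env_gen list \<Rightarrow>\<^sub>0 'k) set" where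
  "poisson_env_alpha P a = poisson_env_ideal P +>\<^bsub>poisson_env_free P\<^esub> monomial [Alpha a]"

definition poisson_env_beta ::
    "('k::field, 'p, 'z) poisson_scheme \<Rightarrow> 'p \<Rightarrow> ('p env_gen list \<Rightarrow>\<^sub>0 'k) set" where
  "poisson_env_beta P a = poisson_env_ideal P +>\<^bsub>poisson_env_free P\<^esub> monomial [Beta a]"

section \<open>The symmetric algebra of a Lie algebra as a Poisson algebra\<close>

text \<open>
  \<open>S(G)\<close> is the polynomial algebra in one variable \<open>X\<^sub>x\<close> for each \<open>x \<in> G\<close>, modulo linearity of
  \<open>x \<mapsto> X\<^sub>x\<close>. The Poisson bracket is induced by the biderivation with
  \<open>{X\<^sub>x, X\<^sub>y} = X\<^bsub>[x,y]\<^esub>\<close>; see \<open>poisson_algebra_sym\<close> and \<open>sym_pbracket_incl\<close> below.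
\<close>

definition poly_algebra :: "('k::field, 'g multiset \<Rightarrow>\<^sub>0 'k) module" where
  "poly_algebra = monoid_algebra \<lparr>carrier = UNIV, mult = (+), one = {#}\<rparr>"

definition sym_ideal :: "('k::field \<Rightarrow> 'g::ab_group_add \<Rightarrow> 'g) \<Rightarrow> ('g multiset \<Rightarrow>\<^sub>0 'k) set" where
  "sym_ideal scale = Idl\<^bsub>poly_algebra\<^esub>
    ({monomial {#x + y#} - (monomial {#x#} + monomial {#y#}) | x y. True} \<union>
     {monomial {#scale c x#} - Poly_Mapping.single {#x#} c | c x. True})"

text \<open>
  On monomials the Leibniz rule forces
  \<open>{x\<^sub>1 \<cdots> x\<^sub>m, y\<^sub>1 \<cdots> y\<^sub>n} = \<Sum>\<^sub>i\<^sub>,\<^sub>j (\<Prod>\<^sub>p\<^sub>\<noteq>\<^sub>i x\<^sub>p) (\<Prod>\<^sub>q\<^sub>\<noteq>\<^sub>j y\<^sub>q) [x\<^sub>i, y\<^sub>j]\<close>.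
\<close>

definition mono_bracket ::
    "('g \<Rightarrow> 'g \<Rightarrow> 'g) \<Rightarrow> 'g multiset \<Rightarrow> 'g multiset \<Rightarrow> 'g multiset \<Rightarrow>\<^sub>0 'k::field" where
  "mono_bracket lie M N =
    (\<Sum>x\<in>#M. \<Sum>y\<in>#N. monomial ((M - {#x#}) + (N - {#y#}) + {#lie x y#}))"

definition poly_bracket ::
    "('g \<Rightarrow> 'g \<Rightarrow> 'g) \<Rightarrow> ('g multiset \<Rightarrow>\<^sub>0 'k::field) \<Rightarrow> ('g multiset \<Rightarrow>\<^sub>0 'k) \<Rightarrow> 'g multiset \<Rightarrow>\<^sub>0 'k" where
  "poly_bracket lie f g =
    (\<Sum>M\<in>Poly_Mapping.keys f. \<Sum>N\<in>Poly_Mapping.keys g.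
      Poly_Mapping.map ((*) (Poly_Mapping.lookup f M * Poly_Mapping.lookup g N))
        (mono_bracket lie M N))"

definition sym_algebra ::
    "('k::field \<Rightarrow> 'g::ab_group_add \<Rightarrow> 'g) \<Rightarrow> ('k, ('g multiset \<Rightarrow>\<^sub>0 'k) set) module" where
  "sym_algebra scale = quotient_algebra poly_algebra (sym_ideal scale)"

definition sym_poisson ::
    "('k::field \<Rightarrow> 'g::ab_group_add \<Rightarrow> 'g) \<Rightarrow> ('g \<Rightarrow> 'g \<Rightarrow> 'g)
      \<Rightarrow> ('k, ('g multiset \<Rightarrow>\<^sub>0 'k) set) poisson" where
  "sym_poisson scale lie = (let S = sym_algebra scale in
    \<lparr>carrier = carrier S, mult = mult S, one = one S, zero = zero S, add = add S,
     smult = smult S,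
     pbracket = (\<lambda>X Y. \<Union>f\<in>X. \<Union>g\<in>Y. sym_ideal scale +>\<^bsub>poly_algebra\<^esub> poly_bracket lie f g)\<rparr>)"

definition sym_incl ::
    "('k::field \<Rightarrow> 'g::ab_group_add \<Rightarrow> 'g) \<Rightarrow> 'g \<Rightarrow> ('g multiset \<Rightarrow>\<^sub>0 'k) set" where
  "sym_incl scale x = sym_ideal scale +>\<^bsub>poly_algebra\<^esub> monomial {#x#}"

section \<open>Monoid algebras and quotients\<close>

lemma carrier_monoid_algebra: "f \<in> carrier (monoid_algebra M) \<longleftrightarrow> Poly_Mapping.keys f \<subseteq> carrier M"
  and add_monoid_algebra [simp]: "add (monoid_algebra M) = (+)"
  and zero_monoid_algebra [simp]: "zero (monoid_algebra M) = 0"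
  and one_monoid_algebra [simp]: "one (monoid_algebra M) = monomial \<one>\<^bsub>M\<^esub>"
  and smult_monoid_algebra [simp]: "smult (monoid_algebra M) c = Poly_Mapping.map ((*) c)"
  by (simp_all add: monoid_algebra_def)

lemma lookup_map_scale [simp]:
  "Poly_Mapping.lookup (Poly_Mapping.map ((*) c) f) x = (c::'k::field) * Poly_Mapping.lookup f x"
  by (simp add: Poly_Mapping.map.rep_eq when_def)

lemma monoid_algebra_mult_superset:
  assumes "finite S" "Poly_Mapping.keys f \<subseteq> S" "finite T" "Poly_Mapping.keys g \<subseteq> T"
  shows "f \<otimes>\<^bsub>monoid_algebra M\<^esub> g = (\<Sum>x\<in>S. \<Sum>y\<in>T. Poly_Mapping.single (x \<otimes>\<^bsub>M\<^esub> y)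
    (Poly_Mapping.lookup f x * (Poly_Mapping.lookup g y :: 'k::field)))"
proof -
  have "f \<otimes>\<^bsub>monoid_algebra M\<^esub> g = (\<Sum>x\<in>Poly_Mapping.keys f. \<Sum>y\<in>T. Poly_Mapping.single (x \<otimes>\<^bsub>M\<^esub> y)
    (Poly_Mapping.lookup f x * Poly_Mapping.lookup g y))"
    unfolding monoid_algebra_def using assms
    by (simp, intro sum.cong refl sum.mono_neutral_left) (auto simp: in_keys_iff)
  also have "\<dots> = (\<Sum>x\<in>S. \<Sum>y\<in>T. Poly_Mapping.single (x \<otimes>\<^bsub>M\<^esub> y)
    (Poly_Mapping.lookup f x * Poly_Mapping.lookup g y))"
    using assms by (intro sum.mono_neutral_left) (auto simp: in_keys_iff)
  finally show ?thesis .
qed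

lemma monoid_algebra_add_mult:
  "(f + g) \<otimes>\<^bsub>monoid_algebra M\<^esub> h = f \<otimes>\<^bsub>monoid_algebra M\<^esub> h + g \<otimes>\<^bsub>monoid_algebra M\<^esub> (h :: _ \<Rightarrow>\<^sub>0 'k::field)"
proof -
  let ?S = "Poly_Mapping.keys f \<union> Poly_Mapping.keys g"
  have "Poly_Mapping.keys (f + g) \<subseteq> ?S" by (rule Poly_Mapping.keys_add)
  then show ?thesis
    by (simp add: monoid_algebra_mult_superset[where S = ?S and T = "Poly_Mapping.keys h"]
        lookup_add distrib_right single_add sum.distrib)
qed

lemma monoid_algebra_mult_add:
  "h \<otimes>\<^bsub>monoid_algebra M\<^esub> (f + g) = h \<otimes>\<^bsub>monoid_algebra M\<^esub> f + h \<otimes>\<^bsub>monoid_algebra M\<^esub> (g :: _ \<Rightarrow>\<^sub>0 'k::field)"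
proof -
  let ?S = "Poly_Mapping.keys f \<union> Poly_Mapping.keys g"
  have "Poly_Mapping.keys (f + g) \<subseteq> ?S" by (rule Poly_Mapping.keys_add)
  then show ?thesis
    by (simp add: monoid_algebra_mult_superset[where T = ?S and S = "Poly_Mapping.keys h"]
        lookup_add distrib_left single_add sum.distrib)
qed

lemma monoid_algebra_mult_0 [simp]:
  "0 \<otimes>\<^bsub>monoid_algebra M\<^esub> f = 0" "f \<otimes>\<^bsub>monoid_algebra M\<^esub> 0 = 0"
  by (simp_all add: monoid_algebra_def)

lemma monoid_algebra_mult_single [simp]:
  "Poly_Mapping.single x c \<otimes>\<^bsub>monoid_algebra M\<^esub> Poly_Mapping.single y d
    = Poly_Mapping.single (x \<otimes>\<^bsub>M\<^esub> y) (c * (d::'k::field))"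
  by (subst monoid_algebra_mult_superset[of "{x}" _ "{y}"]) auto

lemma poly_mapping_single_sum:
  "(\<Sum>x\<in>Poly_Mapping.keys f. Poly_Mapping.single x (Poly_Mapping.lookup f x)) = (f :: _ \<Rightarrow>\<^sub>0 'k::comm_monoid_add)"
proof (rule poly_mapping_eqI)
  fix k
  have "Poly_Mapping.lookup (\<Sum>x\<in>Poly_Mapping.keys f. Poly_Mapping.single x (Poly_Mapping.lookup f x)) k
      = (\<Sum>x\<in>Poly_Mapping.keys f. if x = k then Poly_Mapping.lookup f x else 0)"
    unfolding lookup_sum by (intro sum.cong) (auto simp: lookup_single when_def)
  also have "\<dots> = Poly_Mapping.lookup f k"
    unfolding sum.delta[OF finite_keys] by (auto simp: in_keys_iff)
  finally show "Poly_Mapping.lookup (\<Sum>x\<in>Poly_Mapping.keys f. Poly_Mapping.single x (Poly_Mapping.lookup f x)) k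
      = Poly_Mapping.lookup f k" .
qed

lemma monoid_algebra_induct [consumes 1, case_names zero single add]:
  assumes "f \<in> carrier (monoid_algebra M)"
    and z: "Q 0"
    and s: "\<And>x c. x \<in> carrier M \<Longrightarrow> Q (Poly_Mapping.single x (c::'k::field))"
    and a: "\<And>f g. \<lbrakk>f \<in> carrier (monoid_algebra M); g \<in> carrier (monoid_algebra M); Q f; Q g\<rbrakk> \<Longrightarrow> Q (f + g)"
  shows "Q f"
proof -
  have "Q (\<Sum>x\<in>A. Poly_Mapping.single x (Poly_Mapping.lookup f x)) \<and>
    (\<Sum>x\<in>A. Poly_Mapping.single x (Poly_Mapping.lookup f x)) \<in> carrier (monoid_algebra M)"
    if "A \<subseteq> Poly_Mapping.keys f" for A
  proof -
    have "finite A" using that finite_keys by (rule finite_subset)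
    then show ?thesis using that
    proof induction
      case empty then show ?case using z by (simp add: carrier_monoid_algebra)
    next
      case (insert x A)
      have x: "x \<in> carrier M" using insert.prems assms(1) by (auto simp: carrier_monoid_algebra)
      then have c: "Poly_Mapping.single x (Poly_Mapping.lookup f x) \<in> carrier (monoid_algebra M)"
        by (auto simp: carrier_monoid_algebra)
      have IH: "Q (\<Sum>x\<in>A. Poly_Mapping.single x (Poly_Mapping.lookup f x))"
         "(\<Sum>x\<in>A. Poly_Mapping.single x (Poly_Mapping.lookup f x)) \<in> carrier (monoid_algebra M)"
        using insert by auto
      show ?case using a[OF c IH(2) s[OF x] IH(1)] insert.hyps c IH(2)
          Poly_Mapping.keys_add[of "Poly_Mapping.single x (Poly_Mapping.lookup f x)"
            "\<Sum>x\<in>A. Poly_Mapping.single x (Poly_Mapping.lookup f x)"]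
        by (auto simp: carrier_monoid_algebra)
    qed
  qed
  from this[OF subset_refl] show ?thesis using poly_mapping_single_sum[of f] by simp
qed

lemma single_in_monoid_algebra [simp]:
  "x \<in> carrier M \<Longrightarrow> Poly_Mapping.single x c \<in> carrier (monoid_algebra M)"
  by (auto simp: carrier_monoid_algebra)

lemma monoid_algebra_closed:
  fixes f g :: "'m \<Rightarrow>\<^sub>0 'k::field"
  assumes "monoid M" and f: "f \<in> carrier (monoid_algebra M)" and g: "g \<in> carrier (monoid_algebra M)"
  shows "f + g \<in> carrier (monoid_algebra M)" "- f \<in> carrier (monoid_algebra M)"
    "f - g \<in> carrier (monoid_algebra M)"
    "f \<otimes>\<^bsub>monoid_algebra M\<^esub> g \<in> carrier (monoid_algebra M)"
    "Poly_Mapping.map ((*) c) f \<in> carrier (monoid_algebra M)"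
proof -
  interpret monoid M by fact
  have *: "f + g \<in> carrier (monoid_algebra M)" if "f \<in> carrier (monoid_algebra M)" "g \<in> carrier (monoid_algebra M)"
    for f g :: "'m \<Rightarrow>\<^sub>0 'k"
    using that Poly_Mapping.keys_add[of f g] by (auto simp: carrier_monoid_algebra)
  show "f + g \<in> carrier (monoid_algebra M)" using f g by (rule *)
  show "- f \<in> carrier (monoid_algebra M)"
    using f by (auto simp: carrier_monoid_algebra in_keys_iff)
  show "f - g \<in> carrier (monoid_algebra M)"
    using f g by (auto simp: carrier_monoid_algebra in_keys_iff lookup_minus subset_iff) metis
  show "Poly_Mapping.map ((*) c) f \<in> carrier (monoid_algebra M)"
    using f by (auto simp: carrier_monoid_algebra in_keys_iff)
  show "f \<otimes>\<^bsub>monoid_algebra M\<^esub> g \<in> carrier (monoid_algebra M)"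
    using f
  proof (induction rule: monoid_algebra_induct)
    case (single x c)
    from g show ?case
    proof (induction rule: monoid_algebra_induct)
      case zero then show ?case by (simp add: carrier_monoid_algebra)
    next
      case s: (single y d)
      then show ?case using single by simp
    next
      case (add f g) then show ?case by (simp add: monoid_algebra_mult_add *)
    qed
  next
    case zero then show ?case by (simp add: carrier_monoid_algebra)
  next
    case (add f g) then show ?case by (simp add: monoid_algebra_add_mult *)
  qed
qed

lemma monoid_algebra_assoc:
  assumes "monoid M" "f \<in> carrier (monoid_algebra M)" and g: "g \<in> carrier (monoid_algebra M)"
    and h: "h \<in> carrier (monoid_algebra M)"
  shows "(f \<otimes>\<^bsub>monoid_algebra M\<^esub> g) \<otimes>\<^bsub>monoid_algebra M\<^esub> h = f \<otimes>\<^bsub>monoid_algebra M\<^esub> (g \<otimes>\<^bsub>monoid_algebra M\<^esub> h)"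
  using assms(2)
proof (induction rule: monoid_algebra_induct)
  interpret monoid M by fact
  case (single x c)
  from g show ?case
  proof (induction rule: monoid_algebra_induct)
    case s: (single y d)
    from h show ?case
    proof (induction rule: monoid_algebra_induct)
      case (single z e) then show ?case using s \<open>x \<in> carrier M\<close> by (simp add: m_assoc mult.assoc)
    qed (simp_all add: monoid_algebra_mult_add)
  qed (simp_all add: monoid_algebra_mult_add monoid_algebra_add_mult)
qed (simp_all add: monoid_algebra_add_mult)

lemma map_scale_add:
  "Poly_Mapping.map ((*) (c::'k::field)) (f + g) = Poly_Mapping.map ((*) c) f + Poly_Mapping.map ((*) c) g"
  by (rule poly_mapping_eqI) (simp add: lookup_add algebra_simps)

lemma map_scale_zero [simp]: "Poly_Mapping.map ((*) (c::'k::field)) 0 = 0"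
  by (rule poly_mapping_eqI) simp

lemma map_scale_single:
  "Poly_Mapping.map ((*) (c::'k::field)) (Poly_Mapping.single x d) = Poly_Mapping.single x (c * d)"
  by simp

lemma map_scale_mult:
  assumes "f \<in> carrier (monoid_algebra M)" and g: "g \<in> carrier (monoid_algebra M)"
  shows "Poly_Mapping.map ((*) c) f \<otimes>\<^bsub>monoid_algebra M\<^esub> g = Poly_Mapping.map ((*) c) (f \<otimes>\<^bsub>monoid_algebra M\<^esub> g)"
    "f \<otimes>\<^bsub>monoid_algebra M\<^esub> Poly_Mapping.map ((*) c) g = Poly_Mapping.map ((*) c) (f \<otimes>\<^bsub>monoid_algebra M\<^esub> g)"
proof -
  show "Poly_Mapping.map ((*) c) f \<otimes>\<^bsub>monoid_algebra M\<^esub> g = Poly_Mapping.map ((*) c) (f \<otimes>\<^bsub>monoid_algebra M\<^esub> g)"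
    using assms(1)
  proof (induction rule: monoid_algebra_induct)
    case (single x d)
    from g show ?case
      by (induction rule: monoid_algebra_induct)
        (simp_all add: monoid_algebra_mult_add map_scale_add mult.assoc)
  qed (simp_all add: monoid_algebra_add_mult map_scale_add)
  show "f \<otimes>\<^bsub>monoid_algebra M\<^esub> Poly_Mapping.map ((*) c) g = Poly_Mapping.map ((*) c) (f \<otimes>\<^bsub>monoid_algebra M\<^esub> g)"
    using assms(1)
  proof (induction rule: monoid_algebra_induct)
    case (single x d)
    from g show ?case
      by (induction rule: monoid_algebra_induct)
        (simp_all add: monoid_algebra_mult_add map_scale_add mult.left_commute)
  qed (simp_all add: monoid_algebra_add_mult map_scale_add)
qed

lemma assoc_algebra_monoid_algebra:
  assumes M: "monoid M"
  shows "assoc_algebra (monoid_algebra M :: ('k::field, _) module)"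
proof -
  interpret M: monoid M by fact
  let ?A = "monoid_algebra M :: ('k::field, _) module"
  note cl = monoid_algebra_closed[OF M]
  have one_l: "monomial \<one>\<^bsub>M\<^esub> \<otimes>\<^bsub>?A\<^esub> f = f" if "f \<in> carrier ?A" for f
    using that by (induction rule: monoid_algebra_induct) (simp_all add: monoid_algebra_mult_add)
  have one_r: "f \<otimes>\<^bsub>?A\<^esub> monomial \<one>\<^bsub>M\<^esub> = f" if "f \<in> carrier ?A" for f
    using that by (induction rule: monoid_algebra_induct) (simp_all add: monoid_algebra_add_mult)
  have "ring ?A"
  proof (rule ringI)
    show "abelian_group ?A"
    proof (rule abelian_groupI)
      fix x assume "x \<in> carrier ?A"
      then show "\<exists>y\<in>carrier ?A. y \<oplus>\<^bsub>?A\<^esub> x = \<zero>\<^bsub>?A\<^esub>"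
        by (intro bexI[of _ "- x"]) (simp_all add: cl)
    qed (use cl in \<open>auto simp: add_ac\<close>, simp add: carrier_monoid_algebra)
    show "Group.monoid ?A"
      by (rule monoidI) (simp_all add: cl one_l one_r monoid_algebra_assoc[OF M])
  qed (simp_all add: monoid_algebra_mult_add monoid_algebra_add_mult)
  then show ?thesis
    by (auto simp: assoc_algebra_def assoc_algebra_axioms_def cl map_scale_mult map_scale_add
        intro!: poly_mapping_eqI simp: lookup_add distrib_right)
qed

lemma (in assoc_algebra) smult_zero [simp]: "c \<odot> \<zero> = \<zero>"
proof -
  have "c \<odot> \<zero> \<oplus> c \<odot> \<zero> = c \<odot> \<zero>" using smult_r_distr[of \<zero> \<zero> c] by simp
  then show ?thesis by (metis smult_closed zero_closed add.l_cancel_one)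
qed

lemma (in assoc_algebra) zero_smult [simp]: "x \<in> carrier A \<Longrightarrow> 0 \<odot> x = \<zero>"
proof -
  assume x: "x \<in> carrier A"
  have "0 \<odot> x \<oplus> 0 \<odot> x = 0 \<odot> x" using smult_l_distr[of x 0 0] x by simp
  then show ?thesis using x by (metis smult_closed add.l_cancel_one)
qed

lemma (in assoc_algebra) smult_as_mult: "x \<in> carrier A \<Longrightarrow> c \<odot> x = (c \<odot> \<one>) \<otimes> x"
  by (simp add: smult_mult_left)

lemma (in assoc_algebra) smult_minus: "x \<in> carrier A \<Longrightarrow> c \<odot> (\<ominus> x) = \<ominus> (c \<odot> x)"
  by (metis a_inv_closed add.inv_equality l_neg smult_closed smult_r_distr smult_zero)

lemma (in assoc_algebra) ideal_smult: "\<lbrakk>ideal I A; x \<in> I\<rbrakk> \<Longrightarrow> c \<odot> x \<in> I"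
  using ideal.I_l_closed[of I A x "c \<odot> \<one>"] ideal.Icarr[of I A x] smult_as_mult[of x c] by simp

locale algebra_ideal = assoc_algebra A + ideal I A for I and A (structure)
begin

lemma coset_eq_iff:
  assumes "x \<in> carrier A" "y \<in> carrier A"
  shows "I +> x = I +> y \<longleftrightarrow> x \<ominus> y \<in> I"
  using a_rcos_module[of y x] a_repr_independence'[of x y] a_rcos_self[of x] assms
  by (auto simp: a_minus_def)

lemma coset_closed [simp]: "x \<in> carrier A \<Longrightarrow> I +> x \<in> carrier (quotient_algebra A I)"
  by (simp add: quotient_algebra_def FactRing_def a_rcosetsI a_subset)

lemma coset_cases:
  assumes "X \<in> carrier (quotient_algebra A I)"
  obtains x where "x \<in> carrier A" "X = I +> x"
  using assms by (auto simp: quotient_algebra_def FactRing_def A_RCOSETS_def' )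

lemma coset_ops:
  assumes "x \<in> carrier A" "y \<in> carrier A"
  shows "(I +> x) \<oplus>\<^bsub>quotient_algebra A I\<^esub> (I +> y) = I +> (x \<oplus> y)"
    "(I +> x) \<otimes>\<^bsub>quotient_algebra A I\<^esub> (I +> y) = I +> (x \<otimes> y)"
  using assms by (simp_all add: quotient_algebra_def FactRing_def a_rcos_sum rcoset_mult_add)

lemma quotient_one: "\<one>\<^bsub>quotient_algebra A I\<^esub> = I +> \<one>"
  and quotient_zero: "\<zero>\<^bsub>quotient_algebra A I\<^esub> = I +> \<zero>"
  by (simp_all add: quotient_algebra_def FactRing_def a_coset_join2 a_subset is_additive_subgroup
      additive_subgroup.a_subgroup)

lemma UN_coset:
  assumes "x \<in> carrier A" "\<And>y. y \<in> I +> x \<Longrightarrow> f y = Z"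
  shows "(\<Union>y\<in>I +> x. f y) = Z"
  using assms a_rcos_self by blast

lemma coset_memD: "\<lbrakk>y \<in> I +> x; x \<in> carrier A\<rbrakk> \<Longrightarrow> y \<in> carrier A \<and> y \<ominus> x \<in> I"
  by (metis a_minus_def a_rcos_module_imp a_elemrcos_carrier)

lemma coset_smult:
  assumes "x \<in> carrier A"
  shows "c \<odot>\<^bsub>quotient_algebra A I\<^esub> (I +> x) = I +> (c \<odot> x)"
proof -
  have "I +> (c \<odot> y) = I +> (c \<odot> x)" if "y \<in> I +> x" for y
  proof -
    have y: "y \<in> carrier A" "y \<ominus> x \<in> I" using coset_memD[OF that assms] by auto
    have "c \<odot> y \<ominus> c \<odot> x = c \<odot> (y \<ominus> x)"
      using y assms by (simp add: a_minus_def smult_r_distr smult_minus)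
    then show ?thesis using y assms ideal_smult[OF ideal_axioms, of "y \<ominus> x" c]
      by (simp add: coset_eq_iff)
  qed
  then show ?thesis using UN_coset[OF assms, of "\<lambda>y. I +> (c \<odot> y)"]
    by (simp add: quotient_algebra_def)
qed

lemma assoc_algebra_quotient: "assoc_algebra (quotient_algebra A I)"
proof -
  have "ring (quotient_algebra A I)"
  proof -
    interpret Q: ring "A Quot I" by (rule quotient_is_ring)
    let ?Q = "quotient_algebra A I"
    have "carrier ?Q = carrier (A Quot I)" "add ?Q = add (A Quot I)" "mult ?Q = mult (A Quot I)"
      "one ?Q = one (A Quot I)" "zero ?Q = zero (A Quot I)"
      by (simp_all add: quotient_algebra_def)
    note e = this
    show ?thesis
    proof (rule ringI)
      show "abelian_group ?Q"
      proof (rule abelian_groupI)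
        fix x assume "x \<in> carrier ?Q"
        then show "\<exists>y\<in>carrier ?Q. y \<oplus>\<^bsub>?Q\<^esub> x = \<zero>\<^bsub>?Q\<^esub>"
          by (intro bexI[of _ "\<ominus>\<^bsub>A Quot I\<^esub> x"]) (simp_all add: e Q.l_neg)
      next
        fix x y z assume "x \<in> carrier ?Q" "y \<in> carrier ?Q" "z \<in> carrier ?Q"
        then show "x \<oplus>\<^bsub>?Q\<^esub> y \<oplus>\<^bsub>?Q\<^esub> z = x \<oplus>\<^bsub>?Q\<^esub> (y \<oplus>\<^bsub>?Q\<^esub> z)"
          by (simp only: e Q.a_assoc)
      next
        fix x y assume "x \<in> carrier ?Q" "y \<in> carrier ?Q"
        then show "x \<oplus>\<^bsub>?Q\<^esub> y = y \<oplus>\<^bsub>?Q\<^esub> x"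
          by (simp only: e Q.a_comm)
      qed (simp_all add: e)
      show "Group.monoid ?Q"
        by (rule monoidI) (simp_all add: e Q.m_assoc)
    qed (simp_all add: e Q.l_distr Q.r_distr)
  qed
  moreover have "assoc_algebra_axioms (quotient_algebra A I)"
    by unfold_locales
      (auto elim!: coset_cases simp: coset_smult coset_ops smult_l_distr smult_r_distr smult_assoc
        smult_mult_left smult_mult_right)
  ultimately show ?thesis by (simp add: assoc_algebra_def)
qed

end

section \<open>Homomorphisms out of monoid algebras and quotients\<close>

lemma alg_homI:
  assumes "\<And>x. x \<in> carrier A \<Longrightarrow> h x \<in> carrier B"
    and "\<And>x y. \<lbrakk>x \<in> carrier A; y \<in> carrier A\<rbrakk> \<Longrightarrow> h (x \<otimes>\<^bsub>A\<^esub> y) = h x \<otimes>\<^bsub>B\<^esub> h y"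
    and "\<And>x y. \<lbrakk>x \<in> carrier A; y \<in> carrier A\<rbrakk> \<Longrightarrow> h (x \<oplus>\<^bsub>A\<^esub> y) = h x \<oplus>\<^bsub>B\<^esub> h y"
    and "h \<one>\<^bsub>A\<^esub> = \<one>\<^bsub>B\<^esub>"
    and "\<And>c x. x \<in> carrier A \<Longrightarrow> h (c \<odot>\<^bsub>A\<^esub> x) = c \<odot>\<^bsub>B\<^esub> h x"
  shows "h \<in> alg_hom A B"
  using assms by (auto simp: alg_hom_def intro!: ring_hom_memI)

lemma alg_homD:
  assumes "h \<in> alg_hom A B"
  shows "\<And>x. x \<in> carrier A \<Longrightarrow> h x \<in> carrier B"
    and "\<And>x y. \<lbrakk>x \<in> carrier A; y \<in> carrier A\<rbrakk> \<Longrightarrow> h (x \<otimes>\<^bsub>A\<^esub> y) = h x \<otimes>\<^bsub>B\<^esub> h y"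
    and "\<And>x y. \<lbrakk>x \<in> carrier A; y \<in> carrier A\<rbrakk> \<Longrightarrow> h (x \<oplus>\<^bsub>A\<^esub> y) = h x \<oplus>\<^bsub>B\<^esub> h y"
    and "h \<one>\<^bsub>A\<^esub> = \<one>\<^bsub>B\<^esub>"
    and "\<And>c x. x \<in> carrier A \<Longrightarrow> h (c \<odot>\<^bsub>A\<^esub> x) = c \<odot>\<^bsub>B\<^esub> h x"
  using assms by (auto simp: alg_hom_def ring_hom_memE)

lemma alg_hom_ring_hom_ring:
  assumes "assoc_algebra A" "assoc_algebra B" "h \<in> alg_hom A B"
  shows "ring_hom_ring A B h"
  using assms by (intro ring_hom_ringI2) (auto simp: assoc_algebra_def alg_hom_def)

lemma alg_hom_zero:
  assumes "assoc_algebra A" "assoc_algebra B" "h \<in> alg_hom A B"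
  shows "h \<zero>\<^bsub>A\<^esub> = \<zero>\<^bsub>B\<^esub>"
proof -
  interpret ring_hom_ring A B h by (rule alg_hom_ring_hom_ring) fact+
  show ?thesis by simp
qed

lemma alg_hom_minus:
  assumes "assoc_algebra A" "assoc_algebra B" "h \<in> alg_hom A B" "x \<in> carrier A" "y \<in> carrier A"
  shows "h (x \<ominus>\<^bsub>A\<^esub> y) = h x \<ominus>\<^bsub>B\<^esub> h y"
proof -
  interpret ring_hom_ring A B h by (rule alg_hom_ring_hom_ring) fact+
  show ?thesis using assms by (simp add: a_minus_def)
qed

lemma monoid_algebra_minus:
  assumes "monoid M" "x \<in> carrier (monoid_algebra M)" "y \<in> carrier (monoid_algebra M)"
  shows "x \<ominus>\<^bsub>monoid_algebra M\<^esub> y = x - (y :: _ \<Rightarrow>\<^sub>0 'k::field)"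
proof -
  interpret A: assoc_algebra "monoid_algebra M :: ('k, _) module"
    by (rule assoc_algebra_monoid_algebra) fact
  have "\<ominus>\<^bsub>monoid_algebra M\<^esub> y = - y"
    by (rule A.minus_equality) (use assms in \<open>auto simp: monoid_algebra_closed\<close>)
  then show ?thesis by (simp add: a_minus_def)
qed

lemma monoid_algebra_lift:
  fixes B :: "('k::field, 'b, 'z) module_scheme"
  assumes M: "monoid M" and B: "assoc_algebra B"
    and cl: "\<And>x. x \<in> carrier M \<Longrightarrow> \<phi> x \<in> carrier B"
    and mul: "\<And>x y. \<lbrakk>x \<in> carrier M; y \<in> carrier M\<rbrakk> \<Longrightarrow> \<phi> (x \<otimes>\<^bsub>M\<^esub> y) = \<phi> x \<otimes>\<^bsub>B\<^esub> \<phi> y"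
    and one: "\<phi> \<one>\<^bsub>M\<^esub> = \<one>\<^bsub>B\<^esub>"
  obtains h where "h \<in> alg_hom (monoid_algebra M) B"
    "\<And>x c. x \<in> carrier M \<Longrightarrow> h (Poly_Mapping.single x c) = c \<odot>\<^bsub>B\<^esub> \<phi> x"
proof -
  interpret M: monoid M by fact
  interpret B: assoc_algebra B by fact
  let ?A = "monoid_algebra M :: ('k, _) module"
  note mcl = monoid_algebra_closed[OF M]
  define h where "h f = finsum B (\<lambda>x. Poly_Mapping.lookup f x \<odot>\<^bsub>B\<^esub> \<phi> x) (Poly_Mapping.keys f)"
    for f :: "_ \<Rightarrow>\<^sub>0 'k"
  have h_sup: "h f = finsum B (\<lambda>x. Poly_Mapping.lookup f x \<odot>\<^bsub>B\<^esub> \<phi> x) S"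
    if "finite S" "Poly_Mapping.keys f \<subseteq> S" "S \<subseteq> carrier M" for f S
    unfolding h_def using that cl
    by (intro B.add.finprod_mono_neutral_cong_left) (auto simp: in_keys_iff subset_iff)
  have h_cl: "h f \<in> carrier B" if "f \<in> carrier ?A" for f
    unfolding h_def using that cl by (intro B.finsum_closed) (auto simp: carrier_monoid_algebra)
  have h_add: "h (f + g) = h f \<oplus>\<^bsub>B\<^esub> h g" if f: "f \<in> carrier ?A" and g: "g \<in> carrier ?A" for f g
  proof -
    let ?S = "Poly_Mapping.keys f \<union> Poly_Mapping.keys g"
    have S: "?S \<subseteq> carrier M" using f g by (auto simp: carrier_monoid_algebra)
    have "h (f + g) = finsum B (\<lambda>x. Poly_Mapping.lookup (f + g) x \<odot>\<^bsub>B\<^esub> \<phi> x) ?S"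
      using S Poly_Mapping.keys_add[of f g] by (intro h_sup) auto
    also have "\<dots> = finsum B (\<lambda>x. Poly_Mapping.lookup f x \<odot>\<^bsub>B\<^esub> \<phi> x \<oplus>\<^bsub>B\<^esub> Poly_Mapping.lookup g x \<odot>\<^bsub>B\<^esub> \<phi> x) ?S"
      using S cl by (intro B.finsum_cong') (auto simp: lookup_add B.smult_l_distr)
    also have "\<dots> = finsum B (\<lambda>x. Poly_Mapping.lookup f x \<odot>\<^bsub>B\<^esub> \<phi> x) ?S
       \<oplus>\<^bsub>B\<^esub> finsum B (\<lambda>x. Poly_Mapping.lookup g x \<odot>\<^bsub>B\<^esub> \<phi> x) ?S"
      using S cl by (intro B.finsum_addf) auto
    also have "\<dots> = h f \<oplus>\<^bsub>B\<^esub> h g" using S by (simp add: h_sup[of ?S])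
    finally show ?thesis .
  qed
  have h_single: "h (Poly_Mapping.single x c) = c \<odot>\<^bsub>B\<^esub> \<phi> x" if "x \<in> carrier M" for x c
    using that cl by (subst h_sup[of "{x}"]) (auto simp: B.finsum_insert)
  have h0: "h 0 = \<zero>\<^bsub>B\<^esub>" by (simp add: h_def)
  have h_smult: "h (Poly_Mapping.map ((*) c) f) = c \<odot>\<^bsub>B\<^esub> h f" if "f \<in> carrier ?A" for c f
    using that
    by (induction rule: monoid_algebra_induct)
      (simp_all add: h0 h_single cl B.smult_assoc map_scale_add h_add mcl h_cl B.smult_r_distr)
  have h_mult: "h (f \<otimes>\<^bsub>?A\<^esub> g) = h f \<otimes>\<^bsub>B\<^esub> h g" if "f \<in> carrier ?A" "g \<in> carrier ?A" for f g
    using that(1)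
  proof (induction rule: monoid_algebra_induct)
    case (single x c)
    from that(2) show ?case
    proof (induction rule: monoid_algebra_induct)
      case s: (single y d)
      then show ?case using single cl
        by (simp add: h_single mul B.smult_mult_left B.smult_mult_right B.smult_assoc[symmetric] mult.commute)
    next
      case (add f g)
      then show ?case using single cl
        by (simp add: monoid_algebra_mult_add h_add mcl h_single B.r_distr h_cl)
    qed (use single cl in \<open>simp add: h0 h_single\<close>)
  next
    case (add f g')
    then show ?case using that(2) by (simp add: monoid_algebra_add_mult h_add mcl B.l_distr h_cl)
  qed (use that h_cl in \<open>simp add: h0\<close>)
  have "h \<in> alg_hom ?A B"
    by (rule alg_homI) (simp_all add: h_cl h_mult h_add h_smult h_single one)
  then show ?thesis using that h_single by blast
qed

lemma monoid_algebra_hom_eqI: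
  fixes h h' :: "('m \<Rightarrow>\<^sub>0 'k::field) \<Rightarrow> 'b"
  assumes "monoid M" "assoc_algebra B"
    and h: "h \<in> alg_hom (monoid_algebra M) B" and h': "h' \<in> alg_hom (monoid_algebra M) B"
    and eq: "\<And>x. x \<in> carrier M \<Longrightarrow> h (monomial x) = h' (monomial x)"
    and f: "f \<in> carrier (monoid_algebra M)"
  shows "h f = h' f"
  using f
proof (induction rule: monoid_algebra_induct)
  case zero
  have "h 0 = \<zero>\<^bsub>B\<^esub>" if "h \<in> alg_hom (monoid_algebra M) B" for h :: "('m \<Rightarrow>\<^sub>0 'k) \<Rightarrow> 'b"
    using alg_hom_zero[OF assoc_algebra_monoid_algebra[OF assms(1)] assms(2) that] by simp
  from this[OF h] this[OF h'] show ?case by simp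
next
  case (single x c)
  have "h (Poly_Mapping.single x c) = c \<odot>\<^bsub>B\<^esub> h (monomial x)" if "h \<in> alg_hom (monoid_algebra M) B" for h :: "('m \<Rightarrow>\<^sub>0 'k) \<Rightarrow> 'b"
    using alg_homD(5)[OF that, of "monomial x" c] single by simp
  from this[OF h] this[OF h'] show ?case using eq[OF single] by simp
next
  case (add f g) then show ?case using alg_homD(3)[OF h] alg_homD(3)[OF h'] by simp
qed

lemma word_monoid: "monoid \<lparr>carrier = lists X, mult = (@), one = []\<rparr>"
  by (rule monoidI) auto

lemma assoc_algebra_free: "assoc_algebra (free_algebra X)"
  unfolding free_algebra_def by (rule assoc_algebra_monoid_algebra word_monoid)+

lemma free_algebra_lift:
  fixes B :: "('k::field, 'b, 'z) module_scheme"
  assumes B: "assoc_algebra B" and cl: "\<And>x. x \<in> X \<Longrightarrow> \<phi> x \<in> carrier B"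
  obtains h where "h \<in> alg_hom (free_algebra X) B"
    "\<And>w c. w \<in> lists X \<Longrightarrow> h (Poly_Mapping.single w c) = c \<odot>\<^bsub>B\<^esub> foldr (\<lambda>x y. \<phi> x \<otimes>\<^bsub>B\<^esub> y) w \<one>\<^bsub>B\<^esub>"
proof -
  interpret B: assoc_algebra B by fact
  let ?M = "\<lparr>carrier = lists X, mult = (@), one = []\<rparr>"
  let ?\<psi> = "\<lambda>w. foldr (\<lambda>x y. \<phi> x \<otimes>\<^bsub>B\<^esub> y) w \<one>\<^bsub>B\<^esub>"
  have c: "?\<psi> w \<in> carrier B" if "w \<in> lists X" for w
    using that by (induction w) (auto simp: cl)
  have m: "?\<psi> (v @ w) = ?\<psi> v \<otimes>\<^bsub>B\<^esub> ?\<psi> w" if "v \<in> lists X" "w \<in> lists X" for v w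
    using that(1)
  proof (induction v)
    case Nil then show ?case using c[OF that(2)] by simp
  next
    case (Cons x v) then show ?case using cl c that by (auto simp: B.m_assoc)
  qed
  obtain h where "h \<in> alg_hom (monoid_algebra ?M) B"
    "\<And>w c. w \<in> carrier ?M \<Longrightarrow> h (Poly_Mapping.single w c) = c \<odot>\<^bsub>B\<^esub> ?\<psi> w"
    by (rule monoid_algebra_lift[OF word_monoid B, of X ?\<psi>]) (use c m in auto)
  then show ?thesis using that unfolding free_algebra_def by auto
qed

lemma free_algebra_hom_eqI:
  fixes h h' :: "('x list \<Rightarrow>\<^sub>0 'k::field) \<Rightarrow> 'b"
  assumes B: "assoc_algebra B"
    and h: "h \<in> alg_hom (free_algebra X) B" and h': "h' \<in> alg_hom (free_algebra X) B"
    and eq: "\<And>x. x \<in> X \<Longrightarrow> h (monomial [x]) = h' (monomial [x])"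
    and f: "f \<in> carrier (free_algebra X)"
  shows "h f = h' f"
proof (rule monoid_algebra_hom_eqI[OF word_monoid B h[unfolded free_algebra_def] h'[unfolded free_algebra_def] _ f[unfolded free_algebra_def]])
  let ?M = "\<lparr>carrier = lists X, mult = (@), one = []\<rparr>"
  fix w assume "w \<in> carrier ?M"
  then have "w \<in> lists X" by simp
  then show "h (monomial w) = h' (monomial w)"
  proof (induction w)
    case Nil
    show ?case using alg_homD(4)[OF h] alg_homD(4)[OF h'] by (simp add: free_algebra_def)
  next
    case (Cons x w)
    have "h (monomial (x # w)) = h (monomial [x]) \<otimes>\<^bsub>B\<^esub> h (monomial w)"
      if "h \<in> alg_hom (free_algebra X) B" for h :: "('x list \<Rightarrow>\<^sub>0 'k) \<Rightarrow> 'b"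
      using alg_homD(2)[OF that, of "monomial [x]" "monomial w"] Cons
      by (simp add: free_algebra_def carrier_monoid_algebra)
    from this[OF h] this[OF h'] show ?case using eq Cons by simp
  qed
qed

lemma genideal_algebra_ideal:
  assumes "assoc_algebra A" "S \<subseteq> carrier A"
  shows "algebra_ideal (Idl\<^bsub>A\<^esub> S) A"
  using assms ring.genideal_ideal[of A S] by (simp add: algebra_ideal_def assoc_algebra_def)

lemma (in assoc_algebra) minus_eq_zero_iff:
  assumes "x \<in> carrier A" "y \<in> carrier A"
  shows "x \<ominus> y = \<zero> \<longleftrightarrow> x = y"
  using assms minus_equality[of x "\<ominus> y"] by (auto simp: a_minus_def r_neg)

lemma quotient_lift:
  assumes A: "assoc_algebra A" and S: "S \<subseteq> carrier A" and B: "assoc_algebra B"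
    and h: "h \<in> alg_hom A B" and z: "\<And>x. x \<in> S \<Longrightarrow> h x = \<zero>\<^bsub>B\<^esub>"
  obtains h' where "h' \<in> alg_hom (quotient_algebra A (Idl\<^bsub>A\<^esub> S)) B"
    "\<And>x. x \<in> carrier A \<Longrightarrow> h' (Idl\<^bsub>A\<^esub> S +>\<^bsub>A\<^esub> x) = h x"
proof -
  let ?I = "Idl\<^bsub>A\<^esub> S"
  interpret I: algebra_ideal ?I A by (rule genideal_algebra_ideal) fact+
  interpret B: assoc_algebra B by fact
  interpret h: ring_hom_ring A B h by (rule alg_hom_ring_hom_ring) fact+
  have "S \<subseteq> a_kernel A B h"
  proof
    fix x assume "x \<in> S"
    with S z show "x \<in> a_kernel A B h" unfolding a_kernel_def' by blast
  qed
  then have sub: "?I \<subseteq> a_kernel A B h" by (rule I.genideal_minimal[OF h.kernel_is_ideal])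
  have ker: "h x = \<zero>\<^bsub>B\<^esub>" if "x \<in> ?I" for x
    using subsetD[OF sub that] unfolding a_kernel_def' by blast
  define h' where "h' X = the_elem (h ` X)" for X
  have h': "h' (?I +>\<^bsub>A\<^esub> x) = h x" if x: "x \<in> carrier A" for x
  proof -
    have "h y = h x" if "y \<in> ?I +>\<^bsub>A\<^esub> x" for y
    proof -
      have y: "y \<in> carrier A" "y \<ominus>\<^bsub>A\<^esub> x \<in> ?I" using I.coset_memD[OF that x] by auto
      have "h y \<ominus>\<^bsub>B\<^esub> h x = \<zero>\<^bsub>B\<^esub>" using ker[OF y(2)] alg_hom_minus[OF A B h y(1) x] by simp
      then show ?thesis using x y by (simp add: B.minus_eq_zero_iff)
    qed
    then have "h ` (?I +>\<^bsub>A\<^esub> x) = {h x}" using I.a_rcos_self[OF x] by blast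
    then show ?thesis by (simp add: h'_def)
  qed
  have "h' \<in> alg_hom (quotient_algebra A ?I) B"
  proof (rule alg_homI)
    fix X assume "X \<in> carrier (quotient_algebra A ?I)"
    then show "h' X \<in> carrier B" by (auto elim!: I.coset_cases simp: h')
  next
    fix X Y assume "X \<in> carrier (quotient_algebra A ?I)" "Y \<in> carrier (quotient_algebra A ?I)"
    then show "h' (X \<otimes>\<^bsub>quotient_algebra A ?I\<^esub> Y) = h' X \<otimes>\<^bsub>B\<^esub> h' Y"
      by (auto elim!: I.coset_cases simp: h' I.coset_ops)
  next
    fix X Y assume "X \<in> carrier (quotient_algebra A ?I)" "Y \<in> carrier (quotient_algebra A ?I)"
    then show "h' (X \<oplus>\<^bsub>quotient_algebra A ?I\<^esub> Y) = h' X \<oplus>\<^bsub>B\<^esub> h' Y"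
      by (auto elim!: I.coset_cases simp: h' I.coset_ops)
  next
    show "h' \<one>\<^bsub>quotient_algebra A ?I\<^esub> = \<one>\<^bsub>B\<^esub>" by (simp add: I.quotient_one h')
  next
    fix c X assume "X \<in> carrier (quotient_algebra A ?I)"
    then show "h' (c \<odot>\<^bsub>quotient_algebra A ?I\<^esub> X) = c \<odot>\<^bsub>B\<^esub> h' X"
      by (auto elim!: I.coset_cases simp: h' I.coset_smult alg_homD(5)[OF h])
  qed
  then show ?thesis using that h' by blast
qed

lemma coset_alg_hom:
  assumes "algebra_ideal I A"
  shows "(+>\<^bsub>A\<^esub>) I \<in> alg_hom A (quotient_algebra A I)"
proof -
  interpret algebra_ideal I A by fact
  show ?thesis by (rule alg_homI) (simp_all add: coset_ops coset_smult quotient_one)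
qed

lemma alg_hom_comp:
  assumes "f \<in> alg_hom A B" "g \<in> alg_hom B C"
  shows "g \<circ> f \<in> alg_hom A C"
  by (rule alg_homI) (use assms in \<open>simp_all add: alg_homD[OF assms(1)] alg_homD[OF assms(2)]\<close>)

section \<open>Universal property of the Poisson enveloping algebra\<close>

lemma assoc_algebra_poisson_env_free: "assoc_algebra (poisson_env_free P)"
  by (simp add: poisson_env_free_def assoc_algebra_free)

lemma poisson_env_free_minus:
  assumes "x \<in> carrier (poisson_env_free P)" "y \<in> carrier (poisson_env_free P)"
  shows "x \<ominus>\<^bsub>poisson_env_free P\<^esub> y = x - y" "x + y \<in> carrier (poisson_env_free P)"
     "x - y \<in> carrier (poisson_env_free P)"
  using assms unfolding poisson_env_free_def free_algebra_def
  by (simp_all add: monoid_algebra_minus monoid_algebra_closed word_monoid)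

lemma single_env_free [simp]:
  "set w \<subseteq> Alpha ` carrier P \<union> Beta ` carrier P \<Longrightarrow>
    Poly_Mapping.single w c \<in> carrier (poisson_env_free P)"
  by (auto simp: poisson_env_free_def free_algebra_def carrier_monoid_algebra)

lemma poisson_env_relations_carrier:
  assumes "poisson_algebra P"
  shows "poisson_env_relations P \<subseteq> carrier (poisson_env_free P)"
proof -
  interpret poisson_algebra P by fact
  show ?thesis unfolding poisson_env_relations_def
    by (auto intro!: poisson_env_free_minus(2,3))
qed

lemma poisson_env_relationsI:
  assumes "a \<in> carrier P" "b \<in> carrier P"
  shows
    "monomial [Alpha (a \<oplus>\<^bsub>P\<^esub> b)] - (monomial [Alpha a] + monomial [Alpha b]) \<in> poisson_env_relations P"
    "monomial [Alpha (c \<odot>\<^bsub>P\<^esub> a)] - Poly_Mapping.single [Alpha a] c \<in> poisson_env_relations P"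
    "monomial [Alpha (a \<otimes>\<^bsub>P\<^esub> b)] - monomial [Alpha a, Alpha b] \<in> poisson_env_relations P"
    "monomial [Beta (a \<oplus>\<^bsub>P\<^esub> b)] - (monomial [Beta a] + monomial [Beta b]) \<in> poisson_env_relations P"
    "monomial [Beta (c \<odot>\<^bsub>P\<^esub> a)] - Poly_Mapping.single [Beta a] c \<in> poisson_env_relations P"
    "monomial [Beta \<lbrace>a, b\<rbrace>\<^bsub>P\<^esub>] - (monomial [Beta a, Beta b] - monomial [Beta b, Beta a])
      \<in> poisson_env_relations P"
    "monomial [Alpha \<lbrace>a, b\<rbrace>\<^bsub>P\<^esub>] - (monomial [Beta a, Alpha b] - monomial [Alpha b, Beta a])
      \<in> poisson_env_relations P"
    "monomial [Beta (a \<otimes>\<^bsub>P\<^esub> b)] - (monomial [Beta a, Alpha b] + monomial [Alpha a, Beta b])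
      \<in> poisson_env_relations P"
  using assms unfolding poisson_env_relations_def by blast+

lemma poisson_env_free_ops [simp]:
  "add (poisson_env_free P) = (+)"
  "smult (poisson_env_free P) c = Poly_Mapping.map ((*) c)"
  "\<one>\<^bsub>poisson_env_free P\<^esub> = monomial []"
  "Poly_Mapping.single v c \<otimes>\<^bsub>poisson_env_free P\<^esub> Poly_Mapping.single w d = Poly_Mapping.single (v @ w) (c * d)"
  by (simp_all add: poisson_env_free_def free_algebra_def)

context
  fixes P :: "('k::field, 'p, 'z) poisson_scheme"
  assumes P: "poisson_algebra P"
begin

interpretation P: poisson_algebra P by (rule P)
interpretation I: algebra_ideal "poisson_env_ideal P" "poisson_env_free P"
  unfolding poisson_env_ideal_def
  by (intro genideal_algebra_ideal assoc_algebra_poisson_env_free poisson_env_relations_carrier P)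

lemma assoc_algebra_poisson_env: "assoc_algebra (poisson_env P)"
  unfolding poisson_env_def by (rule I.assoc_algebra_quotient)

lemma poisson_env_rel_eq:
  assumes "x - y \<in> poisson_env_relations P" "x \<in> carrier (poisson_env_free P)" "y \<in> carrier (poisson_env_free P)"
  shows "poisson_env_ideal P +>\<^bsub>poisson_env_free P\<^esub> x = poisson_env_ideal P +>\<^bsub>poisson_env_free P\<^esub> y"
proof -
  have "x - y \<in> poisson_env_ideal P"
    using assms(1) I.genideal_self[OF poisson_env_relations_carrier[OF P]]
    by (auto simp: poisson_env_ideal_def)
  then show ?thesis using assms(2,3) by (simp add: I.coset_eq_iff poisson_env_free_minus)
qed

lemma poisson_compatible_poisson_env:
  "poisson_compatible P (poisson_env P) (poisson_env_alpha P) (poisson_env_beta P)"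
proof -
  let ?F = "poisson_env_free P" and ?I = "poisson_env_ideal P"
  have U: "poisson_env P = quotient_algebra ?F ?I" by (simp add: poisson_env_def)
  interpret U: assoc_algebra "poisson_env P" by (rule assoc_algebra_poisson_env)
  have minus: "(?I +>\<^bsub>?F\<^esub> x) \<ominus>\<^bsub>poisson_env P\<^esub> (?I +>\<^bsub>?F\<^esub> y) = ?I +>\<^bsub>?F\<^esub> (x - y)"
    if "x \<in> carrier ?F" "y \<in> carrier ?F" for x y
    using alg_hom_minus[OF assoc_algebra_poisson_env_free _ coset_alg_hom[OF I.algebra_ideal_axioms] that]
      that assoc_algebra_poisson_env
    by (simp add: U poisson_env_free_minus)
  have add: "(?I +>\<^bsub>?F\<^esub> x) \<oplus>\<^bsub>poisson_env P\<^esub> (?I +>\<^bsub>?F\<^esub> y) = ?I +>\<^bsub>?F\<^esub> (x + y)"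
    if "x \<in> carrier ?F" "y \<in> carrier ?F" for x y using I.coset_ops[OF that] by (simp add: U)
  have sm: "c \<odot>\<^bsub>poisson_env P\<^esub> (?I +>\<^bsub>?F\<^esub> x) = ?I +>\<^bsub>?F\<^esub> Poly_Mapping.map ((*) c) x"
    if "x \<in> carrier ?F" for c x using I.coset_smult[OF that] by (simp add: U)
  have mult: "(?I +>\<^bsub>?F\<^esub> monomial v) \<otimes>\<^bsub>poisson_env P\<^esub> (?I +>\<^bsub>?F\<^esub> monomial w) = ?I +>\<^bsub>?F\<^esub> monomial (v @ w)"
    if "monomial v \<in> carrier ?F" "monomial w \<in> carrier ?F" for v w using I.coset_ops[OF that] by (simp add: U)
  note * = poisson_env_alpha_def poisson_env_beta_def add sm mult minus
  show ?thesis
    unfolding poisson_compatible_def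
  proof (intro conjI ballI allI alg_homI)
    show "poisson_env_alpha P \<one>\<^bsub>P\<^esub> = \<one>\<^bsub>poisson_env P\<^esub>"
      by (simp add: U I.quotient_one *)
        (rule poisson_env_rel_eq, auto simp: poisson_env_relations_def)
    show "poisson_env_beta P \<in> carrier P \<rightarrow> carrier (poisson_env P)" by (auto simp: U *)
    fix x assume x: "x \<in> carrier P"
    then show "poisson_env_alpha P x \<in> carrier (poisson_env P)" by (auto simp: U *)
    {
      fix c
      show "poisson_env_alpha P (c \<odot>\<^bsub>P\<^esub> x) = c \<odot>\<^bsub>poisson_env P\<^esub> poisson_env_alpha P x"
        "poisson_env_beta P (c \<odot>\<^bsub>P\<^esub> x) = c \<odot>\<^bsub>poisson_env P\<^esub> poisson_env_beta P x"
        by (simp_all add: * x) (rule poisson_env_rel_eq[OF poisson_env_relationsI(2)[OF x x]], use x in simp_all,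
          rule poisson_env_rel_eq[OF poisson_env_relationsI(5)[OF x x]], use x in simp_all)
    }
    fix y assume y: "y \<in> carrier P"
    show "poisson_env_alpha P (x \<otimes>\<^bsub>P\<^esub> y) = poisson_env_alpha P x \<otimes>\<^bsub>poisson_env P\<^esub> poisson_env_alpha P y"
     "poisson_env_alpha P (x \<oplus>\<^bsub>P\<^esub> y) = poisson_env_alpha P x \<oplus>\<^bsub>poisson_env P\<^esub> poisson_env_alpha P y"
     "poisson_env_beta P (x \<oplus>\<^bsub>P\<^esub> y) = poisson_env_beta P x \<oplus>\<^bsub>poisson_env P\<^esub> poisson_env_beta P y"
     "poisson_env_beta P \<lbrace>x, y\<rbrace>\<^bsub>P\<^esub> = poisson_env_beta P x \<otimes>\<^bsub>poisson_env P\<^esub> poisson_env_beta P y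
        \<ominus>\<^bsub>poisson_env P\<^esub> poisson_env_beta P y \<otimes>\<^bsub>poisson_env P\<^esub> poisson_env_beta P x"
     "poisson_env_beta P (x \<otimes>\<^bsub>P\<^esub> y) = poisson_env_beta P x \<otimes>\<^bsub>poisson_env P\<^esub> poisson_env_alpha P y
        \<oplus>\<^bsub>poisson_env P\<^esub> poisson_env_alpha P x \<otimes>\<^bsub>poisson_env P\<^esub> poisson_env_beta P y"
      using x y poisson_env_relationsI[OF x y, THEN poisson_env_rel_eq]
      by (simp_all add: * poisson_env_free_minus(2,3))
    show "poisson_env_beta P x \<otimes>\<^bsub>poisson_env P\<^esub> poisson_env_alpha P y
      \<ominus>\<^bsub>poisson_env P\<^esub> poisson_env_alpha P y \<otimes>\<^bsub>poisson_env P\<^esub> poisson_env_beta P x = poisson_env_alpha P \<lbrace>x, y\<rbrace>\<^bsub>P\<^esub>"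
      using x y poisson_env_relationsI(7)[OF x y, THEN poisson_env_rel_eq]
      by (simp add: * poisson_env_free_minus(2,3))
  qed
qed

lemma poisson_env_lift:
  assumes B: "assoc_algebra (B :: ('k, 'b, 'y) module_scheme)" and c: "poisson_compatible P B \<gamma> \<delta>"
  obtains h where "h \<in> alg_hom (poisson_env P) B"
    "\<And>a. a \<in> carrier P \<Longrightarrow> h (poisson_env_alpha P a) = \<gamma> a"
    "\<And>a. a \<in> carrier P \<Longrightarrow> h (poisson_env_beta P a) = \<delta> a"
proof -
  let ?F = "poisson_env_free P" and ?X = "Alpha ` carrier P \<union> Beta ` carrier P"
  interpret B: assoc_algebra B by fact
  note c' = c[unfolded poisson_compatible_def]
  have \<gamma>: "\<gamma> \<in> alg_hom P B" using c' by blast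
  have \<delta>: "\<delta> a \<in> carrier B" if "a \<in> carrier P" for a using c' that by blast
  define \<phi> where "\<phi> x = (case x of Alpha a \<Rightarrow> \<gamma> a | Beta a \<Rightarrow> \<delta> a)" for x
  have \<phi>: "\<phi> x \<in> carrier B" if "x \<in> ?X" for x
    using that alg_homD(1)[OF \<gamma>] \<delta> by (auto simp: \<phi>_def)
  obtain h where
    hF: "h \<in> alg_hom (free_algebra ?X) B" and hw':
    "\<And>w c. w \<in> lists ?X \<Longrightarrow> h (Poly_Mapping.single w c) = c \<odot>\<^bsub>B\<^esub> foldr (\<lambda>x y. \<phi> x \<otimes>\<^bsub>B\<^esub> y) w \<one>\<^bsub>B\<^esub>"
    using free_algebra_lift[of B ?X \<phi>, OF B \<phi>] by metis
  from hF have h: "h \<in> alg_hom ?F B" by (simp add: poisson_env_free_def)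
  have hw: "h (Poly_Mapping.single w c) = c \<odot>\<^bsub>B\<^esub> foldr (\<lambda>x y. \<phi> x \<otimes>\<^bsub>B\<^esub> y) w \<one>\<^bsub>B\<^esub>"
    if "set w \<subseteq> ?X" for w c using hw'[of w c] that by (auto simp: lists_eq_set)
  have hadd: "h (x + y) = h x \<oplus>\<^bsub>B\<^esub> h y" if "x \<in> carrier ?F" "y \<in> carrier ?F" for x y
    using alg_homD(3)[OF h that] by simp
  have hmin: "h (x - y) = h x \<ominus>\<^bsub>B\<^esub> h y" if "x \<in> carrier ?F" "y \<in> carrier ?F" for x y
    using alg_hom_minus[OF assoc_algebra_poisson_env_free B h that] that by (simp add: poisson_env_free_minus)
  have zero: "h (x - y) = \<zero>\<^bsub>B\<^esub>" if "x \<in> carrier ?F" "y \<in> carrier ?F" "h x = h y" for x y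
    using that by (simp add: hmin alg_homD(1)[OF h] B.minus_eq_zero_iff)
  note [simp] = alg_homD(1)[OF \<gamma>] \<delta>
  have "h x = \<zero>\<^bsub>B\<^esub>" if "x \<in> poisson_env_relations P" for x
    using that unfolding poisson_env_relations_def Un_iff
    apply (elim disjE)
            apply (use c' alg_homD(2-5)[OF \<gamma>] in \<open>clarsimp, intro zero; simp add: hadd hmin hw \<phi>_def poisson_env_free_minus(2,3) image_iff; fail\<close>)+
    done
  then obtain h' where h': "h' \<in> alg_hom (poisson_env P) B"
    "\<And>x. x \<in> carrier ?F \<Longrightarrow> h' (poisson_env_ideal P +>\<^bsub>?F\<^esub> x) = h x"
    using quotient_lift[OF assoc_algebra_poisson_env_free poisson_env_relations_carrier[OF P] B h]
    unfolding poisson_env_def poisson_env_ideal_def by metis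
  show ?thesis
    by (rule that[OF h'(1)])
      (simp_all add: poisson_env_alpha_def poisson_env_beta_def h'(2) hw \<phi>_def alg_homD(1)[OF \<gamma>] \<delta>)
qed

lemma poisson_env_hom_eqI:
  assumes B: "assoc_algebra (B :: ('k, 'b, 'y) module_scheme)"
    and h: "h \<in> alg_hom (poisson_env P) B" and h': "h' \<in> alg_hom (poisson_env P) B"
    and eq: "\<And>a. a \<in> carrier P \<Longrightarrow> h (poisson_env_alpha P a) = h' (poisson_env_alpha P a)"
     "\<And>a. a \<in> carrier P \<Longrightarrow> h (poisson_env_beta P a) = h' (poisson_env_beta P a)"
    and u: "u \<in> carrier (poisson_env P)"
  shows "h u = h' u"
proof -
  let ?F = "poisson_env_free P" and ?X = "Alpha ` carrier P \<union> Beta ` carrier P"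
  let ?q = "(+>\<^bsub>?F\<^esub>) (poisson_env_ideal P)"
  have q: "?q \<in> alg_hom (free_algebra ?X) (poisson_env P)"
    using coset_alg_hom[OF I.algebra_ideal_axioms] by (simp add: poisson_env_def poisson_env_free_def)
  obtain f where f: "f \<in> carrier ?F" "u = ?q f"
    using u unfolding poisson_env_def by (rule I.coset_cases)
  have "(h \<circ> ?q) f = (h' \<circ> ?q) f"
    by (rule free_algebra_hom_eqI[OF B alg_hom_comp[OF q h] alg_hom_comp[OF q h']])
      (use eq f in \<open>auto simp: poisson_env_free_def poisson_env_alpha_def poisson_env_beta_def\<close>)
  then show ?thesis using f by simp
qed

theorem poisson_env_universal:
  "universal_poisson_triple T P (poisson_env P) (poisson_env_alpha P) (poisson_env_beta P)"
  unfolding universal_poisson_triple_def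
proof (intro conjI allI impI assoc_algebra_poisson_env poisson_compatible_poisson_env)
  fix B :: "('k, 'b) module" and \<gamma> \<delta>
  assume "assoc_algebra B \<and> poisson_compatible P B \<gamma> \<delta>"
  then have B: "assoc_algebra B" and c: "poisson_compatible P B \<gamma> \<delta>" by auto
  interpret U: assoc_algebra "poisson_env P" by (rule assoc_algebra_poisson_env)
  have cl: "poisson_env_alpha P a \<in> carrier (poisson_env P)" "poisson_env_beta P a \<in> carrier (poisson_env P)"
    if "a \<in> carrier P" for a
    using that by (simp_all add: poisson_env_alpha_def poisson_env_beta_def poisson_env_def)
  obtain h where h: "h \<in> alg_hom (poisson_env P) B"
    "\<And>a. a \<in> carrier P \<Longrightarrow> h (poisson_env_alpha P a) = \<gamma> a"
    "\<And>a. a \<in> carrier P \<Longrightarrow> h (poisson_env_beta P a) = \<delta> a"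
    using poisson_env_lift[OF B c] by metis
  show "\<exists>!h. h \<in> alg_hom (poisson_env P) B \<and> h \<in> extensional (carrier (poisson_env P)) \<and>
    (\<forall>a\<in>carrier P. h (poisson_env_alpha P a) = \<gamma> a \<and> h (poisson_env_beta P a) = \<delta> a)"
  proof (rule ex1I[of _ "restrict h (carrier (poisson_env P))"], intro conjI ballI)
    show "restrict h (carrier (poisson_env P)) \<in> alg_hom (poisson_env P) B"
      by (rule alg_homI) (simp_all add: alg_homD[OF h(1)])
    fix h' assume h': "h' \<in> alg_hom (poisson_env P) B \<and> h' \<in> extensional (carrier (poisson_env P)) \<and>
      (\<forall>a\<in>carrier P. h' (poisson_env_alpha P a) = \<gamma> a \<and> h' (poisson_env_beta P a) = \<delta> a)"
    show "h' = restrict h (carrier (poisson_env P))"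
    proof (rule extensionalityI[of _ "carrier (poisson_env P)"])
      fix u assume u: "u \<in> carrier (poisson_env P)"
      have "h' u = h u" by (rule poisson_env_hom_eqI[OF B _ h(1) _ _ u]) (use h h' in auto)
      then show "h' u = restrict h (carrier (poisson_env P)) u" using u by simp
    qed (use h' in auto)
  qed (use h cl in auto)
qed

end

section \<open>The symmetric algebra is a Poisson algebra\<close>

lemma multiset_monoid: "monoid \<lparr>carrier = UNIV, mult = (+), one = {#}\<rparr>"
  by (rule monoidI) (auto simp: add_ac)

lemma carrier_poly_algebra [simp]: "carrier poly_algebra = UNIV"
  by (simp add: poly_algebra_def monoid_algebra_def)

lemma poly_algebra_mult [simp]: "mult poly_algebra = (*)"
proof (intro ext)
  fix f g :: "'g multiset \<Rightarrow>\<^sub>0 'k::field"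
  let ?M = "\<lparr>carrier = UNIV, mult = (+), one = {#}\<rparr> :: 'g multiset monoid"
  have f: "f \<in> carrier (monoid_algebra ?M)" and g: "g \<in> carrier (monoid_algebra ?M)"
    by (simp_all add: monoid_algebra_def)
  have "f \<otimes>\<^bsub>monoid_algebra ?M\<^esub> g = f * g"
    using f
  proof (induction rule: monoid_algebra_induct)
    case (single x c)
    from g show ?case
      by (induction rule: monoid_algebra_induct)
        (simp_all add: mult_single monoid_algebra_mult_add distrib_left)
  qed (simp_all add: monoid_algebra_add_mult distrib_right)
  then show "f \<otimes>\<^bsub>poly_algebra\<^esub> g = f * g" by (simp add: poly_algebra_def)
qed

lemma poly_algebra_ops [simp]:
  "add poly_algebra = (+)" "zero poly_algebra = 0" "one poly_algebra = 1"
  "smult poly_algebra c = Poly_Mapping.map ((*) c)"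
  by (simp_all add: poly_algebra_def flip: single_one)

lemma assoc_algebra_poly: "assoc_algebra poly_algebra"
  unfolding poly_algebra_def by (rule assoc_algebra_monoid_algebra multiset_monoid)+

lemma poly_algebra_minus [simp]: "f \<ominus>\<^bsub>poly_algebra\<^esub> g = f - g"
  unfolding poly_algebra_def
  by (rule monoid_algebra_minus[OF multiset_monoid]) (simp_all add: monoid_algebra_def)

lemma map_scale_eq: "Poly_Mapping.map ((*) c) f = Poly_Mapping.single {#} c * f"
  using mult_map_scale_conv_mult[of c f] by simp

lemma poly_induct [case_names scalar var add mult]:
  assumes "\<And>c. Q (Poly_Mapping.single {#} c)" "\<And>x. Q (monomial {#x#})"
    and "\<And>f g. \<lbrakk>Q f; Q g\<rbrakk> \<Longrightarrow> Q (f + g)" "\<And>f g. \<lbrakk>Q f; Q g\<rbrakk> \<Longrightarrow> Q (f * g)"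
  shows "Q (f :: 'g multiset \<Rightarrow>\<^sub>0 'k::field)"
proof -
  let ?M = "\<lparr>carrier = UNIV, mult = (+), one = {#}\<rparr> :: 'g multiset monoid"
  have f: "f \<in> carrier (monoid_algebra ?M)" by (simp add: monoid_algebra_def)
  then show ?thesis
  proof (induction rule: monoid_algebra_induct)
    case zero show ?case using assms(1)[of 0] by simp
  next
    case (single M c)
    show ?case
    proof (induction M)
      case empty show ?case by (rule assms)
    next
      case (add x M)
      show ?case using assms(4)[OF assms(2)[of x] add] by (simp add: mult_single)
    qed
  qed (use assms in auto)
qed

lemma mono_bracket_empty [simp]: "mono_bracket l M {#} = 0" "mono_bracket l {#} N = 0"
  by (simp_all add: mono_bracket_def)

lemma mono_bracket_single [simp]: "mono_bracket l {#x#} {#y#} = monomial {#l x y#}"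
  by (simp add: mono_bracket_def)

lemma sum_mset_mult_right:
  "(\<Sum>x\<in>#M. f x) * (c::'c::semiring_0) = (\<Sum>x\<in>#M. f x * c)"
  by (induction M) (auto simp: distrib_right)

lemma mono_bracket_plus_right:
  "(mono_bracket l M (N + N') :: _ \<Rightarrow>\<^sub>0 'k::field)
    = mono_bracket l M N * monomial N' + monomial N * mono_bracket l M N'"
proof -
  have 1: "(\<Sum>y\<in>#N. monomial (M - {#x#} + (N + N' - {#y#}) + {#l x y#}))
      = (\<Sum>y\<in>#N. monomial (M - {#x#} + (N - {#y#}) + {#l x y#}) * (monomial N' :: _ \<Rightarrow>\<^sub>0 'k))" for x
    by (intro arg_cong[where f = sum_mset] image_mset_cong) (auto simp: mult_single add_ac dest!: multi_member_split)
  have 2: "(\<Sum>y\<in>#N'. monomial (M - {#x#} + (N + N' - {#y#}) + {#l x y#}))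
      = (\<Sum>y\<in>#N'. monomial (M - {#x#} + (N' - {#y#}) + {#l x y#}) * (monomial N :: _ \<Rightarrow>\<^sub>0 'k))" for x
    by (intro arg_cong[where f = sum_mset] image_mset_cong) (auto simp: mult_single add_ac dest!: multi_member_split)
  show ?thesis
    unfolding mono_bracket_def image_mset_union sum_mset.union 1 2
    by (simp only: sum_mset.distrib flip: sum_mset_mult_right) (simp add: mult.commute)
qed

lemma mono_bracket_plus_left:
  "(mono_bracket l (M + M') N :: _ \<Rightarrow>\<^sub>0 'k::field)
    = mono_bracket l M N * monomial M' + monomial M * mono_bracket l M' N"
proof -
  have 1: "(\<Sum>x\<in>#M. \<Sum>y\<in>#N. monomial (M + M' - {#x#} + (N - {#y#}) + {#l x y#}))
      = (\<Sum>x\<in>#M. \<Sum>y\<in>#N. monomial (M - {#x#} + (N - {#y#}) + {#l x y#}) * (monomial M' :: _ \<Rightarrow>\<^sub>0 'k))"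
    by (intro arg_cong[where f = sum_mset] image_mset_cong) (auto simp: mult_single add_ac dest!: multi_member_split)
  have 2: "(\<Sum>x\<in>#M'. \<Sum>y\<in>#N. monomial (M + M' - {#x#} + (N - {#y#}) + {#l x y#}))
      = (\<Sum>x\<in>#M'. \<Sum>y\<in>#N. monomial (M' - {#x#} + (N - {#y#}) + {#l x y#}) * (monomial M :: _ \<Rightarrow>\<^sub>0 'k))"
    by (intro arg_cong[where f = sum_mset] image_mset_cong) (auto simp: mult_single add_ac dest!: multi_member_split)
  show ?thesis
    unfolding mono_bracket_def image_mset_union sum_mset.union 1 2
    by (simp only: sum_mset.distrib flip: sum_mset_mult_right) (simp add: mult.commute)
qed

lemma poly_bracket_superset:
  assumes "finite S" "Poly_Mapping.keys f \<subseteq> S" "finite T" "Poly_Mapping.keys g \<subseteq> T"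
  shows "poly_bracket l f g = (\<Sum>M\<in>S. \<Sum>N\<in>T.
    Poly_Mapping.single {#} (Poly_Mapping.lookup f M * Poly_Mapping.lookup g N) * mono_bracket l M N)"
proof -
  have "poly_bracket l f g = (\<Sum>M\<in>Poly_Mapping.keys f. \<Sum>N\<in>T.
    Poly_Mapping.single {#} (Poly_Mapping.lookup f M * Poly_Mapping.lookup g N) * mono_bracket l M N)"
    unfolding poly_bracket_def map_scale_eq using assms
    by (intro sum.cong refl sum.mono_neutral_left) (auto simp: in_keys_iff)
  also have "\<dots> = (\<Sum>M\<in>S. \<Sum>N\<in>T.
    Poly_Mapping.single {#} (Poly_Mapping.lookup f M * Poly_Mapping.lookup g N) * mono_bracket l M N)"
    using assms by (intro sum.mono_neutral_left) (auto simp: in_keys_iff)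
  finally show ?thesis .
qed

lemma poly_bracket_add_left: "poly_bracket l (f + g) h = poly_bracket l f h + poly_bracket l g h"
proof -
  let ?S = "Poly_Mapping.keys f \<union> Poly_Mapping.keys g"
  have "Poly_Mapping.keys (f + g) \<subseteq> ?S" by (rule Poly_Mapping.keys_add)
  then show ?thesis
    by (simp add: poly_bracket_superset[where S = ?S and T = "Poly_Mapping.keys h"]
        lookup_add distrib_right single_add sum.distrib)
qed

lemma poly_bracket_add_right: "poly_bracket l h (f + g) = poly_bracket l h f + poly_bracket l h g"
proof -
  let ?S = "Poly_Mapping.keys f \<union> Poly_Mapping.keys g"
  have "Poly_Mapping.keys (f + g) \<subseteq> ?S" by (rule Poly_Mapping.keys_add)
  then show ?thesis
    by (simp add: poly_bracket_superset[where T = ?S and S = "Poly_Mapping.keys h"]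
        lookup_add distrib_left distrib_right single_add sum.distrib)
qed

lemma poly_bracket_single [simp]:
  "poly_bracket l (Poly_Mapping.single M c) (Poly_Mapping.single N d)
    = Poly_Mapping.single {#} (c * d) * mono_bracket l M N"
  by (subst poly_bracket_superset[of "{M}" _ "{N}"]) auto

lemma poly_bracket_0 [simp]: "poly_bracket l f 0 = 0" "poly_bracket l 0 f = 0"
  by (simp_all add: poly_bracket_def)

lemma poly_mono_induct [case_names zero single add]:
  assumes "Q 0" "\<And>M c. Q (Poly_Mapping.single M c)" "\<And>f g. \<lbrakk>Q f; Q g\<rbrakk> \<Longrightarrow> Q (f + g)"
  shows "Q (f :: 'g multiset \<Rightarrow>\<^sub>0 'k::field)"
  using monoid_algebra_induct[of f "\<lparr>carrier = UNIV, mult = (+), one = {#}\<rparr>" Q] assms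
  by (simp add: monoid_algebra_def)

lemma single_split: "Poly_Mapping.single M c = Poly_Mapping.single {#} c * monomial M"
  by (simp add: mult_single)

lemma poly_bracket_leibniz_right:
  "poly_bracket l f (g * h) = poly_bracket l f g * h + g * poly_bracket l f (h :: _ \<Rightarrow>\<^sub>0 'k::field)"
proof (induction f rule: poly_mono_induct)
  case (single M c)
  show ?case
  proof (induction g rule: poly_mono_induct)
    case s: (single N d)
    show ?case
    proof (induction h rule: poly_mono_induct)
      case (single N' e)
      have e: "Poly_Mapping.single N d = Poly_Mapping.single {#} d * monomial N"
        "Poly_Mapping.single N' e = Poly_Mapping.single {#} e * monomial N'"
        by (simp_all add: mult_single)
      have c: "Poly_Mapping.single {#} (c * (d * e)) = Poly_Mapping.single {#} c * Poly_Mapping.single {#} d * (Poly_Mapping.single {#} e :: _ \<Rightarrow>\<^sub>0 'k)"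
        "Poly_Mapping.single {#} (c * d) = Poly_Mapping.single {#} c * (Poly_Mapping.single {#} d :: _ \<Rightarrow>\<^sub>0 'k)"
        "Poly_Mapping.single {#} (c * e) = Poly_Mapping.single {#} c * (Poly_Mapping.single {#} e :: _ \<Rightarrow>\<^sub>0 'k)"
        by (simp_all add: mult_single mult_ac)
      show ?case
        unfolding mult_single poly_bracket_single mono_bracket_plus_right
        unfolding c e by (simp only: ring_distribs mult_ac)
    qed (simp_all add: poly_bracket_add_right algebra_simps)
  qed (simp_all add: poly_bracket_add_right algebra_simps)
qed (simp_all add: poly_bracket_add_left algebra_simps)

lemma poly_bracket_leibniz_left:
  "poly_bracket l (g * h) f = poly_bracket l g f * h + g * poly_bracket l (h :: _ \<Rightarrow>\<^sub>0 'k::field) f"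
proof (induction f rule: poly_mono_induct)
  case (single M c)
  show ?case
  proof (induction g rule: poly_mono_induct)
    case s: (single N d)
    show ?case
    proof (induction h rule: poly_mono_induct)
      case (single N' e)
      have e: "Poly_Mapping.single N d = Poly_Mapping.single {#} d * monomial N"
        "Poly_Mapping.single N' e = Poly_Mapping.single {#} e * monomial N'"
        by (simp_all add: mult_single)
      have c: "Poly_Mapping.single {#} (d * e * c) = Poly_Mapping.single {#} c * Poly_Mapping.single {#} d * (Poly_Mapping.single {#} e :: _ \<Rightarrow>\<^sub>0 'k)"
        "Poly_Mapping.single {#} (d * c) = Poly_Mapping.single {#} c * (Poly_Mapping.single {#} d :: _ \<Rightarrow>\<^sub>0 'k)"
        "Poly_Mapping.single {#} (e * c) = Poly_Mapping.single {#} c * (Poly_Mapping.single {#} e :: _ \<Rightarrow>\<^sub>0 'k)"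
        by (simp_all add: mult_single mult_ac)
      show ?case
        unfolding mult_single poly_bracket_single mono_bracket_plus_left
        unfolding c e by (simp only: ring_distribs mult_ac)
    qed (simp_all add: poly_bracket_add_left algebra_simps)
  qed (simp_all add: poly_bracket_add_left algebra_simps)
qed (simp_all add: poly_bracket_add_right algebra_simps)

lemma poly_bracket_scalar [simp]:
  "poly_bracket l f (Poly_Mapping.single {#} c) = 0" "poly_bracket l (Poly_Mapping.single {#} c) f = 0"
  for f :: "_ \<Rightarrow>\<^sub>0 'k::field"
  by (induction f rule: poly_mono_induct, simp_all add: poly_bracket_add_left)
    (induction f rule: poly_mono_induct, simp_all add: poly_bracket_add_right)

lemma poly_bracket_minus:
  "poly_bracket l (f - g) h = poly_bracket l f h - poly_bracket l g h"
  "poly_bracket l h (f - g) = poly_bracket l h f - poly_bracket l h g"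
  using poly_bracket_add_left[of l "f - g" g h] poly_bracket_add_right[of l h "f - g" g]
  by simp_all

lemma poly_bracket_smult:
  fixes f g :: "_ \<Rightarrow>\<^sub>0 'k::field"
  shows "poly_bracket l (Poly_Mapping.map ((*) c) f) g = Poly_Mapping.map ((*) c) (poly_bracket l f g)"
    "poly_bracket l f (Poly_Mapping.map ((*) c) g) = Poly_Mapping.map ((*) c) (poly_bracket l f g)"
  by (simp_all add: map_scale_eq poly_bracket_leibniz_left poly_bracket_leibniz_right)

context lie_algebra
begin

abbreviation SI :: "('g multiset \<Rightarrow>\<^sub>0 'k) set" where "SI \<equiv> sym_ideal scale"
abbreviation D :: "('g multiset \<Rightarrow>\<^sub>0 'k) \<Rightarrow> ('g multiset \<Rightarrow>\<^sub>0 'k) \<Rightarrow> 'g multiset \<Rightarrow>\<^sub>0 'k" where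
  "D \<equiv> poly_bracket lie"
abbreviation V :: "'g \<Rightarrow> 'g multiset \<Rightarrow>\<^sub>0 'k" where "V x \<equiv> monomial {#x#}"

interpretation SI: algebra_ideal SI poly_algebra
  unfolding sym_ideal_def by (rule genideal_algebra_ideal assoc_algebra_poly)+ simp

lemma SI_add: "\<lbrakk>f \<in> SI; g \<in> SI\<rbrakk> \<Longrightarrow> f + g \<in> SI"
  using SI.a_closed[of f g] by simp

lemma SI_zero [simp]: "0 \<in> SI"
  using SI.zero_closed by simp

lemma SI_mult: "f \<in> SI \<Longrightarrow> f * g \<in> SI" "f \<in> SI \<Longrightarrow> g * f \<in> SI"
  using SI.I_r_closed[of f g] SI.I_l_closed[of f g] by auto

lemma SI_uminus: "f \<in> SI \<Longrightarrow> - f \<in> SI"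
  using SI_mult(2)[of f "- 1"] by simp

lemma SI_minus: "\<lbrakk>f \<in> SI; g \<in> SI\<rbrakk> \<Longrightarrow> f - g \<in> SI"
  using SI_add[of f "- g"] SI_uminus[of g] by simp

lemma SI_gen: "V (x + y) - (V x + V y) \<in> SI" "V (scale c x) - Poly_Mapping.single {#x#} c \<in> SI"
  unfolding sym_ideal_def genideal_def by blast+

lemma SI_V0: "V 0 \<in> SI"
  using SI_gen(1)[of 0 0] SI_uminus[of "- V 0"] by simp

lemma SI_V_add: "V (x + y) - V x - V y \<in> SI"
  using SI_gen(1)[of x y] by (simp add: algebra_simps)

lemma SI_V_add3: "x + y + z = 0 \<Longrightarrow> V x + V y + V z \<in> SI"
  using SI_minus[OF SI_minus[OF SI_V0 SI_V_add[of "x + y" z]] SI_V_add[of x y]] by (simp add: algebra_simps)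

lemma SI_V_swap: "V (lie x y) + V (lie y x) \<in> SI"
proof -
  have "lie x y + lie y x = lie (x + y) (x + y)"
    unfolding lie_add_left lie_add_right by (simp add: lie_self)
  then have "lie x y + lie y x = 0" unfolding lie_self .
  then show ?thesis using SI_V_add3[of "lie x y" "lie y x" 0] SI_minus[OF _ SI_V0, of "V (lie x y) + V (lie y x) + V 0"] by simp
qed

lemma derivation_SI:
  assumes add: "\<And>f g. E (f + g) = E f + E g" and mult: "\<And>f g. E (f * g) = E f * g + f * E g"
    and scalar: "\<And>c. E (Poly_Mapping.single {#} c) = 0" and var: "\<And>x. E (V x) \<in> SI"
  shows "E f \<in> SI"
  by (induction f rule: poly_induct) (auto simp: add mult scalar var SI_add SI_mult)

lemma D_antisym: "D f g + D g f \<in> SI"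
proof (rule derivation_SI[of "\<lambda>g. D f g + D g f"])
  fix y
  show "D f (V y) + D (V y) f \<in> SI"
    by (rule derivation_SI[of "\<lambda>f. D f (V y) + D (V y) f"])
      (auto simp: poly_bracket_add_left poly_bracket_add_right poly_bracket_leibniz_left
        poly_bracket_leibniz_right algebra_simps SI_V_swap)
qed (auto simp: poly_bracket_add_left poly_bracket_add_right poly_bracket_leibniz_left
        poly_bracket_leibniz_right algebra_simps)

lemma D_self: "D f f \<in> SI"
proof (induction f rule: poly_mono_induct)
  case (single M c)
  show ?case
  proof (induction M)
    case (add x M)
    let ?m = "Poly_Mapping.single M c"
    have e: "Poly_Mapping.single (add_mset x M) c = V x * ?m" by (simp add: mult_single)
    have "D (V x) (V x) \<in> SI" by (simp add: lie_self SI_V0)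
    then have "(V x * V x) * D ?m ?m + (?m * ?m) * D (V x) (V x) + (V x * ?m) * (D (V x) ?m + D ?m (V x)) \<in> SI"
      using add by (intro SI_add SI_mult(2) D_antisym)
    also have "(V x * V x) * D ?m ?m + (?m * ?m) * D (V x) (V x) + (V x * ?m) * (D (V x) ?m + D ?m (V x))
      = D (V x * ?m) (V x * ?m)"
      by (simp only: poly_bracket_leibniz_left poly_bracket_leibniz_right) (simp only: algebra_simps)
    finally show ?case unfolding e .
  qed simp
next
  case (add f g)
  have "D f f + D g g + (D f g + D g f) \<in> SI" using add by (intro SI_add D_antisym)
  then show ?case by (simp add: poly_bracket_add_left poly_bracket_add_right algebra_simps)
qed simp

lemma D_SI_right: "g \<in> SI \<Longrightarrow> D f g \<in> SI"
proof -
  let ?J = "{g \<in> SI. \<forall>f. D f g \<in> SI}"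
  have J: "ideal ?J poly_algebra"
  proof (rule idealI)
    show "ring (poly_algebra :: ('k, 'g multiset \<Rightarrow>\<^sub>0 'k) module)" by (rule SI.ring_axioms)
    show "subgroup ?J (add_monoid poly_algebra)"
    proof (rule group.subgroupI)
      show "Group.group (add_monoid (poly_algebra :: ('k, 'g multiset \<Rightarrow>\<^sub>0 'k) module))" by (rule SI.a_group)
      fix a assume a: "a \<in> ?J"
      have "inv\<^bsub>add_monoid poly_algebra\<^esub> a = - a"
        using SI.minus_equality[of "- a" a] by (simp add: a_inv_def)
      moreover have "D f (- a) = - D f a" for f using poly_bracket_minus(2)[of lie f 0 a] by simp
      ultimately show "inv\<^bsub>add_monoid poly_algebra\<^esub> a \<in> ?J" using a by (simp add: SI_uminus)
      fix b assume "b \<in> ?J"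
      then show "a \<otimes>\<^bsub>add_monoid poly_algebra\<^esub> b \<in> ?J" using a by (simp add: SI_add poly_bracket_add_right)
    qed (auto intro!: exI[of _ 0])
  qed (auto simp: SI_mult SI_add poly_bracket_leibniz_right)
  have var: "D f (V (x + y) - (V x + V y)) \<in> SI" for f x y
    by (rule derivation_SI[of "\<lambda>f. D f (V (x + y) - (V x + V y))"])
      (auto simp: poly_bracket_add_left poly_bracket_leibniz_left poly_bracket_minus
        poly_bracket_add_right SI_gen lie_add_right ring_distribs)
  have sc: "D f (V (scale c x) - Poly_Mapping.single {#x#} c) \<in> SI" for f x c
    by (rule derivation_SI[of "\<lambda>f. D f (V (scale c x) - Poly_Mapping.single {#x#} c)"])
      (auto simp: poly_bracket_add_left poly_bracket_leibniz_left poly_bracket_minus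
        poly_bracket_add_right SI_gen lie_scale_right mult_single ring_distribs)
  have "{V (x + y) - (V x + V y) | x y. True} \<union> {V (scale c x) - Poly_Mapping.single {#x#} c | c x. True} \<subseteq> ?J"
    using var sc SI_gen by blast
  then have "SI \<subseteq> ?J"
    by (subst sym_ideal_def) (rule SI.genideal_minimal[OF J])
  then show "g \<in> SI \<Longrightarrow> D f g \<in> SI" by blast
qed

lemma D_SI_left: "g \<in> SI \<Longrightarrow> D g f \<in> SI"
  using SI_minus[OF D_antisym[of f g] D_SI_right[of g f]] by simp

definition "J' f g h = D f (D g h) - D g (D f h) - D (D f g) h"

lemma J'_cyc_eq: "J' f g h - (D f (D g h) + D g (D h f) + D h (D f g)) \<in> SI"
proof -
  have "- (D g (D f h + D h f)) - (D (D f g) h + D h (D f g)) \<in> SI"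
    by (intro SI_minus SI_uminus D_SI_right D_antisym)
  then show ?thesis by (simp add: J'_def poly_bracket_add_right algebra_simps)
qed

lemma J'_cyc: "J' f g h \<in> SI \<longleftrightarrow> D f (D g h) + D g (D h f) + D h (D f g) \<in> SI"
proof
  assume "J' f g h \<in> SI"
  from SI_minus[OF this J'_cyc_eq[of f g h]] show "D f (D g h) + D g (D h f) + D h (D f g) \<in> SI" by (simp add: add.assoc)
next
  assume "D f (D g h) + D g (D h f) + D h (D f g) \<in> SI"
  from SI_add[OF this J'_cyc_eq[of f g h]] show "J' f g h \<in> SI" by simp
qed

lemma J'_rot: "J' f g h \<in> SI \<Longrightarrow> J' g h f \<in> SI"
  unfolding J'_cyc by (simp add: add_ac)

lemma J'_derivation:
  assumes "\<And>x. J' f g (V x) \<in> SI" shows "J' f g h \<in> SI"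
  by (rule derivation_SI[of "J' f g"])
    (use assms in \<open>auto simp: J'_def poly_bracket_add_right poly_bracket_leibniz_right algebra_simps\<close>)

lemma D_jacobi: "D f (D g h) + D g (D h f) + D h (D f g) \<in> SI"
proof -
  have "J' (V x) (V y) (V z) \<in> SI" for x y z
    unfolding J'_cyc using SI_V_add3[OF lie_jacobi, of x y z] by simp
  then have "J' (V x) (V y) f \<in> SI" for x y f by (rule J'_derivation)
  then have "J' f (V x) (V y) \<in> SI" for x y f by (metis J'_rot)
  then have "J' f (V x) g \<in> SI" for x g f by (rule J'_derivation)
  then have "J' g f (V x) \<in> SI" for x g f by (metis J'_rot)
  then have "J' f g h \<in> SI" by (rule J'_derivation)
  then show ?thesis by (simp add: J'_cyc)
qed

lemma sym_poisson_simps: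
  "carrier (sym_poisson scale lie) = carrier (sym_algebra scale)"
  "mult (sym_poisson scale lie) = mult (sym_algebra scale)"
  "one (sym_poisson scale lie) = one (sym_algebra scale)"
  "zero (sym_poisson scale lie) = zero (sym_algebra scale)"
  "add (sym_poisson scale lie) = add (sym_algebra scale)"
  "smult (sym_poisson scale lie) = smult (sym_algebra scale)"
  by (simp_all add: sym_poisson_def Let_def)

lemma sym_pbracket:
  "\<lbrace>SI +>\<^bsub>poly_algebra\<^esub> f, SI +>\<^bsub>poly_algebra\<^esub> g\<rbrace>\<^bsub>sym_poisson scale lie\<^esub> = SI +>\<^bsub>poly_algebra\<^esub> D f g"
proof -
  have eq: "SI +>\<^bsub>poly_algebra\<^esub> D f' g' = SI +>\<^bsub>poly_algebra\<^esub> D f g"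
    if "f' \<in> SI +>\<^bsub>poly_algebra\<^esub> f" "g' \<in> SI +>\<^bsub>poly_algebra\<^esub> g" for f' g'
  proof -
    have "f' - f \<in> SI" "g' - g \<in> SI" using that[THEN SI.coset_memD] by auto
    then have "D (f' - f) g' + D f (g' - g) \<in> SI" by (intro SI_add D_SI_left D_SI_right)
    then show ?thesis by (simp add: SI.coset_eq_iff poly_bracket_minus)
  qed
  have "(\<Union>g'\<in>SI +>\<^bsub>poly_algebra\<^esub> g. SI +>\<^bsub>poly_algebra\<^esub> D f' g') = SI +>\<^bsub>poly_algebra\<^esub> D f g"
    if "f' \<in> SI +>\<^bsub>poly_algebra\<^esub> f" for f' by (rule SI.UN_coset) (simp_all add: eq[OF that])
  then have "(\<Union>f'\<in>SI +>\<^bsub>poly_algebra\<^esub> f. \<Union>g'\<in>SI +>\<^bsub>poly_algebra\<^esub> g. SI +>\<^bsub>poly_algebra\<^esub> D f' g')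
    = SI +>\<^bsub>poly_algebra\<^esub> D f g" by (intro SI.UN_coset[of f]) simp_all
  then show ?thesis by (simp add: sym_poisson_def Let_def)
qed

lemma sym_pbracket_incl:
  "\<lbrace>sym_incl scale x, sym_incl scale y\<rbrace>\<^bsub>sym_poisson scale lie\<^esub> = sym_incl scale (lie x y)"
  by (simp add: sym_incl_def sym_pbracket)

lemma sym_incl_linear:
  "sym_incl scale (x + y) = sym_incl scale x \<oplus>\<^bsub>sym_poisson scale lie\<^esub> sym_incl scale y"
  "sym_incl scale (scale c x) = c \<odot>\<^bsub>sym_poisson scale lie\<^esub> sym_incl scale x"
  using SI_gen by (simp_all add: sym_incl_def sym_poisson_simps sym_algebra_def SI.coset_ops
      SI.coset_smult SI.coset_eq_iff)

theorem poisson_algebra_sym: "poisson_algebra (sym_poisson scale lie)"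
proof -
  let ?P = "sym_poisson scale lie"
  have ops: "(SI +>\<^bsub>poly_algebra\<^esub> f) \<oplus>\<^bsub>?P\<^esub> (SI +>\<^bsub>poly_algebra\<^esub> g) = SI +>\<^bsub>poly_algebra\<^esub> (f + g)"
    "(SI +>\<^bsub>poly_algebra\<^esub> f) \<otimes>\<^bsub>?P\<^esub> (SI +>\<^bsub>poly_algebra\<^esub> g) = SI +>\<^bsub>poly_algebra\<^esub> (f * g)"
    "c \<odot>\<^bsub>?P\<^esub> (SI +>\<^bsub>poly_algebra\<^esub> f) = SI +>\<^bsub>poly_algebra\<^esub> Poly_Mapping.map ((*) c) f"
    "\<zero>\<^bsub>?P\<^esub> = SI +>\<^bsub>poly_algebra\<^esub> 0" "SI +>\<^bsub>poly_algebra\<^esub> f \<in> carrier ?P" for f g c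
    using SI.coset_ops[of f g] SI.coset_smult[of f c] SI.quotient_zero SI.coset_closed[of f]
    by (simp_all add: sym_poisson_simps sym_algebra_def)
  have cases: "\<exists>f. X = SI +>\<^bsub>poly_algebra\<^esub> f" if "X \<in> carrier ?P" for X
    using that SI.coset_cases[of X] by (auto simp: sym_poisson_simps sym_algebra_def)
  have A: "assoc_algebra ?P"
  proof -
    interpret S: assoc_algebra "sym_algebra scale"
      unfolding sym_algebra_def by (rule SI.assoc_algebra_quotient)
    note s = sym_poisson_simps
    have "ring ?P"
    proof (rule ringI)
      show "abelian_group ?P"
      proof (rule abelian_groupI)
        fix x assume "x \<in> carrier ?P"
        then show "\<exists>y\<in>carrier ?P. y \<oplus>\<^bsub>?P\<^esub> x = \<zero>\<^bsub>?P\<^esub>"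
          by (intro bexI[of _ "\<ominus>\<^bsub>sym_algebra scale\<^esub> x"]) (simp_all add: s S.l_neg)
      next
        fix x y z assume "x \<in> carrier ?P" "y \<in> carrier ?P" "z \<in> carrier ?P"
        then show "x \<oplus>\<^bsub>?P\<^esub> y \<oplus>\<^bsub>?P\<^esub> z = x \<oplus>\<^bsub>?P\<^esub> (y \<oplus>\<^bsub>?P\<^esub> z)"
          by (simp only: s S.a_assoc)
      next
        fix x y assume "x \<in> carrier ?P" "y \<in> carrier ?P"
        then show "x \<oplus>\<^bsub>?P\<^esub> y = y \<oplus>\<^bsub>?P\<^esub> x" by (simp only: s S.a_comm)
      qed (simp_all add: s)
      show "Group.monoid ?P" by (rule monoidI) (simp_all add: s S.m_assoc)
    qed (simp_all add: s S.l_distr S.r_distr)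
    then show ?thesis
      by (simp add: assoc_algebra_def assoc_algebra_axioms_def s S.smult_l_distr S.smult_r_distr
          S.smult_assoc S.smult_mult_left S.smult_mult_right)
  qed
  then interpret P: assoc_algebra ?P .
  have "comm_monoid ?P"
  proof (rule P.monoid_comm_monoidI)
    fix X Y assume "X \<in> carrier ?P" "Y \<in> carrier ?P"
    from this[THEN cases] show "X \<otimes>\<^bsub>?P\<^esub> Y = Y \<otimes>\<^bsub>?P\<^esub> X" by (auto simp: ops mult.commute)
  qed
  then have C: "cring ?P" by (simp add: cring_def P.ring_axioms)
  have "poisson_algebra_axioms ?P"
  proof (unfold_locales, goal_cases)
    case (1 X Y) from this[THEN cases] show ?case by (auto simp: ops sym_pbracket)
  next
    case (2 X Y Z) from this[THEN cases] show ?case by (auto simp: ops sym_pbracket poly_bracket_add_left)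
  next
    case (3 X Y Z) from this[THEN cases] show ?case by (auto simp: ops sym_pbracket poly_bracket_add_right)
  next
    case (4 X Y k) from this[THEN cases] show ?case by (auto simp: ops sym_pbracket poly_bracket_smult)
  next
    case (5 X Y k) from this[THEN cases] show ?case by (auto simp: ops sym_pbracket poly_bracket_smult)
  next
    case (6 X) from cases[OF this] obtain f where [simp]: "X = SI +>\<^bsub>poly_algebra\<^esub> f" by blast
    show ?case by (simp add: ops sym_pbracket SI.coset_eq_iff D_self)
  next
    case (7 X Y Z)
    from this[THEN cases] obtain f g h where [simp]: "X = SI +>\<^bsub>poly_algebra\<^esub> f" "Y = SI +>\<^bsub>poly_algebra\<^esub> g" "Z = SI +>\<^bsub>poly_algebra\<^esub> h" by blast
    show ?case by (simp add: ops sym_pbracket SI.coset_eq_iff D_jacobi)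
  next
    case (8 X Y Z) from this[THEN cases] show ?case by (auto simp: ops sym_pbracket poly_bracket_leibniz_right)
  qed
  then show ?thesis using A C by (simp add: poisson_algebra_def)
qed

end

section \<open>Universal property of the tensor product\<close>

definition tensor_elt ::
    "('k::field, 'a, 'z) module_scheme \<Rightarrow> ('k, 'b, 'y) module_scheme \<Rightarrow> 'a \<Rightarrow> 'b \<Rightarrow> ('a \<times> 'b \<Rightarrow>\<^sub>0 'k) set" where
  "tensor_elt A B a b =
    Idl\<^bsub>monoid_algebra (A \<times>\<times> B)\<^esub> (tensor_relations A B) +>\<^bsub>monoid_algebra (A \<times>\<times> B)\<^esub> monomial (a, b)"

context
  fixes A :: "('k::field, 'a, 'z) module_scheme" and B :: "('k, 'b, 'y) module_scheme"
  assumes A: "assoc_algebra A" and B: "assoc_algebra B"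
begin

interpretation A: assoc_algebra A by (rule A)
interpretation B: assoc_algebra B by (rule B)

lemma tensor_monoid: "monoid (A \<times>\<times> B)"
  by (rule DirProd_monoid) (rule A.monoid_axioms B.monoid_axioms)+

lemma tensor_relations_carrier: "tensor_relations A B \<subseteq> carrier (monoid_algebra (A \<times>\<times> B))"
  unfolding tensor_relations_def
  by (auto intro!: monoid_algebra_closed(1,3)[OF tensor_monoid])

interpretation I: algebra_ideal "Idl\<^bsub>monoid_algebra (A \<times>\<times> B)\<^esub> (tensor_relations A B)" "monoid_algebra (A \<times>\<times> B)"
  by (intro genideal_algebra_ideal assoc_algebra_monoid_algebra tensor_monoid tensor_relations_carrier)

lemma assoc_algebra_tensor: "assoc_algebra (A \<otimes>\<^sub>a B)"
  unfolding alg_tensor_def by (rule I.assoc_algebra_quotient)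

lemma tensor_elt_closed: "\<lbrakk>a \<in> carrier A; b \<in> carrier B\<rbrakk> \<Longrightarrow> tensor_elt A B a b \<in> carrier (A \<otimes>\<^sub>a B)"
  by (simp add: tensor_elt_def alg_tensor_def)

lemma tensor_elt_mult:
  "\<lbrakk>a \<in> carrier A; b \<in> carrier B; a' \<in> carrier A; b' \<in> carrier B\<rbrakk> \<Longrightarrow>
    tensor_elt A B a b \<otimes>\<^bsub>A \<otimes>\<^sub>a B\<^esub> tensor_elt A B a' b' = tensor_elt A B (a \<otimes>\<^bsub>A\<^esub> a') (b \<otimes>\<^bsub>B\<^esub> b')"
  by (simp add: tensor_elt_def alg_tensor_def I.coset_ops)

lemma tensor_elt_one: "\<one>\<^bsub>A \<otimes>\<^sub>a B\<^esub> = tensor_elt A B \<one>\<^bsub>A\<^esub> \<one>\<^bsub>B\<^esub>"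
  by (simp add: tensor_elt_def alg_tensor_def I.quotient_one)

lemma tensor_rel_eq:
  assumes "x - y \<in> tensor_relations A B" "x \<in> carrier (monoid_algebra (A \<times>\<times> B))"
    "y \<in> carrier (monoid_algebra (A \<times>\<times> B))"
  shows "Idl\<^bsub>monoid_algebra (A \<times>\<times> B)\<^esub> (tensor_relations A B) +>\<^bsub>monoid_algebra (A \<times>\<times> B)\<^esub> x
    = Idl\<^bsub>monoid_algebra (A \<times>\<times> B)\<^esub> (tensor_relations A B) +>\<^bsub>monoid_algebra (A \<times>\<times> B)\<^esub> y"
proof -
  have "x - y \<in> Idl\<^bsub>monoid_algebra (A \<times>\<times> B)\<^esub> (tensor_relations A B)"
    using assms(1) I.genideal_self[OF tensor_relations_carrier] by blast
  then show ?thesis using assms(2,3) by (simp add: I.coset_eq_iff monoid_algebra_minus[OF tensor_monoid])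
qed

lemma tensor_elt_bilinear:
  assumes a: "a \<in> carrier A" "a' \<in> carrier A" and b: "b \<in> carrier B" "b' \<in> carrier B"
  shows "tensor_elt A B (a \<oplus>\<^bsub>A\<^esub> a') b = tensor_elt A B a b \<oplus>\<^bsub>A \<otimes>\<^sub>a B\<^esub> tensor_elt A B a' b"
    "tensor_elt A B a (b \<oplus>\<^bsub>B\<^esub> b') = tensor_elt A B a b \<oplus>\<^bsub>A \<otimes>\<^sub>a B\<^esub> tensor_elt A B a b'"
    "tensor_elt A B (c \<odot>\<^bsub>A\<^esub> a) b = c \<odot>\<^bsub>A \<otimes>\<^sub>a B\<^esub> tensor_elt A B a b"
    "tensor_elt A B a (c \<odot>\<^bsub>B\<^esub> b) = c \<odot>\<^bsub>A \<otimes>\<^sub>a B\<^esub> tensor_elt A B a b"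
proof -
  have "monomial (a \<oplus>\<^bsub>A\<^esub> a', b) - (monomial (a, b) + monomial (a', b)) \<in> tensor_relations A B"
    "monomial (a, b \<oplus>\<^bsub>B\<^esub> b') - (monomial (a, b) + monomial (a, b')) \<in> tensor_relations A B"
    "monomial (c \<odot>\<^bsub>A\<^esub> a, b) - Poly_Mapping.single (a, b) c \<in> tensor_relations A B"
    "monomial (a, c \<odot>\<^bsub>B\<^esub> b) - Poly_Mapping.single (a, b) c \<in> tensor_relations A B"
    using a b unfolding tensor_relations_def by blast+
  note this[THEN tensor_rel_eq]
  then show "tensor_elt A B (a \<oplus>\<^bsub>A\<^esub> a') b = tensor_elt A B a b \<oplus>\<^bsub>A \<otimes>\<^sub>a B\<^esub> tensor_elt A B a' b"
    "tensor_elt A B a (b \<oplus>\<^bsub>B\<^esub> b') = tensor_elt A B a b \<oplus>\<^bsub>A \<otimes>\<^sub>a B\<^esub> tensor_elt A B a b'"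
    "tensor_elt A B (c \<odot>\<^bsub>A\<^esub> a) b = c \<odot>\<^bsub>A \<otimes>\<^sub>a B\<^esub> tensor_elt A B a b"
    "tensor_elt A B a (c \<odot>\<^bsub>B\<^esub> b) = c \<odot>\<^bsub>A \<otimes>\<^sub>a B\<^esub> tensor_elt A B a b"
    using a b
    by (simp_all add: tensor_elt_def alg_tensor_def I.coset_ops I.coset_smult
        monoid_algebra_closed(1)[OF tensor_monoid])
qed

theorem tensor_lift:
  assumes C: "assoc_algebra C" and f: "f \<in> alg_hom A C" and g: "g \<in> alg_hom B C"
    and comm: "\<And>a b. \<lbrakk>a \<in> carrier A; b \<in> carrier B\<rbrakk> \<Longrightarrow> f a \<otimes>\<^bsub>C\<^esub> g b = g b \<otimes>\<^bsub>C\<^esub> f a"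
  obtains h where "h \<in> alg_hom (A \<otimes>\<^sub>a B) C"
    "\<And>a b. \<lbrakk>a \<in> carrier A; b \<in> carrier B\<rbrakk> \<Longrightarrow> h (tensor_elt A B a b) = f a \<otimes>\<^bsub>C\<^esub> g b"
proof -
  let ?M = "monoid_algebra (A \<times>\<times> B) :: ('k, 'a \<times> 'b \<Rightarrow>\<^sub>0 'k) module"
  interpret C: assoc_algebra C by fact
  note [simp] = alg_homD(1)[OF f] alg_homD(1)[OF g]
  let ?\<phi> = "\<lambda>(a, b). f a \<otimes>\<^bsub>C\<^esub> g b"
  obtain h where h: "h \<in> alg_hom ?M C" and
    hs: "\<And>x c. x \<in> carrier (A \<times>\<times> B) \<Longrightarrow> h (Poly_Mapping.single x c) = c \<odot>\<^bsub>C\<^esub> ?\<phi> x"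
  proof (rule monoid_algebra_lift[OF tensor_monoid C, of ?\<phi>])
    fix x y assume "x \<in> carrier (A \<times>\<times> B)" "y \<in> carrier (A \<times>\<times> B)"
    then obtain a b a' b' where x: "x = (a, b)" "y = (a', b')"
      and ab: "a \<in> carrier A" "b \<in> carrier B" "a' \<in> carrier A" "b' \<in> carrier B" by auto
    have "f a \<otimes>\<^bsub>C\<^esub> f a' \<otimes>\<^bsub>C\<^esub> (g b \<otimes>\<^bsub>C\<^esub> g b') = f a \<otimes>\<^bsub>C\<^esub> ((f a' \<otimes>\<^bsub>C\<^esub> g b) \<otimes>\<^bsub>C\<^esub> g b')"
      using ab by (simp add: C.m_assoc)
    also have "\<dots> = f a \<otimes>\<^bsub>C\<^esub> g b \<otimes>\<^bsub>C\<^esub> (f a' \<otimes>\<^bsub>C\<^esub> g b')"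
      unfolding comm[OF ab(3,2)] using ab by (simp add: C.m_assoc)
    finally show "?\<phi> (x \<otimes>\<^bsub>A \<times>\<times> B\<^esub> y) = ?\<phi> x \<otimes>\<^bsub>C\<^esub> ?\<phi> y"
      using ab by (simp add: x alg_homD(2)[OF f] alg_homD(2)[OF g])
  qed (auto simp: alg_homD(4)[OF f] alg_homD(4)[OF g])
  have zero: "h (x - y) = \<zero>\<^bsub>C\<^esub>" if "x \<in> carrier ?M" "y \<in> carrier ?M" "h x = h y" for x y
    using alg_hom_minus[OF assoc_algebra_monoid_algebra[OF tensor_monoid] C h that(1,2)] that
    by (simp add: alg_homD(1)[OF h] C.minus_eq_zero_iff monoid_algebra_minus[OF tensor_monoid])
  have hadd: "h (x + y) = h x \<oplus>\<^bsub>C\<^esub> h y" if "x \<in> carrier ?M" "y \<in> carrier ?M" for x y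
    using alg_homD(3)[OF h that] by simp
  have "h x = \<zero>\<^bsub>C\<^esub>" if "x \<in> tensor_relations A B" for x
    using that unfolding tensor_relations_def Un_iff
    apply (elim disjE)
       apply (clarsimp, intro zero; simp add: hadd hs monoid_algebra_closed(1)[OF tensor_monoid]
        alg_homD(3,5)[OF f] alg_homD(3,5)[OF g] C.l_distr C.r_distr C.smult_mult_left C.smult_mult_right; fail)+
    done
  then obtain h' where "h' \<in> alg_hom (A \<otimes>\<^sub>a B) C" and
    "\<And>x. x \<in> carrier ?M \<Longrightarrow> h' (Idl\<^bsub>?M\<^esub> (tensor_relations A B) +>\<^bsub>?M\<^esub> x) = h x"
    using quotient_lift[OF assoc_algebra_monoid_algebra[OF tensor_monoid] tensor_relations_carrier C h]
    unfolding alg_tensor_def by metis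
  then show ?thesis using that[of h'] by (simp add: tensor_elt_def hs)
qed

theorem tensor_hom_eqI:
  assumes C: "assoc_algebra C" and h: "h \<in> alg_hom (A \<otimes>\<^sub>a B) C" and h': "h' \<in> alg_hom (A \<otimes>\<^sub>a B) C"
    and eq: "\<And>a b. \<lbrakk>a \<in> carrier A; b \<in> carrier B\<rbrakk> \<Longrightarrow> h (tensor_elt A B a b) = h' (tensor_elt A B a b)"
    and u: "u \<in> carrier (A \<otimes>\<^sub>a B)"
  shows "h u = h' u"
proof -
  let ?M = "monoid_algebra (A \<times>\<times> B) :: ('k, 'a \<times> 'b \<Rightarrow>\<^sub>0 'k) module"
  let ?q = "(+>\<^bsub>?M\<^esub>) (Idl\<^bsub>?M\<^esub> (tensor_relations A B))"
  have q: "?q \<in> alg_hom ?M (A \<otimes>\<^sub>a B)"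
    unfolding alg_tensor_def by (rule coset_alg_hom[OF I.algebra_ideal_axioms])
  obtain m where m: "m \<in> carrier ?M" "u = ?q m"
    using u unfolding alg_tensor_def by (rule I.coset_cases)
  have "(h \<circ> ?q) m = (h' \<circ> ?q) m"
    by (rule monoid_algebra_hom_eqI[OF tensor_monoid C alg_hom_comp[OF q h] alg_hom_comp[OF q h'] _ m(1)])
      (use eq in \<open>auto simp: tensor_elt_def\<close>)
  then show ?thesis using m by simp
qed

end

end

theory Submission
  imports Defs
begin

text \<open>
  \<open>U(S(G))\<close> is generated by the elements \<open>\<alpha> x\<close>, \<open>\<beta> x\<close> with \<open>x \<in> G\<close>, and a homomorphism to an algebra
  \<open>T\<close> is the same as a pair of linear maps \<open>c, d : G \<rightarrow> T\<close> satisfying the defining relations on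
  \<open>G\<close> only. The extension from \<open>G\<close> to \<open>S(G)\<close> takes \<open>(c, d)\<close> to one algebra homomorphism from
  \<open>S(G)\<close> to a square-zero extension of \<open>T\<close>, and then both bracket relations spread from \<open>G\<close> to
  \<open>S(G)\<close> by the Leibniz rule. For \<open>G = G\<^sub>1 \<times> G\<^sub>2\<close> the pair \<open>c (x, y) = \<alpha> x \<otimes> 1 + 1 \<otimes> \<alpha> y\<close>,
  \<open>d (x, y) = \<beta> x \<otimes> 1 + 1 \<otimes> \<beta> y\<close> gives a homomorphism \<open>U(S(G)) \<rightarrow> U(S(G\<^sub>1)) \<otimes> U(S(G\<^sub>2))\<close>. Its
  inverse comes from the two inclusions of factors: as \<open>[G\<^sub>1, G\<^sub>2] = 0\<close>, the images of \<open>U(S(G\<^sub>1))\<close>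
  and \<open>U(S(G\<^sub>2))\<close> in \<open>U(S(G))\<close> commute.
\<close>

section \<open>Trivial extension algebras\<close>

text \<open>
  The product is that of the upper triangular matrices with equal diagonal entries \<open>a\<close> and
  upper right entry \<open>x\<close>, so a homomorphism \<open>p \<mapsto> (\<gamma> p, \<delta> p)\<close> is the same as a homomorphism \<open>\<gamma>\<close>
  together with a \<open>\<gamma>\<close>-derivation \<open>\<delta>\<close>.
\<close>

definition triv_ext :: "('k, 'a, 'z) module_scheme \<Rightarrow> ('k, 'a \<times> 'a) module" where
  "triv_ext T =
    \<lparr>carrier = carrier T \<times> carrier T,
     mult = (\<lambda>(a, x) (b, y). (a \<otimes>\<^bsub>T\<^esub> b, x \<otimes>\<^bsub>T\<^esub> b \<oplus>\<^bsub>T\<^esub> a \<otimes>\<^bsub>T\<^esub> y)),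
     one = (\<one>\<^bsub>T\<^esub>, \<zero>\<^bsub>T\<^esub>),
     zero = (\<zero>\<^bsub>T\<^esub>, \<zero>\<^bsub>T\<^esub>),
     add = (\<lambda>(a, x) (b, y). (a \<oplus>\<^bsub>T\<^esub> b, x \<oplus>\<^bsub>T\<^esub> y)),
     smult = (\<lambda>c (a, x). (c \<odot>\<^bsub>T\<^esub> a, c \<odot>\<^bsub>T\<^esub> x))\<rparr>"

lemma triv_ext_simps [simp]:
  "p \<in> carrier (triv_ext T) \<longleftrightarrow> fst p \<in> carrier T \<and> snd p \<in> carrier T"
  "(a, x) \<otimes>\<^bsub>triv_ext T\<^esub> (b, y) = (a \<otimes>\<^bsub>T\<^esub> b, x \<otimes>\<^bsub>T\<^esub> b \<oplus>\<^bsub>T\<^esub> a \<otimes>\<^bsub>T\<^esub> y)"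
  "\<one>\<^bsub>triv_ext T\<^esub> = (\<one>\<^bsub>T\<^esub>, \<zero>\<^bsub>T\<^esub>)"
  "\<zero>\<^bsub>triv_ext T\<^esub> = (\<zero>\<^bsub>T\<^esub>, \<zero>\<^bsub>T\<^esub>)"
  "(a, x) \<oplus>\<^bsub>triv_ext T\<^esub> (b, y) = (a \<oplus>\<^bsub>T\<^esub> b, x \<oplus>\<^bsub>T\<^esub> y)"
  "c \<odot>\<^bsub>triv_ext T\<^esub> (a, x) = (c \<odot>\<^bsub>T\<^esub> a, c \<odot>\<^bsub>T\<^esub> x)"
  by (auto simp: triv_ext_def mem_Times_iff)

lemma assoc_algebra_triv_ext:
  assumes "assoc_algebra T"
  shows "assoc_algebra (triv_ext T)"
proof -
  interpret T: assoc_algebra T by fact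
  have "ring (triv_ext T)"
  proof (rule ringI)
    show "abelian_group (triv_ext T)"
    proof (rule abelian_groupI)
      fix p assume "p \<in> carrier (triv_ext T)"
      then show "\<exists>q\<in>carrier (triv_ext T). q \<oplus>\<^bsub>triv_ext T\<^esub> p = \<zero>\<^bsub>triv_ext T\<^esub>"
        by (intro bexI[of _ "(\<ominus>\<^bsub>T\<^esub> fst p, \<ominus>\<^bsub>T\<^esub> snd p)"]) (cases p; simp add: T.l_neg)+
    qed (auto simp: T.a_ac)
    show "Group.monoid (triv_ext T)"
      by (rule monoidI) (auto simp: T.m_assoc T.l_distr T.r_distr T.a_assoc)
  qed (auto simp: T.l_distr T.r_distr T.a_ac)
  then show ?thesis
    by (auto simp: assoc_algebra_def assoc_algebra_axioms_def T.smult_l_distr T.smult_r_distr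
        T.smult_assoc T.smult_mult_left T.smult_mult_right)
qed

section \<open>Homomorphisms out of the symmetric algebra\<close>

text \<open>Multisets form the free commutative monoid, so a family of pairwise commuting elements
  extends multiplicatively to them even when \<open>G\<close> itself is not commutative.\<close>

lemma (in monoid) commuting_family_lift:
  assumes cl: "\<And>x. \<psi> x \<in> carrier G" and comm: "\<And>x y. \<psi> x \<otimes> \<psi> y = \<psi> y \<otimes> \<psi> x"
  obtains \<phi> :: "'i multiset \<Rightarrow> 'a" where "\<And>M. \<phi> M \<in> carrier G" "\<phi> {#} = \<one>"
    "\<And>M N. \<phi> (M + N) = \<phi> M \<otimes> \<phi> N" "\<And>x. \<phi> {#x#} = \<psi> x"
proof -
  \<comment> \<open>The fold needs left-commutativity on the whole type, while associativity holds
    only in the carrier; hence \<open>f x\<close> is the identity outside it. The fold starts at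
    \<open>\<one>\<close> and never leaves the carrier.\<close>
  define f where "f x y = (if y \<in> carrier G then \<psi> x \<otimes> y else y)" for x y
  interpret f: comp_fun_commute f
    by standard (auto simp: f_def fun_eq_iff cl m_assoc[symmetric] comm)
  define \<phi> where "\<phi> M = fold_mset f \<one> M" for M
  have closed: "\<phi> M \<in> carrier G" for M
    by (induction M) (auto simp: \<phi>_def f_def cl)
  then have insert: "\<phi> (add_mset x M) = \<psi> x \<otimes> \<phi> M" for x M
    by (auto simp: \<phi>_def f_def)
  have empty: "\<phi> {#} = \<one>" by (simp add: \<phi>_def)
  have "\<phi> (M + N) = \<phi> M \<otimes> \<phi> N" for M N
    by (induction M) (simp_all add: empty insert closed cl m_assoc)
  then show ?thesis by (rule that[of \<phi>, OF closed empty]) (simp add: insert empty cl)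
qed

context lie_algebra
begin

abbreviation "SP \<equiv> sym_poisson scale lie"

interpretation SI: algebra_ideal SI poly_algebra
  unfolding sym_ideal_def by (rule genideal_algebra_ideal assoc_algebra_poly)+ simp

interpretation P: poisson_algebra SP by (rule poisson_algebra_sym)

lemma sym_incl_closed [simp]: "sym_incl scale x \<in> carrier SP"
  by (simp add: sym_incl_def sym_poisson_simps sym_algebra_def)

text \<open>The polynomial algebra is the monoid algebra of multisets, so the multiplicative
  extension of \<open>\<psi>\<close> defines a homomorphism on it, and linearity of
  \<open>\<psi>\<close> kills the generators of \<open>sym_ideal\<close>. Only the values of
  \<open>\<psi>\<close> have to commute, so \<open>B\<close> may later be the possibly
  noncommutative \<open>triv_ext T\<close>.\<close>

lemma sym_algebra_lift:
  assumes B: "assoc_algebra B" and cl: "\<And>x. \<psi> x \<in> carrier B"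
    and add: "\<And>x y. \<psi> (x + y) = \<psi> x \<oplus>\<^bsub>B\<^esub> \<psi> y"
    and smult: "\<And>c x. \<psi> (scale c x) = c \<odot>\<^bsub>B\<^esub> \<psi> x"
    and comm: "\<And>x y. \<psi> x \<otimes>\<^bsub>B\<^esub> \<psi> y = \<psi> y \<otimes>\<^bsub>B\<^esub> \<psi> x"
  obtains h where "h \<in> alg_hom SP B" "\<And>x. h (sym_incl scale x) = \<psi> x"
proof -
  interpret B: assoc_algebra B by fact
  obtain \<phi> where \<phi>: "\<And>M. \<phi> M \<in> carrier B" "\<phi> {#} = \<one>\<^bsub>B\<^esub>"
    "\<And>M N. \<phi> (M + N) = \<phi> M \<otimes>\<^bsub>B\<^esub> \<phi> N" "\<And>x. \<phi> {#x#} = \<psi> x"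
    using B.commuting_family_lift[of \<psi>, OF cl comm] by metis
  obtain h where h: "h \<in> alg_hom poly_algebra B"
    and hs: "\<And>M c. h (Poly_Mapping.single M c) = c \<odot>\<^bsub>B\<^esub> \<phi> M"
    using monoid_algebra_lift[OF multiset_monoid B, of \<phi>] \<phi> unfolding poly_algebra_def by auto
  have hadd: "h (f + g) = h f \<oplus>\<^bsub>B\<^esub> h g" for f g using alg_homD(3)[OF h, of f g] by simp
  have hclosed: "h f \<in> carrier B" for f using alg_homD(1)[OF h, of f] by simp
  have hminus: "h (f - g) = h f \<ominus>\<^bsub>B\<^esub> h g" for f g
    using alg_hom_minus[OF assoc_algebra_poly B h, of f g] by simp
  let ?S = "{monomial {#x + y#} - (monomial {#x#} + monomial {#y#}) | x y. True} \<union>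
     {monomial {#scale c x#} - Poly_Mapping.single {#x#} c | c x. True}"
  have "h f = \<zero>\<^bsub>B\<^esub>" if "f \<in> ?S" for f
    using that by (auto simp: hminus hadd hs \<phi> add smult cl B.minus_eq_zero_iff)
  then obtain h' where "h' \<in> alg_hom (sym_algebra scale) B"
    and h': "\<And>f. h' (SI +>\<^bsub>poly_algebra\<^esub> f) = h f"
    using quotient_lift[OF assoc_algebra_poly _ B h, of ?S]
    unfolding sym_algebra_def sym_ideal_def by auto
  \<comment> \<open>\<open>SP\<close> and \<open>sym_algebra scale\<close> differ only by the
    bracket, which \<open>alg_hom\<close> does not see.\<close>
  then have "h' \<in> alg_hom SP B"
    by (simp add: alg_hom_def ring_hom_def sym_poisson_simps)
  then show ?thesis using that[of h'] by (simp add: sym_incl_def h' hs \<phi> cl)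
qed

text \<open>\<open>S(G)\<close> is generated by \<open>G\<close> as a unital algebra; constant
  polynomials enter as scalar multiples of \<open>\<one>\<close>.\<close>

lemma sym_induct [consumes 1, case_names one incl add mult smult]:
  assumes p: "p \<in> carrier SP"
    and "Q \<one>\<^bsub>SP\<^esub>" and "\<And>x. Q (sym_incl scale x)"
    and "\<And>p q. \<lbrakk>p \<in> carrier SP; q \<in> carrier SP; Q p; Q q\<rbrakk> \<Longrightarrow> Q (p \<oplus>\<^bsub>SP\<^esub> q)"
    and "\<And>p q. \<lbrakk>p \<in> carrier SP; q \<in> carrier SP; Q p; Q q\<rbrakk> \<Longrightarrow> Q (p \<otimes>\<^bsub>SP\<^esub> q)"
    and smult: "\<And>c p. \<lbrakk>p \<in> carrier SP; Q p\<rbrakk> \<Longrightarrow> Q (c \<odot>\<^bsub>SP\<^esub> p)"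
  shows "Q p"
proof -
  have "Q (SI +>\<^bsub>poly_algebra\<^esub> f)" for f
  proof (induction f rule: poly_induct)
    case (scalar c)
    have "c \<odot>\<^bsub>SP\<^esub> \<one>\<^bsub>SP\<^esub> = SI +>\<^bsub>poly_algebra\<^esub> Poly_Mapping.single {#} c"
      by (simp add: sym_poisson_simps sym_algebra_def SI.quotient_one SI.coset_smult
          flip: single_one)
    then show ?case using smult[of "\<one>\<^bsub>SP\<^esub>" c] assms by simp
  next
    case (var x) then show ?case using assms(3) by (simp add: sym_incl_def)
  next
    case (add f g)
    then show ?case using assms(4)[of "SI +>\<^bsub>poly_algebra\<^esub> f" "SI +>\<^bsub>poly_algebra\<^esub> g"]
      by (simp add: sym_poisson_simps sym_algebra_def SI.coset_ops)
  next
    case (mult f g)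
    then show ?case using assms(5)[of "SI +>\<^bsub>poly_algebra\<^esub> f" "SI +>\<^bsub>poly_algebra\<^esub> g"]
      by (simp add: sym_poisson_simps sym_algebra_def SI.coset_ops)
  qed
  moreover obtain f where "p = SI +>\<^bsub>poly_algebra\<^esub> f"
    using p SI.coset_cases[of p] by (auto simp: sym_poisson_simps sym_algebra_def)
  ultimately show ?thesis by simp
qed

end

section \<open>Commutation rules\<close>

context ring
begin

text \<open>Turns a commutator identity \<open>[x, y] = z\<close> into \<open>xy = z + yx\<close>,
  the subtraction-free form in which the relations are carried below.\<close>

lemma minus_eq_iff_add:
  assumes "x \<in> carrier R" "y \<in> carrier R" "z \<in> carrier R"
  shows "x \<ominus> y = z \<longleftrightarrow> x = z \<oplus> y"
  using assms by (auto simp: a_minus_def a_assoc l_neg r_neg)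

text \<open>An equation \<open>da = a' + ad\<close> says that \<open>[d, a] = a'\<close>. Read this
  way, this lemma and the next three are additivity and the Leibniz rule of the commutator in each
  argument.\<close>

lemma commutation_add_right:
  assumes "d \<otimes> a = a' \<oplus> a \<otimes> d" "d \<otimes> b = b' \<oplus> b \<otimes> d"
    and "d \<in> carrier R" "a \<in> carrier R" "b \<in> carrier R" "a' \<in> carrier R" "b' \<in> carrier R"
  shows "d \<otimes> (a \<oplus> b) = (a' \<oplus> b') \<oplus> (a \<oplus> b) \<otimes> d"
  using assms by (simp add: l_distr r_distr a_ac)

lemma commutation_add_left:
  assumes "d \<otimes> a = d' \<oplus> a \<otimes> d" "e \<otimes> a = e' \<oplus> a \<otimes> e"
    and "d \<in> carrier R" "e \<in> carrier R" "a \<in> carrier R" "d' \<in> carrier R" "e' \<in> carrier R"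
  shows "(d \<oplus> e) \<otimes> a = (d' \<oplus> e') \<oplus> a \<otimes> (d \<oplus> e)"
  using assms by (simp add: l_distr r_distr a_ac)

lemma commutation_mult_right:
  assumes da: "d \<otimes> a = a' \<oplus> a \<otimes> d" and db: "d \<otimes> b = b' \<oplus> b \<otimes> d"
    and cl: "d \<in> carrier R" "a \<in> carrier R" "b \<in> carrier R" "a' \<in> carrier R" "b' \<in> carrier R"
  shows "d \<otimes> (a \<otimes> b) = (a' \<otimes> b \<oplus> a \<otimes> b') \<oplus> (a \<otimes> b) \<otimes> d"
proof -
  have "d \<otimes> (a \<otimes> b) = (d \<otimes> a) \<otimes> b" using cl by (simp add: m_assoc)
  also have "\<dots> = a' \<otimes> b \<oplus> a \<otimes> (d \<otimes> b)" unfolding da using cl by (simp add: l_distr m_assoc)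
  finally show ?thesis unfolding db using cl by (simp add: r_distr m_assoc a_assoc)
qed

lemma commutation_mult_left:
  assumes da: "d \<otimes> a = d' \<oplus> a \<otimes> d" and ea: "e \<otimes> a = e' \<oplus> a \<otimes> e"
    and cl: "d \<in> carrier R" "e \<in> carrier R" "a \<in> carrier R" "d' \<in> carrier R" "e' \<in> carrier R"
  shows "(d \<otimes> e) \<otimes> a = (d' \<otimes> e \<oplus> d \<otimes> e') \<oplus> a \<otimes> (d \<otimes> e)"
proof -
  have "(d \<otimes> e) \<otimes> a = d \<otimes> (e \<otimes> a)" using cl by (simp add: m_assoc)
  also have "\<dots> = d \<otimes> e' \<oplus> (d \<otimes> a) \<otimes> e" unfolding ea using cl by (simp add: r_distr m_assoc)
  finally show ?thesis unfolding da using cl by (simp add: l_distr m_assoc a_ac)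
qed

end

text \<open>Polarisation of \<open>pbracket_self\<close>, valid in every characteristic.\<close>

lemma (in poisson_algebra) pbracket_antisym:
  assumes "a \<in> carrier P" "b \<in> carrier P"
  shows "\<lbrace>a, b\<rbrace> = \<ominus> \<lbrace>b, a\<rbrace>"
proof -
  have "\<zero> = \<lbrace>a \<oplus> b, a \<oplus> b\<rbrace>" using assms by (simp add: pbracket_self)
  also have "\<dots> = \<lbrace>a, b\<rbrace> \<oplus> \<lbrace>b, a\<rbrace>"
    using assms by (subst pbracket_add_left) (simp_all add: pbracket_add_right pbracket_self)
  finally show ?thesis using assms minus_equality[of "\<lbrace>a, b\<rbrace>" "\<lbrace>b, a\<rbrace>"] by simp
qed

lemma (in poisson_algebra) pbracket_leibniz_left:
  assumes "a \<in> carrier P" "x \<in> carrier P" "y \<in> carrier P"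
  shows "\<lbrace>x \<otimes> y, a\<rbrace> = \<lbrace>x, a\<rbrace> \<otimes> y \<oplus> x \<otimes> \<lbrace>y, a\<rbrace>"
  unfolding pbracket_antisym[of x a, OF assms(2,1)] pbracket_antisym[of y a, OF assms(3,1)]
  using assms by (subst pbracket_antisym) (simp_all add: pbracket_leibniz l_minus r_minus minus_add)

lemma (in poisson_algebra) pbracket_one_right:
  assumes "a \<in> carrier P"
  shows "\<lbrace>a, \<one>\<rbrace> = \<zero>"
proof -
  have "\<lbrace>a, \<one>\<rbrace> \<oplus> \<lbrace>a, \<one>\<rbrace> = \<lbrace>a, \<one>\<rbrace> \<oplus> \<zero>" using pbracket_leibniz[of a \<one> \<one>] assms by simp
  then show ?thesis using assms by simp
qed

lemma (in poisson_algebra) pbracket_one_left: "a \<in> carrier P \<Longrightarrow> \<lbrace>\<one>, a\<rbrace> = \<zero>"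
  using pbracket_antisym[of \<one> a] pbracket_one_right[of a] by simp


section \<open>Generators and relations of the Poisson enveloping algebra of \<open>S(G)\<close>\<close>

text \<open>Words are products of single letters, and elements of the free algebra are linear
  combinations of words; the quotient map, being a homomorphism, carries this generation over to
  cosets.\<close>

lemma poisson_env_induct [consumes 2, case_names alpha beta one add mult smult]:
  assumes P: "poisson_algebra P" and u: "u \<in> carrier (poisson_env P)"
    and \<alpha>: "\<And>a. a \<in> carrier P \<Longrightarrow> Q (poisson_env_alpha P a)"
    and \<beta>: "\<And>a. a \<in> carrier P \<Longrightarrow> Q (poisson_env_beta P a)"
    and one: "Q \<one>\<^bsub>poisson_env P\<^esub>"
    and add: "\<And>u v. \<lbrakk>u \<in> carrier (poisson_env P); v \<in> carrier (poisson_env P); Q u; Q v\<rbrakk>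
      \<Longrightarrow> Q (u \<oplus>\<^bsub>poisson_env P\<^esub> v)"
    and mult: "\<And>u v. \<lbrakk>u \<in> carrier (poisson_env P); v \<in> carrier (poisson_env P); Q u; Q v\<rbrakk>
      \<Longrightarrow> Q (u \<otimes>\<^bsub>poisson_env P\<^esub> v)"
    and smult: "\<And>k u. \<lbrakk>u \<in> carrier (poisson_env P); Q u\<rbrakk> \<Longrightarrow> Q (k \<odot>\<^bsub>poisson_env P\<^esub> u)"
  shows "Q u"
proof -
  let ?F = "poisson_env_free P" and ?X = "Alpha ` carrier P \<union> Beta ` carrier P"
  let ?q = "(+>\<^bsub>?F\<^esub>) (poisson_env_ideal P)"
  interpret I: algebra_ideal "poisson_env_ideal P" ?F
    unfolding poisson_env_ideal_def
    by (intro genideal_algebra_ideal assoc_algebra_poisson_env_free poisson_env_relations_carrier P)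
  interpret U: assoc_algebra "poisson_env P" by (rule assoc_algebra_poisson_env[OF P])
  note q = alg_homD[OF coset_alg_hom[OF I.algebra_ideal_axioms, folded poisson_env_def]]
  have word: "Q (?q (monomial w))" if "w \<in> lists ?X" for w
    using that
  proof (induction w)
    case Nil then show ?case using one q(4) by simp
  next
    case (Cons x w)
    then have x: "monomial [x] \<in> carrier ?F" and w: "monomial w \<in> carrier ?F"
      by (intro single_env_free; auto)+
    have "Q (?q (monomial [x]))"
      using Cons \<alpha> \<beta> by (auto simp: poisson_env_alpha_def poisson_env_beta_def)
    moreover have "?q (monomial (x # w)) = ?q (monomial [x]) \<otimes>\<^bsub>poisson_env P\<^esub> ?q (monomial w)"
      using q(2)[OF x w] by simp
    ultimately show ?case using Cons mult[OF q(1)[OF x] q(1)[OF w]] by simp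
  qed
  have "Q (?q f)" if "f \<in> carrier ?F" for f
    using that unfolding poisson_env_free_def free_algebra_def
  proof (induction rule: monoid_algebra_induct)
    case zero
    \<comment> \<open>There is no separate case for zero: it is the multiple of
      \<open>\<one>\<close> by the scalar 0.\<close>
    have "?q 0 = 0 \<odot>\<^bsub>poisson_env P\<^esub> \<one>\<^bsub>poisson_env P\<^esub>"
      using q(5)[of "monomial []" 0] q(4) by simp
    then show ?case using smult[OF _ one, of 0] by (simp add: poisson_env_free_def free_algebra_def)
  next
    case (single w k)
    then have w: "w \<in> lists ?X" by simp
    then have F: "monomial w \<in> carrier ?F" by (intro single_env_free) auto
    then have "?q (Poly_Mapping.single w k) = k \<odot>\<^bsub>poisson_env P\<^esub> ?q (monomial w)"
      using q(5)[OF F, of k] by simp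
    then show ?case using smult[OF q(1)[OF F] word[OF w], of k]
      by (simp add: poisson_env_free_def free_algebra_def)
  next
    case (add f g)
    then show ?case using assms(6)[OF q(1) q(1), of f g] q(3)[of f g]
      by (simp add: poisson_env_free_def free_algebra_def)
  qed
  then show ?thesis using u I.coset_cases[folded poisson_env_def] by metis
qed

text \<open>
  The relation \<open>c [x, y] = c [y, x]\<close> comes from \<open>\<beta> (ab) = \<beta> (ba)\<close>: since \<open>\<beta> (ab)\<close> is
  \<open>\<beta> a \<alpha> b + \<alpha> a \<beta> b\<close> with \<open>\<alpha>\<close> on different sides, commutativity of \<open>S(G)\<close> forces
  \<open>\<alpha> {a, b} = \<alpha> {b, a}\<close>.
\<close>

definition lie_compatible ::
    "('k::field \<Rightarrow> 'g::ab_group_add \<Rightarrow> 'g) \<Rightarrow> ('g \<Rightarrow> 'g \<Rightarrow> 'g) \<Rightarrow> ('k, 'u, 'z) module_scheme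
      \<Rightarrow> ('g \<Rightarrow> 'u) \<Rightarrow> ('g \<Rightarrow> 'u) \<Rightarrow> bool" where
  "lie_compatible scale lie T c d \<longleftrightarrow>
    range c \<subseteq> carrier T \<and> range d \<subseteq> carrier T \<and>
    (\<forall>x y. c (x + y) = c x \<oplus>\<^bsub>T\<^esub> c y) \<and> (\<forall>x y. d (x + y) = d x \<oplus>\<^bsub>T\<^esub> d y) \<and>
    (\<forall>k x. c (scale k x) = k \<odot>\<^bsub>T\<^esub> c x) \<and> (\<forall>k x. d (scale k x) = k \<odot>\<^bsub>T\<^esub> d x) \<and>
    (\<forall>x y. c x \<otimes>\<^bsub>T\<^esub> c y = c y \<otimes>\<^bsub>T\<^esub> c x) \<and>
    (\<forall>x y. c (lie x y) = c (lie y x)) \<and>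
    (\<forall>x y. d x \<otimes>\<^bsub>T\<^esub> c y = c (lie x y) \<oplus>\<^bsub>T\<^esub> c y \<otimes>\<^bsub>T\<^esub> d x) \<and>
    (\<forall>x y. d x \<otimes>\<^bsub>T\<^esub> d y = d (lie x y) \<oplus>\<^bsub>T\<^esub> d y \<otimes>\<^bsub>T\<^esub> d x)"

lemma lie_compatibleI:
  assumes "\<And>x. c x \<in> carrier T" "\<And>x. d x \<in> carrier T"
    and "\<And>x y. c (x + y) = c x \<oplus>\<^bsub>T\<^esub> c y" "\<And>x y. d (x + y) = d x \<oplus>\<^bsub>T\<^esub> d y"
    and "\<And>k x. c (scale k x) = k \<odot>\<^bsub>T\<^esub> c x" "\<And>k x. d (scale k x) = k \<odot>\<^bsub>T\<^esub> d x"
    and "\<And>x y. c x \<otimes>\<^bsub>T\<^esub> c y = c y \<otimes>\<^bsub>T\<^esub> c x"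
    and "\<And>x y. c (lie x y) = c (lie y x)"
    and "\<And>x y. d x \<otimes>\<^bsub>T\<^esub> c y = c (lie x y) \<oplus>\<^bsub>T\<^esub> c y \<otimes>\<^bsub>T\<^esub> d x"
    and "\<And>x y. d x \<otimes>\<^bsub>T\<^esub> d y = d (lie x y) \<oplus>\<^bsub>T\<^esub> d y \<otimes>\<^bsub>T\<^esub> d x"
  shows "lie_compatible scale lie T c d"
  using assms unfolding lie_compatible_def by blast

lemma lie_compatibleD:
  assumes "lie_compatible scale lie T c d"
  shows "\<And>x. c x \<in> carrier T" "\<And>x. d x \<in> carrier T"
    and "\<And>x y. c (x + y) = c x \<oplus>\<^bsub>T\<^esub> c y" "\<And>x y. d (x + y) = d x \<oplus>\<^bsub>T\<^esub> d y"
    and "\<And>k x. c (scale k x) = k \<odot>\<^bsub>T\<^esub> c x" "\<And>k x. d (scale k x) = k \<odot>\<^bsub>T\<^esub> d x"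
    and "\<And>x y. c x \<otimes>\<^bsub>T\<^esub> c y = c y \<otimes>\<^bsub>T\<^esub> c x"
    and "\<And>x y. c (lie x y) = c (lie y x)"
    and "\<And>x y. d x \<otimes>\<^bsub>T\<^esub> c y = c (lie x y) \<oplus>\<^bsub>T\<^esub> c y \<otimes>\<^bsub>T\<^esub> d x"
    and "\<And>x y. d x \<otimes>\<^bsub>T\<^esub> d y = d (lie x y) \<oplus>\<^bsub>T\<^esub> d y \<otimes>\<^bsub>T\<^esub> d x"
  using assms unfolding lie_compatible_def by (blast+)

section \<open>Transport and combination of compatible pairs\<close>

lemma lie_compatible_hom:
  assumes "lie_compatible scale lie A c d" and h: "h \<in> alg_hom A B" and "assoc_algebra A"
  shows "lie_compatible scale lie B (\<lambda>x. h (c x)) (\<lambda>x. h (d x))"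
proof -
  interpret A: assoc_algebra A by fact
  note c = lie_compatibleD[OF assms(1)] and h' = alg_homD[OF h]
  show ?thesis
  proof (rule lie_compatibleI, goal_cases)
    case (7 x y) show ?case using c(7)[of x y] c(1) by (simp flip: h'(2))
  next
    case (8 x y) show ?case using c(8)[of x y] by simp
  next
    case (9 x y) show ?case using c(9)[of x y] c(1,2) by (simp flip: h'(2,3))
  next
    case (10 x y) show ?case using c(10)[of x y] c(1,2) by (simp flip: h'(2,3))
  qed (simp_all add: c(1-6) h'(1,3,5))
qed

text \<open>Pullback along a Lie homomorphism \<open>f\<close>, needed for the two inclusions of
  factors into the product.\<close>

lemma lie_compatible_comp:
  assumes "lie_compatible scale lie A c d"
    and "\<And>x y. f (x + y) = f x + f y" "\<And>k x. f (scale' k x) = scale k (f x)"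
      "\<And>x y. f (lie' x y) = lie (f x) (f y)"
  shows "lie_compatible scale' lie' A (\<lambda>x. c (f x)) (\<lambda>x. d (f x))"
  by (rule lie_compatibleI; (unfold assms(2-4))?; rule lie_compatibleD[OF assms(1)])

text \<open>When the products are expanded, the mixed terms commute by \<open>comm\<close>, in
  agreement with the componentwise bracket \<open>prod_lie\<close>; what remains of each relation is
  the sum of the relations for the two factors.\<close>

lemma lie_compatible_prod:
  assumes T: "assoc_algebra T"
    and c1: "lie_compatible s1 l1 T c1 d1" and c2: "lie_compatible s2 l2 T c2 d2"
    and comm: "\<And>x y. c1 x \<otimes>\<^bsub>T\<^esub> c2 y = c2 y \<otimes>\<^bsub>T\<^esub> c1 x" "\<And>x y. c1 x \<otimes>\<^bsub>T\<^esub> d2 y = d2 y \<otimes>\<^bsub>T\<^esub> c1 x"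
      "\<And>x y. d1 x \<otimes>\<^bsub>T\<^esub> c2 y = c2 y \<otimes>\<^bsub>T\<^esub> d1 x" "\<And>x y. d1 x \<otimes>\<^bsub>T\<^esub> d2 y = d2 y \<otimes>\<^bsub>T\<^esub> d1 x"
  shows "lie_compatible (prod_scale s1 s2) (prod_lie l1 l2) T
    (\<lambda>u. c1 (fst u) \<oplus>\<^bsub>T\<^esub> c2 (snd u)) (\<lambda>u. d1 (fst u) \<oplus>\<^bsub>T\<^esub> d2 (snd u))"
proof -
  interpret T: assoc_algebra T by fact
  note c1' = lie_compatibleD[OF c1] and c2' = lie_compatibleD[OF c2]
  note [simp] = c1'(1,2) c2'(1,2)
  show ?thesis
  proof (rule lie_compatibleI, goal_cases)
    case (7 u v)
    show ?case
      using comm(1)[of "fst u" "snd v"] comm(1)[of "fst v" "snd u"]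
        c1'(7)[of "fst u" "fst v"] c2'(7)[of "snd u" "snd v"]
      by (simp add: T.l_distr T.r_distr T.a_ac)
  next
    case (8 u v)
    show ?case
      using c1'(8)[of "fst u" "fst v"] c2'(8)[of "snd u" "snd v"] by (simp add: prod_lie_def)
  next
    case (9 u v)
    show ?case
      using comm(3)[of "fst u" "snd v"] comm(2)[of "fst v" "snd u"]
        c1'(9)[of "fst u" "fst v"] c2'(9)[of "snd u" "snd v"]
      by (simp add: prod_lie_def T.l_distr T.r_distr T.a_ac)
  next
    case (10 u v)
    show ?case
      using comm(4)[of "fst u" "snd v"] comm(4)[of "fst v" "snd u"]
        c1'(10)[of "fst u" "fst v"] c2'(10)[of "snd u" "snd v"]
      by (simp add: prod_lie_def T.l_distr T.r_distr T.a_ac)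
  qed (simp_all add: prod_scale_def c1'(3-6) c2'(3-6) T.smult_r_distr T.a_ac)
qed

text \<open>Commutators are brought to the form \<open>xy = z + yx\<close>. Beyond the definition
  there are consequences of commutativity of \<open>P\<close> and of the product rule for
  \<open>\<beta>\<close>, among them the symmetry of \<open>\<alpha>\<close> on brackets that
  \<open>lie_compatible\<close> asks for.\<close>

lemma poisson_compatibleD:
  assumes "assoc_algebra U" "poisson_algebra P" "poisson_compatible P U \<alpha> \<beta>"
    and ab: "a \<in> carrier P" "b \<in> carrier P"
  shows "\<alpha> a \<in> carrier U" "\<beta> a \<in> carrier U"
    and "\<alpha> (a \<oplus>\<^bsub>P\<^esub> b) = \<alpha> a \<oplus>\<^bsub>U\<^esub> \<alpha> b" "\<beta> (a \<oplus>\<^bsub>P\<^esub> b) = \<beta> a \<oplus>\<^bsub>U\<^esub> \<beta> b"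
    and "\<alpha> (k \<odot>\<^bsub>P\<^esub> a) = k \<odot>\<^bsub>U\<^esub> \<alpha> a" "\<beta> (k \<odot>\<^bsub>P\<^esub> a) = k \<odot>\<^bsub>U\<^esub> \<beta> a"
    and "\<alpha> a \<otimes>\<^bsub>U\<^esub> \<alpha> b = \<alpha> b \<otimes>\<^bsub>U\<^esub> \<alpha> a"
    and "\<alpha> \<lbrace>a, b\<rbrace>\<^bsub>P\<^esub> = \<alpha> \<lbrace>b, a\<rbrace>\<^bsub>P\<^esub>"
    and "\<beta> a \<otimes>\<^bsub>U\<^esub> \<alpha> b = \<alpha> \<lbrace>a, b\<rbrace>\<^bsub>P\<^esub> \<oplus>\<^bsub>U\<^esub> \<alpha> b \<otimes>\<^bsub>U\<^esub> \<beta> a"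
    and "\<beta> a \<otimes>\<^bsub>U\<^esub> \<beta> b = \<beta> \<lbrace>a, b\<rbrace>\<^bsub>P\<^esub> \<oplus>\<^bsub>U\<^esub> \<beta> b \<otimes>\<^bsub>U\<^esub> \<beta> a"
    and "\<alpha> (a \<otimes>\<^bsub>P\<^esub> b) = \<alpha> a \<otimes>\<^bsub>U\<^esub> \<alpha> b"
    and "\<beta> (a \<otimes>\<^bsub>P\<^esub> b) = \<beta> a \<otimes>\<^bsub>U\<^esub> \<alpha> b \<oplus>\<^bsub>U\<^esub> \<alpha> a \<otimes>\<^bsub>U\<^esub> \<beta> b"
    and "\<alpha> \<one>\<^bsub>P\<^esub> = \<one>\<^bsub>U\<^esub>" "\<beta> \<one>\<^bsub>P\<^esub> = \<zero>\<^bsub>U\<^esub>"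
proof -
  interpret U: assoc_algebra U by fact
  interpret P: poisson_algebra P by fact
  have \<alpha>: "\<alpha> \<in> alg_hom P U" using assms(3) by (simp add: poisson_compatible_def)
  note \<alpha>' = alg_homD[OF \<alpha>]
  have \<beta>: "\<beta> a \<in> carrier U" if "a \<in> carrier P" for a
    using assms(3) that by (auto simp: poisson_compatible_def)
  have \<beta>mult: "\<beta> (a \<otimes>\<^bsub>P\<^esub> b) = \<beta> a \<otimes>\<^bsub>U\<^esub> \<alpha> b \<oplus>\<^bsub>U\<^esub> \<alpha> a \<otimes>\<^bsub>U\<^esub> \<beta> b"
    if "a \<in> carrier P" "b \<in> carrier P" for a b
    using assms(3) that by (auto simp: poisson_compatible_def)
  have \<beta>\<alpha>: "\<beta> a \<otimes>\<^bsub>U\<^esub> \<alpha> b = \<alpha> \<lbrace>a, b\<rbrace>\<^bsub>P\<^esub> \<oplus>\<^bsub>U\<^esub> \<alpha> b \<otimes>\<^bsub>U\<^esub> \<beta> a"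
    if "a \<in> carrier P" "b \<in> carrier P" for a b
    using assms(3) that \<beta> \<alpha>'(1)
    by (subst U.minus_eq_iff_add[symmetric]) (auto simp: poisson_compatible_def)
  show "\<alpha> a \<in> carrier U" "\<beta> a \<in> carrier U" using ab \<alpha>' \<beta> by auto
  show "\<alpha> (a \<oplus>\<^bsub>P\<^esub> b) = \<alpha> a \<oplus>\<^bsub>U\<^esub> \<alpha> b" "\<alpha> (k \<odot>\<^bsub>P\<^esub> a) = k \<odot>\<^bsub>U\<^esub> \<alpha> a"
    "\<alpha> (a \<otimes>\<^bsub>P\<^esub> b) = \<alpha> a \<otimes>\<^bsub>U\<^esub> \<alpha> b" "\<alpha> \<one>\<^bsub>P\<^esub> = \<one>\<^bsub>U\<^esub>"
    using ab \<alpha>' by auto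
  show "\<alpha> a \<otimes>\<^bsub>U\<^esub> \<alpha> b = \<alpha> b \<otimes>\<^bsub>U\<^esub> \<alpha> a"
    using ab by (simp add: P.m_comm flip: \<alpha>'(2))
  show "\<beta> (a \<oplus>\<^bsub>P\<^esub> b) = \<beta> a \<oplus>\<^bsub>U\<^esub> \<beta> b" "\<beta> (k \<odot>\<^bsub>P\<^esub> a) = k \<odot>\<^bsub>U\<^esub> \<beta> a"
    using assms(3) ab by (auto simp: poisson_compatible_def)
  show "\<beta> a \<otimes>\<^bsub>U\<^esub> \<alpha> b = \<alpha> \<lbrace>a, b\<rbrace>\<^bsub>P\<^esub> \<oplus>\<^bsub>U\<^esub> \<alpha> b \<otimes>\<^bsub>U\<^esub> \<beta> a" using ab by (rule \<beta>\<alpha>)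
  show "\<beta> a \<otimes>\<^bsub>U\<^esub> \<beta> b = \<beta> \<lbrace>a, b\<rbrace>\<^bsub>P\<^esub> \<oplus>\<^bsub>U\<^esub> \<beta> b \<otimes>\<^bsub>U\<^esub> \<beta> a"
    using assms(3) ab \<beta>
    by (subst U.minus_eq_iff_add[symmetric]) (auto simp: poisson_compatible_def)
  show "\<beta> (a \<otimes>\<^bsub>P\<^esub> b) = \<beta> a \<otimes>\<^bsub>U\<^esub> \<alpha> b \<oplus>\<^bsub>U\<^esub> \<alpha> a \<otimes>\<^bsub>U\<^esub> \<beta> b" using ab by (rule \<beta>mult)
  \<comment> \<open>Moving every \<open>\<alpha>\<close> to the left turns both
    \<open>\<beta> (ab)\<close> and \<open>\<beta> (ba)\<close> into a bracket term plus the same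
    remainder \<open>?r\<close>, which cancels.\<close>
  let ?r = "\<alpha> a \<otimes>\<^bsub>U\<^esub> \<beta> b \<oplus>\<^bsub>U\<^esub> \<alpha> b \<otimes>\<^bsub>U\<^esub> \<beta> a"
  have "\<alpha> \<lbrace>a, b\<rbrace>\<^bsub>P\<^esub> \<oplus>\<^bsub>U\<^esub> ?r = \<beta> (a \<otimes>\<^bsub>P\<^esub> b)"
    using ab \<alpha>'(1) \<beta> by (simp add: \<beta>mult \<beta>\<alpha> U.a_ac)
  also have "\<dots> = \<beta> (b \<otimes>\<^bsub>P\<^esub> a)" using ab by (simp add: P.m_comm)
  also have "\<dots> = \<alpha> \<lbrace>b, a\<rbrace>\<^bsub>P\<^esub> \<oplus>\<^bsub>U\<^esub> ?r"
    using ab \<alpha>'(1) \<beta> by (simp add: \<beta>mult \<beta>\<alpha> U.a_ac)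
  finally show "\<alpha> \<lbrace>a, b\<rbrace>\<^bsub>P\<^esub> = \<alpha> \<lbrace>b, a\<rbrace>\<^bsub>P\<^esub>" using ab \<alpha>'(1) \<beta> by simp
  have "\<beta> \<one>\<^bsub>P\<^esub> = \<beta> \<one>\<^bsub>P\<^esub> \<oplus>\<^bsub>U\<^esub> \<beta> \<one>\<^bsub>P\<^esub>" using \<beta>mult[of "\<one>\<^bsub>P\<^esub>" "\<one>\<^bsub>P\<^esub>"] \<beta> \<alpha>'(4) by simp
  then show "\<beta> \<one>\<^bsub>P\<^esub> = \<zero>\<^bsub>U\<^esub>" using \<beta>[of "\<one>\<^bsub>P\<^esub>"] by simp
qed

section \<open>Presentation of \<open>U(S(G))\<close> by generators from \<open>G\<close>\<close>

context lie_algebra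
begin

interpretation P: poisson_algebra SP by (rule poisson_algebra_sym)

lemma lie_compatible_incl:
  assumes "assoc_algebra T" "poisson_compatible SP T \<gamma> \<delta>"
  shows "lie_compatible scale lie T (\<lambda>x. \<gamma> (sym_incl scale x)) (\<lambda>x. \<delta> (sym_incl scale x))"
proof -
  note c = poisson_compatibleD[OF assms(1) poisson_algebra_sym assms(2)]
  show ?thesis
    by (rule lie_compatibleI; (unfold sym_pbracket_incl[symmetric] sym_incl_linear)?;
        (rule c sym_incl_closed)+)
qed

text \<open>One homomorphism into \<open>triv_ext T\<close> yields \<open>\<gamma>\<close> and
  \<open>\<delta>\<close> together with their product rules, so only the two bracket relations are
  left to spread from \<open>G\<close> to \<open>S(G)\<close>.\<close>

lemma poisson_compatible_lift:
  assumes T: "assoc_algebra T" and c: "lie_compatible scale lie T c d"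
  obtains \<gamma> \<delta> where "poisson_compatible SP T \<gamma> \<delta>"
    "\<And>x. \<gamma> (sym_incl scale x) = c x" "\<And>x. \<delta> (sym_incl scale x) = d x"
proof -
  interpret T: assoc_algebra T by fact
  note c' = lie_compatibleD[OF c]
  \<comment> \<open>In the second component both sides become \<open>c y d x + c x d y\<close> plus
    \<open>c [x, y]\<close> or \<open>c [y, x]\<close>; here the symmetry of \<open>c\<close> on
    brackets is indispensable.\<close>
  have "(c x, d x) \<otimes>\<^bsub>triv_ext T\<^esub> (c y, d y) = (c y, d y) \<otimes>\<^bsub>triv_ext T\<^esub> (c x, d x)" for x y
    using c'(7)[of x y] c'(8)[of x y] c'(1,2) by (simp add: c'(9) T.a_ac)
  then obtain h where h: "h \<in> alg_hom SP (triv_ext T)"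
    and hi: "\<And>x. h (sym_incl scale x) = (c x, d x)"
    using sym_algebra_lift[OF assoc_algebra_triv_ext[OF T], of "\<lambda>x. (c x, d x)"] c'(1-6)
    by (metis fst_conv snd_conv triv_ext_simps(1,5,6))
  define \<gamma> where "\<gamma> p = fst (h p)" for p
  define \<delta> where "\<delta> p = snd (h p)" for p
  have hp: "h p = (\<gamma> p, \<delta> p)" for p by (simp add: \<gamma>_def \<delta>_def)
  note h' = alg_homD[OF h, unfolded hp]
  have cl [simp]: "\<gamma> p \<in> carrier T" "\<delta> p \<in> carrier T" if "p \<in> carrier SP" for p
    using h'(1)[OF that] by simp_all
  have \<gamma>\<delta>_one: "\<gamma> \<one>\<^bsub>SP\<^esub> = \<one>\<^bsub>T\<^esub>" "\<delta> \<one>\<^bsub>SP\<^esub> = \<zero>\<^bsub>T\<^esub>" using h'(4) by simp_all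
  have \<gamma>\<delta>_add: "\<gamma> (p \<oplus>\<^bsub>SP\<^esub> q) = \<gamma> p \<oplus>\<^bsub>T\<^esub> \<gamma> q" "\<delta> (p \<oplus>\<^bsub>SP\<^esub> q) = \<delta> p \<oplus>\<^bsub>T\<^esub> \<delta> q"
    and \<gamma>\<delta>_mult: "\<gamma> (p \<otimes>\<^bsub>SP\<^esub> q) = \<gamma> p \<otimes>\<^bsub>T\<^esub> \<gamma> q"
      "\<delta> (p \<otimes>\<^bsub>SP\<^esub> q) = \<delta> p \<otimes>\<^bsub>T\<^esub> \<gamma> q \<oplus>\<^bsub>T\<^esub> \<gamma> p \<otimes>\<^bsub>T\<^esub> \<delta> q"
    if "p \<in> carrier SP" "q \<in> carrier SP" for p q
    using h'(2,3)[OF that] by simp_all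
  have \<gamma>\<delta>_smult: "\<gamma> (k \<odot>\<^bsub>SP\<^esub> p) = k \<odot>\<^bsub>T\<^esub> \<gamma> p" "\<delta> (k \<odot>\<^bsub>SP\<^esub> p) = k \<odot>\<^bsub>T\<^esub> \<delta> p"
    if "p \<in> carrier SP" for p k using h'(5)[OF that] by simp_all
  have \<gamma>\<delta>_incl: "\<gamma> (sym_incl scale x) = c x" "\<delta> (sym_incl scale x) = d x" for x
    using hi[of x] by (simp_all add: hp)
  have \<gamma>comm: "\<gamma> p \<otimes>\<^bsub>T\<^esub> \<gamma> q = \<gamma> q \<otimes>\<^bsub>T\<^esub> \<gamma> p" if "p \<in> carrier SP" "q \<in> carrier SP" for p q
    using \<gamma>\<delta>_mult(1)[OF that] \<gamma>\<delta>_mult(1)[OF that(2,1)] P.m_comm[OF that] by simp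
  have \<gamma>\<delta>_zero: "\<gamma> \<zero>\<^bsub>SP\<^esub> = \<zero>\<^bsub>T\<^esub>" "\<delta> \<zero>\<^bsub>SP\<^esub> = \<zero>\<^bsub>T\<^esub>"
    using \<gamma>\<delta>_smult[of "\<one>\<^bsub>SP\<^esub>" 0] by (simp_all add: \<gamma>\<delta>_one)
  \<comment> \<open>The first argument is kept in \<open>G\<close> while the second is extended,
    both sides being derivations in it; the next step extends the first argument.\<close>
  have \<delta>\<gamma>_incl: "\<delta> (sym_incl scale x) \<otimes>\<^bsub>T\<^esub> \<gamma> q
      = \<gamma> \<lbrace>sym_incl scale x, q\<rbrace>\<^bsub>SP\<^esub> \<oplus>\<^bsub>T\<^esub> \<gamma> q \<otimes>\<^bsub>T\<^esub> \<delta> (sym_incl scale x)"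
    if "q \<in> carrier SP" for x q
    using that
  proof (induction q rule: sym_induct)
    case one then show ?case by (simp add: \<gamma>\<delta>_one \<gamma>\<delta>_zero P.pbracket_one_right)
  next
    case (incl y) then show ?case by (simp add: sym_pbracket_incl \<gamma>\<delta>_incl c'(9))
  next
    case (add p q)
    then show ?case
      by (simp add: P.pbracket_add_right add \<gamma>\<delta>_add T.commutation_add_right)
  next
    case (mult p q)
    then show ?case
      by (simp add: P.pbracket_leibniz mult \<gamma>\<delta>_add \<gamma>\<delta>_mult T.commutation_mult_right)
  next
    case (smult k p)
    then show ?case
      by (simp add: P.pbracket_smult_right smult \<gamma>\<delta>_smult T.smult_mult_left T.smult_mult_right T.smult_r_distr)
  qed
  have \<delta>\<gamma>: "\<delta> p \<otimes>\<^bsub>T\<^esub> \<gamma> q = \<gamma> \<lbrace>p, q\<rbrace>\<^bsub>SP\<^esub> \<oplus>\<^bsub>T\<^esub> \<gamma> q \<otimes>\<^bsub>T\<^esub> \<delta> p"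
    if "p \<in> carrier SP" and q: "q \<in> carrier SP" for p q
    using that(1)
  proof (induction p rule: sym_induct)
    case one then show ?case using q by (simp add: \<gamma>\<delta>_one \<gamma>\<delta>_zero P.pbracket_one_left)
  next
    case (incl x) show ?case using q by (rule \<delta>\<gamma>_incl)
  next
    case (add p p')
    then show ?case using q
      by (simp add: P.pbracket_add_left add \<gamma>\<delta>_add T.commutation_add_left)
  next
    case (mult p p')
    \<comment> \<open>Commutation of the \<open>\<gamma>\<close> values is written with bracket term
      zero, so that \<open>T.commutation_mult_left\<close> also applies to the factors
      \<open>\<gamma> p\<close> and \<open>\<gamma> p'\<close> of
      \<open>\<delta> (pp')\<close>.\<close>
    have g: "\<gamma> r \<otimes>\<^bsub>T\<^esub> \<gamma> q = \<zero>\<^bsub>T\<^esub> \<oplus>\<^bsub>T\<^esub> \<gamma> q \<otimes>\<^bsub>T\<^esub> \<gamma> r" if "r \<in> carrier SP" for r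
      using \<gamma>comm[OF that q] q that by simp
    have "\<delta> (p \<otimes>\<^bsub>SP\<^esub> p') \<otimes>\<^bsub>T\<^esub> \<gamma> q
        = ((\<gamma> \<lbrace>p, q\<rbrace>\<^bsub>SP\<^esub> \<otimes>\<^bsub>T\<^esub> \<gamma> p' \<oplus>\<^bsub>T\<^esub> \<delta> p \<otimes>\<^bsub>T\<^esub> \<zero>\<^bsub>T\<^esub>)
          \<oplus>\<^bsub>T\<^esub> (\<zero>\<^bsub>T\<^esub> \<otimes>\<^bsub>T\<^esub> \<delta> p' \<oplus>\<^bsub>T\<^esub> \<gamma> p \<otimes>\<^bsub>T\<^esub> \<gamma> \<lbrace>p', q\<rbrace>\<^bsub>SP\<^esub>))
          \<oplus>\<^bsub>T\<^esub> \<gamma> q \<otimes>\<^bsub>T\<^esub> \<delta> (p \<otimes>\<^bsub>SP\<^esub> p')"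
      unfolding \<gamma>\<delta>_mult(2)[OF mult.hyps]
      by (intro T.commutation_add_left T.commutation_mult_left mult.IH g)
        (use mult.hyps q in simp_all)
    then show ?case using mult.hyps q
      by (simp add: P.pbracket_leibniz_left \<gamma>\<delta>_add \<gamma>\<delta>_mult(1))
  next
    case (smult k p)
    then show ?case using q
      by (simp add: P.pbracket_smult_left smult \<gamma>\<delta>_smult T.smult_mult_left T.smult_mult_right T.smult_r_distr)
  qed
  \<comment> \<open>Extends only the second argument. It is applied twice below: to \<open>p\<close>
    in \<open>G\<close>, then, after exchanging the arguments, to arbitrary
    \<open>p\<close>.\<close>
  have \<delta>\<delta>_step: "\<delta> p \<otimes>\<^bsub>T\<^esub> \<delta> q = \<delta> \<lbrace>p, q\<rbrace>\<^bsub>SP\<^esub> \<oplus>\<^bsub>T\<^esub> \<delta> q \<otimes>\<^bsub>T\<^esub> \<delta> p"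
    if p: "p \<in> carrier SP" and q: "q \<in> carrier SP"
      and gen: "\<And>x. \<delta> p \<otimes>\<^bsub>T\<^esub> \<delta> (sym_incl scale x)
        = \<delta> \<lbrace>p, sym_incl scale x\<rbrace>\<^bsub>SP\<^esub> \<oplus>\<^bsub>T\<^esub> \<delta> (sym_incl scale x) \<otimes>\<^bsub>T\<^esub> \<delta> p" for p q
    using q
  proof (induction q rule: sym_induct)
    case one then show ?case using p by (simp add: \<gamma>\<delta>_one \<gamma>\<delta>_zero P.pbracket_one_right)
  next
    case (incl y) show ?case by (rule gen)
  next
    case (add q q')
    then show ?case using p
      by (simp add: P.pbracket_add_right add \<gamma>\<delta>_add T.commutation_add_right)
  next
    case (mult q q')
    \<comment> \<open>Passing \<open>\<delta> p\<close> across a \<open>\<gamma>\<close> factor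
      needs \<open>\<delta>\<gamma>\<close>. The four resulting terms regroup to
      \<open>\<delta> ({p, q} q' + q {p, q'})\<close>.\<close>
    have "\<delta> p \<otimes>\<^bsub>T\<^esub> \<delta> (q \<otimes>\<^bsub>SP\<^esub> q')
        = ((\<delta> \<lbrace>p, q\<rbrace>\<^bsub>SP\<^esub> \<otimes>\<^bsub>T\<^esub> \<gamma> q' \<oplus>\<^bsub>T\<^esub> \<delta> q \<otimes>\<^bsub>T\<^esub> \<gamma> \<lbrace>p, q'\<rbrace>\<^bsub>SP\<^esub>)
          \<oplus>\<^bsub>T\<^esub> (\<gamma> \<lbrace>p, q\<rbrace>\<^bsub>SP\<^esub> \<otimes>\<^bsub>T\<^esub> \<delta> q' \<oplus>\<^bsub>T\<^esub> \<gamma> q \<otimes>\<^bsub>T\<^esub> \<delta> \<lbrace>p, q'\<rbrace>\<^bsub>SP\<^esub>))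
          \<oplus>\<^bsub>T\<^esub> \<delta> (q \<otimes>\<^bsub>SP\<^esub> q') \<otimes>\<^bsub>T\<^esub> \<delta> p"
      unfolding \<gamma>\<delta>_mult(2)[OF mult.hyps]
      by (intro T.commutation_add_right T.commutation_mult_right mult.IH \<delta>\<gamma>)
        (use mult.hyps p in simp_all)
    then show ?case using mult.hyps p
      by (simp add: P.pbracket_leibniz \<gamma>\<delta>_add \<gamma>\<delta>_mult T.a_ac)
  next
    case (smult k q)
    then show ?case using p
      by (simp add: P.pbracket_smult_right smult \<gamma>\<delta>_smult T.smult_mult_left T.smult_mult_right T.smult_r_distr)
  qed
  have \<delta>\<delta>: "\<delta> p \<otimes>\<^bsub>T\<^esub> \<delta> q = \<delta> \<lbrace>p, q\<rbrace>\<^bsub>SP\<^esub> \<oplus>\<^bsub>T\<^esub> \<delta> q \<otimes>\<^bsub>T\<^esub> \<delta> p"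
    if p: "p \<in> carrier SP" and q: "q \<in> carrier SP" for p q
  proof (rule \<delta>\<delta>_step[OF p q])
    fix x
    let ?x = "sym_incl scale x"
    \<comment> \<open>The relation with the generator on the left; antisymmetry of the bracket then
      moves the generator to the right.\<close>
    have *: "\<delta> ?x \<otimes>\<^bsub>T\<^esub> \<delta> p = \<delta> \<lbrace>?x, p\<rbrace>\<^bsub>SP\<^esub> \<oplus>\<^bsub>T\<^esub> \<delta> p \<otimes>\<^bsub>T\<^esub> \<delta> ?x"
      by (rule \<delta>\<delta>_step[OF sym_incl_closed p]) (simp only: sym_pbracket_incl \<gamma>\<delta>_incl c'(10)[symmetric])
    have "\<delta> \<lbrace>p, ?x\<rbrace>\<^bsub>SP\<^esub> \<oplus>\<^bsub>T\<^esub> \<delta> \<lbrace>?x, p\<rbrace>\<^bsub>SP\<^esub> = \<delta> (\<lbrace>p, ?x\<rbrace>\<^bsub>SP\<^esub> \<oplus>\<^bsub>SP\<^esub> \<lbrace>?x, p\<rbrace>\<^bsub>SP\<^esub>)"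
      using p by (simp add: \<gamma>\<delta>_add)
    also have "\<dots> = \<zero>\<^bsub>T\<^esub>"
      using p by (subst P.pbracket_antisym) (simp_all add: P.l_neg \<gamma>\<delta>_zero)
    finally show "\<delta> p \<otimes>\<^bsub>T\<^esub> \<delta> ?x = \<delta> \<lbrace>p, ?x\<rbrace>\<^bsub>SP\<^esub> \<oplus>\<^bsub>T\<^esub> \<delta> ?x \<otimes>\<^bsub>T\<^esub> \<delta> p"
      unfolding * using p by (simp add: T.a_assoc[symmetric])
  qed
  have "\<gamma> \<in> alg_hom SP T"
    by (rule alg_homI) (simp_all add: \<gamma>\<delta>_add \<gamma>\<delta>_mult \<gamma>\<delta>_one \<gamma>\<delta>_smult)
  \<comment> \<open>The Lie relation for \<open>\<delta>\<close> is first flipped by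
    \<open>eq_commute\<close>, so that \<open>T.minus_eq_iff_add\<close> can remove its
    difference.\<close>
  then have "poisson_compatible SP T \<gamma> \<delta>"
    unfolding poisson_compatible_def
    by (simp add: \<gamma>\<delta>_add \<gamma>\<delta>_mult \<gamma>\<delta>_smult T.minus_eq_iff_add \<delta>\<gamma>
        eq_commute[of "\<delta> \<lbrace>_, _\<rbrace>\<^bsub>SP\<^esub>"]) (use \<delta>\<delta> in blast)
  then show ?thesis using that \<gamma>\<delta>_incl by blast
qed

definition gen_alpha :: "'g \<Rightarrow> (('g multiset \<Rightarrow>\<^sub>0 'k) set env_gen list \<Rightarrow>\<^sub>0 'k) set" where
  "gen_alpha x = poisson_env_alpha SP (sym_incl scale x)"

definition gen_beta :: "'g \<Rightarrow> (('g multiset \<Rightarrow>\<^sub>0 'k) set env_gen list \<Rightarrow>\<^sub>0 'k) set" where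
  "gen_beta x = poisson_env_beta SP (sym_incl scale x)"

lemma lie_compatible_gen: "lie_compatible scale lie (poisson_env SP) gen_alpha gen_beta"
  using lie_compatible_incl[OF assoc_algebra_poisson_env[OF poisson_algebra_sym]
      poisson_compatible_poisson_env[OF poisson_algebra_sym]]
  unfolding gen_alpha_def[abs_def] gen_beta_def[abs_def] .

text \<open>Data on \<open>G\<close> extend to \<open>S(G)\<close> by
  \<open>poisson_compatible_lift\<close>, and from there to \<open>U(S(G))\<close> by its universal
  property.\<close>

lemma env_lift:
  assumes T: "assoc_algebra T" and c: "lie_compatible scale lie T c d"
  obtains h where "h \<in> alg_hom (poisson_env SP) T"
    "\<And>x. h (gen_alpha x) = c x" "\<And>x. h (gen_beta x) = d x"
proof -
  obtain \<gamma> \<delta> where "poisson_compatible SP T \<gamma> \<delta>"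
    and i: "\<And>x. \<gamma> (sym_incl scale x) = c x" "\<And>x. \<delta> (sym_incl scale x) = d x"
    using poisson_compatible_lift[OF assms] by metis
  then obtain h where h: "h \<in> alg_hom (poisson_env SP) T"
    "\<And>p. p \<in> carrier SP \<Longrightarrow> h (poisson_env_alpha SP p) = \<gamma> p"
    "\<And>p. p \<in> carrier SP \<Longrightarrow> h (poisson_env_beta SP p) = \<delta> p"
    using poisson_env_lift[OF poisson_algebra_sym T] by metis
  show ?thesis by (rule that[OF h(1)]) (simp_all add: gen_alpha_def gen_beta_def h(2,3) i)
qed

text \<open>\<open>poisson_env_induct\<close> reduces to the images of all of \<open>S(G)\<close>;
  the sum, product and scalar rules for \<open>\<alpha>\<close> and \<open>\<beta>\<close> then
  reduce these to \<open>G\<close>.\<close>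

lemma env_induct [consumes 1, case_names alpha beta one add mult smult]:
  assumes u: "u \<in> carrier (poisson_env SP)"
    and \<alpha>: "\<And>x. Q (gen_alpha x)" and \<beta>: "\<And>x. Q (gen_beta x)"
    and one: "Q \<one>\<^bsub>poisson_env SP\<^esub>"
    and add: "\<And>u v. \<lbrakk>u \<in> carrier (poisson_env SP); v \<in> carrier (poisson_env SP); Q u; Q v\<rbrakk>
      \<Longrightarrow> Q (u \<oplus>\<^bsub>poisson_env SP\<^esub> v)"
    and mult: "\<And>u v. \<lbrakk>u \<in> carrier (poisson_env SP); v \<in> carrier (poisson_env SP); Q u; Q v\<rbrakk>
      \<Longrightarrow> Q (u \<otimes>\<^bsub>poisson_env SP\<^esub> v)"
    and smult: "\<And>k u. \<lbrakk>u \<in> carrier (poisson_env SP); Q u\<rbrakk> \<Longrightarrow> Q (k \<odot>\<^bsub>poisson_env SP\<^esub> u)"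
  shows "Q u"
proof -
  let ?U = "poisson_env SP" and ?\<alpha> = "poisson_env_alpha SP" and ?\<beta> = "poisson_env_beta SP"
  interpret U: assoc_algebra ?U by (rule assoc_algebra_poisson_env[OF poisson_algebra_sym])
  note c = poisson_compatibleD[OF U.assoc_algebra_axioms poisson_algebra_sym
      poisson_compatible_poisson_env[OF poisson_algebra_sym]]
  have Q0: "Q \<zero>\<^bsub>?U\<^esub>" using smult[OF U.one_closed one, of 0] by simp
  \<comment> \<open>Both claims run in one induction because \<open>\<beta>\<close> of a product
    involves \<open>\<alpha>\<close> of its factors.\<close>
  have \<alpha>\<beta>: "Q (?\<alpha> p) \<and> Q (?\<beta> p)" if "p \<in> carrier SP" for p
    using that
  proof (induction p rule: sym_induct)
    case one
    show ?case using assms(4) Q0 by (simp add: c(13,14)[where a = "\<one>\<^bsub>SP\<^esub>" and b = "\<one>\<^bsub>SP\<^esub>"])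
  next
    case (incl x)
    show ?case using \<alpha>[of x] \<beta>[of x] by (simp add: gen_alpha_def gen_beta_def)
  next
    case (add p q)
    then show ?case
      by (simp add: c(3,4) assms(5) c(1,2)[where b = p])
  next
    case (mult p q)
    then show ?case
      by (simp add: c(11,12) assms(5,6) c(1,2)[where b = p])
  next
    case (smult k p)
    then show ?case
      by (simp add: c(5,6)[where b = p] assms(7) c(1,2)[where b = p])
  qed
  show ?thesis
    using poisson_algebra_sym u
  proof (induction u rule: poisson_env_induct)
    case (alpha a) then show ?case using \<alpha>\<beta> by simp
  next
    case (beta a) then show ?case using \<alpha>\<beta> by simp
  qed (use one add mult smult in auto)
qed

lemma env_hom_eqI:
  assumes h: "h \<in> alg_hom (poisson_env SP) B" and h': "h' \<in> alg_hom (poisson_env SP) B"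
    and "\<And>x. h (gen_alpha x) = h' (gen_alpha x)" "\<And>x. h (gen_beta x) = h' (gen_beta x)"
    and "u \<in> carrier (poisson_env SP)"
  shows "h u = h' u"
  using assms(5)
  by (induction u rule: env_induct) (simp_all add: assms(3,4) alg_homD(2-5)[OF h] alg_homD(2-5)[OF h'])

text \<open>The elements whose image commutes with \<open>z\<close> form a subalgebra, so it
  suffices to test generators.\<close>

lemma env_hom_commute:
  assumes B: "assoc_algebra B" and h: "h \<in> alg_hom (poisson_env SP) B"
    and z: "z \<in> carrier B"
    and "\<And>x. h (gen_alpha x) \<otimes>\<^bsub>B\<^esub> z = z \<otimes>\<^bsub>B\<^esub> h (gen_alpha x)"
      "\<And>x. h (gen_beta x) \<otimes>\<^bsub>B\<^esub> z = z \<otimes>\<^bsub>B\<^esub> h (gen_beta x)"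
    and "u \<in> carrier (poisson_env SP)"
  shows "h u \<otimes>\<^bsub>B\<^esub> z = z \<otimes>\<^bsub>B\<^esub> h u"
proof -
  interpret B: assoc_algebra B by fact
  note h' = alg_homD[OF h]
  show ?thesis using assms(6)
  proof (induction u rule: env_induct)
    case (mult u v)
    have "h u \<otimes>\<^bsub>B\<^esub> h v \<otimes>\<^bsub>B\<^esub> z = h u \<otimes>\<^bsub>B\<^esub> (h v \<otimes>\<^bsub>B\<^esub> z)"
      using mult.hyps z h'(1) by (simp add: B.m_assoc)
    also have "\<dots> = (h u \<otimes>\<^bsub>B\<^esub> z) \<otimes>\<^bsub>B\<^esub> h v"
      unfolding mult.IH(2) using mult.hyps z h'(1) by (simp add: B.m_assoc)
    also have "\<dots> = z \<otimes>\<^bsub>B\<^esub> (h u \<otimes>\<^bsub>B\<^esub> h v)"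
      unfolding mult.IH(1) using mult.hyps z h'(1) by (simp add: B.m_assoc)
    finally show ?case using mult by (simp add: h'(2))
  qed (use assms(4,5) z in \<open>simp_all add: h' B.l_distr B.r_distr B.smult_mult_left B.smult_mult_right\<close>)
qed

end

section \<open>Tensor products\<close>

lemma tensor_incl_hom:
  assumes A: "assoc_algebra A" and B: "assoc_algebra B"
  shows "(\<lambda>a. tensor_elt A B a \<one>\<^bsub>B\<^esub>) \<in> alg_hom A (A \<otimes>\<^sub>a B)"
    and "(\<lambda>b. tensor_elt A B \<one>\<^bsub>A\<^esub> b) \<in> alg_hom B (A \<otimes>\<^sub>a B)"
proof -
  interpret A: assoc_algebra A by fact
  interpret B: assoc_algebra B by fact
  show "(\<lambda>a. tensor_elt A B a \<one>\<^bsub>B\<^esub>) \<in> alg_hom A (A \<otimes>\<^sub>a B)"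
    by (rule alg_homI)
      (simp_all add: tensor_elt_closed[OF A B] tensor_elt_mult[OF A B] tensor_elt_one[OF A B]
        tensor_elt_bilinear(3)[OF A B, where b' = "\<one>\<^bsub>B\<^esub>" and a' = "\<one>\<^bsub>A\<^esub>"]
        tensor_elt_bilinear(1)[OF A B, where b' = "\<one>\<^bsub>B\<^esub>"])
  show "(\<lambda>b. tensor_elt A B \<one>\<^bsub>A\<^esub> b) \<in> alg_hom B (A \<otimes>\<^sub>a B)"
    by (rule alg_homI)
      (simp_all add: tensor_elt_closed[OF A B] tensor_elt_mult[OF A B] tensor_elt_one[OF A B]
        tensor_elt_bilinear(4)[OF A B, where b' = "\<one>\<^bsub>B\<^esub>" and a' = "\<one>\<^bsub>A\<^esub>"]
        tensor_elt_bilinear(2)[OF A B, where a' = "\<one>\<^bsub>A\<^esub>"])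
qed

theorem corollary2p12:
  fixes s1 :: "'k::field \<Rightarrow> 'a::ab_group_add \<Rightarrow> 'a" and l1 :: "'a \<Rightarrow> 'a \<Rightarrow> 'a"
    and s2 :: "'k \<Rightarrow> 'b::ab_group_add \<Rightarrow> 'b" and l2 :: "'b \<Rightarrow> 'b \<Rightarrow> 'b"
  assumes "lie_algebra s1 l1" and "lie_algebra s2 l2"
  shows "poisson_env (sym_poisson (prod_scale s1 s2) (prod_lie l1 l2))
    \<cong>\<^sub>a poisson_env (sym_poisson s1 l1) \<otimes>\<^sub>a poisson_env (sym_poisson s2 l2)"
proof -
  interpret G1: lie_algebra s1 l1 by fact
  interpret G2: lie_algebra s2 l2 by fact
  interpret G: lie_algebra "prod_scale s1 s2" "prod_lie l1 l2" by (rule lie_algebra_prod) fact+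
  let ?U1 = "poisson_env (sym_poisson s1 l1)" and ?U2 = "poisson_env (sym_poisson s2 l2)"
  let ?U = "poisson_env (sym_poisson (prod_scale s1 s2) (prod_lie l1 l2))" and ?T = "?U1 \<otimes>\<^sub>a ?U2"
  have U1: "assoc_algebra ?U1" by (rule assoc_algebra_poisson_env[OF G1.poisson_algebra_sym])
  have U2: "assoc_algebra ?U2" by (rule assoc_algebra_poisson_env[OF G2.poisson_algebra_sym])
  have U: "assoc_algebra ?U" by (rule assoc_algebra_poisson_env[OF G.poisson_algebra_sym])
  have T: "assoc_algebra ?T" by (rule assoc_algebra_tensor[OF U1 U2])
  interpret U1: assoc_algebra ?U1 by fact
  interpret U2: assoc_algebra ?U2 by fact
  interpret U: assoc_algebra ?U by fact
  interpret T: assoc_algebra ?T by fact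
  note c1 = lie_compatibleD[OF G1.lie_compatible_gen] and c2 = lie_compatibleD[OF G2.lie_compatible_gen]
    and c = lie_compatibleD[OF G.lie_compatible_gen]
  let ?i1 = "\<lambda>a. tensor_elt ?U1 ?U2 a \<one>\<^bsub>?U2\<^esub>" and ?i2 = "\<lambda>b. tensor_elt ?U1 ?U2 \<one>\<^bsub>?U1\<^esub> b"
  note i1 = tensor_incl_hom(1)[OF U1 U2] and i2 = tensor_incl_hom(2)[OF U1 U2]
  \<comment> \<open>Besides factoring pure tensors, the two equations show that the images of
    \<open>?i1\<close> and \<open>?i2\<close> commute.\<close>
  have i_mult: "?i1 a \<otimes>\<^bsub>?T\<^esub> ?i2 b = tensor_elt ?U1 ?U2 a b"
    "?i2 b \<otimes>\<^bsub>?T\<^esub> ?i1 a = tensor_elt ?U1 ?U2 a b" if "a \<in> carrier ?U1" "b \<in> carrier ?U2" for a b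
    using that by (simp_all add: tensor_elt_mult[OF U1 U2])

  \<comment> \<open>The homomorphism \<open>F\<close> into the tensor product\<close>
  let ?c = "\<lambda>u. ?i1 (G1.gen_alpha (fst u)) \<oplus>\<^bsub>?T\<^esub> ?i2 (G2.gen_alpha (snd u))"
  let ?d = "\<lambda>u. ?i1 (G1.gen_beta (fst u)) \<oplus>\<^bsub>?T\<^esub> ?i2 (G2.gen_beta (snd u))"
  have "lie_compatible (prod_scale s1 s2) (prod_lie l1 l2) ?T ?c ?d"
    by (rule lie_compatible_prod[OF T lie_compatible_hom[OF G1.lie_compatible_gen i1 U1]
          lie_compatible_hom[OF G2.lie_compatible_gen i2 U2]]) (simp_all add: i_mult c1(1,2) c2(1,2))
  then obtain F where F: "F \<in> alg_hom ?U ?T"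
    and F\<alpha>: "\<And>x. F (G.gen_alpha x) = ?c x" and F\<beta>: "\<And>x. F (G.gen_beta x) = ?d x"
    using G.env_lift[OF T, of ?c ?d] by blast

  \<comment> \<open>The homomorphism \<open>K\<close> back from the tensor product\<close>
  have zero1: "l1 x 0 = 0" "l1 0 x = 0" for x
    using G1.lie_scale_right[of x 0 0] G1.lie_scale_left[of 0 0 x] by simp_all
  have zero2: "l2 x 0 = 0" "l2 0 x = 0" for x
    using G2.lie_scale_right[of x 0 0] G2.lie_scale_left[of 0 0 x] by simp_all
  \<comment> \<open>\<open>x \<mapsto> (x, 0)\<close> respects brackets because the second component
    of a bracket of such pairs is \<open>l2 0 0 = 0\<close>.\<close>
  have "lie_compatible s1 l1 ?U (\<lambda>x. G.gen_alpha (x, 0)) (\<lambda>x. G.gen_beta (x, 0))"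
    by (rule lie_compatible_comp[OF G.lie_compatible_gen])
      (simp_all add: prod_scale_def prod_lie_def zero2)
  then obtain K1 where K1: "K1 \<in> alg_hom ?U1 ?U"
    and K1\<alpha>: "\<And>x. K1 (G1.gen_alpha x) = G.gen_alpha (x, 0)"
    and K1\<beta>: "\<And>x. K1 (G1.gen_beta x) = G.gen_beta (x, 0)"
    using G1.env_lift[OF U] by blast
  have "lie_compatible s2 l2 ?U (\<lambda>y. G.gen_alpha (0, y)) (\<lambda>y. G.gen_beta (0, y))"
    by (rule lie_compatible_comp[OF G.lie_compatible_gen])
      (simp_all add: prod_scale_def prod_lie_def zero1)
  then obtain K2 where K2: "K2 \<in> alg_hom ?U2 ?U"
    and K2\<alpha>: "\<And>y. K2 (G2.gen_alpha y) = G.gen_alpha (0, y)"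
    and K2\<beta>: "\<And>y. K2 (G2.gen_beta y) = G.gen_beta (0, y)"
    using G2.env_lift[OF U] by blast

  have gen0: "G.gen_alpha 0 = \<zero>\<^bsub>?U\<^esub>" "G.gen_beta 0 = \<zero>\<^bsub>?U\<^esub>"
    using c(5,6)[of 0 0] c(1,2)[of 0] by (simp_all add: prod_scale_def zero_prod_def)
  have bracket0: "prod_lie l1 l2 (x, 0) (0, y) = 0" "prod_lie l1 l2 (0, y) (x, 0) = 0" for x y
    by (simp_all add: prod_lie_def zero1 zero2 zero_prod_def)
  \<comment> \<open>Each commutator involving a \<open>\<beta>\<close> is a generator at the bracket
    of the two pairs, which is zero by \<open>bracket0\<close>.\<close>
  have comm: "G.gen_alpha (x, 0) \<otimes>\<^bsub>?U\<^esub> G.gen_alpha (0, y) = G.gen_alpha (0, y) \<otimes>\<^bsub>?U\<^esub> G.gen_alpha (x, 0)"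
    "G.gen_alpha (x, 0) \<otimes>\<^bsub>?U\<^esub> G.gen_beta (0, y) = G.gen_beta (0, y) \<otimes>\<^bsub>?U\<^esub> G.gen_alpha (x, 0)"
    "G.gen_beta (x, 0) \<otimes>\<^bsub>?U\<^esub> G.gen_alpha (0, y) = G.gen_alpha (0, y) \<otimes>\<^bsub>?U\<^esub> G.gen_beta (x, 0)"
    "G.gen_beta (x, 0) \<otimes>\<^bsub>?U\<^esub> G.gen_beta (0, y) = G.gen_beta (0, y) \<otimes>\<^bsub>?U\<^esub> G.gen_beta (x, 0)" for x y
    using c(7)[of "(x, 0)" "(0, y)"] c(9)[of "(x, 0)" "(0, y)"] c(9)[of "(0, y)" "(x, 0)"]
      c(10)[of "(x, 0)" "(0, y)"] c(1,2)
    by (simp_all add: bracket0 gen0)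
  \<comment> \<open>Commutation spreads one factor at a time: first over \<open>?U2\<close> against
    a fixed generator of \<open>?U1\<close>, then over \<open>?U1\<close> against a fixed
    \<open>K2 b\<close>.\<close>
  have K2_comm: "K2 b \<otimes>\<^bsub>?U\<^esub> K1 (G1.gen_alpha x) = K1 (G1.gen_alpha x) \<otimes>\<^bsub>?U\<^esub> K2 b"
    "K2 b \<otimes>\<^bsub>?U\<^esub> K1 (G1.gen_beta x) = K1 (G1.gen_beta x) \<otimes>\<^bsub>?U\<^esub> K2 b"
    if "b \<in> carrier ?U2" for b x
    by (rule G2.env_hom_commute[OF U K2 _ _ _ that]; simp add: K1\<alpha> K1\<beta> K2\<alpha> K2\<beta> c(1,2) comm)+
  have K_comm: "K1 a \<otimes>\<^bsub>?U\<^esub> K2 b = K2 b \<otimes>\<^bsub>?U\<^esub> K1 a" if "a \<in> carrier ?U1" "b \<in> carrier ?U2" for a b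
    by (rule G1.env_hom_commute[OF U K1]) (simp_all add: that alg_homD(1)[OF K2] K2_comm)
  obtain K where K: "K \<in> alg_hom ?T ?U" and K_elt:
    "\<And>a b. \<lbrakk>a \<in> carrier ?U1; b \<in> carrier ?U2\<rbrakk> \<Longrightarrow> K (tensor_elt ?U1 ?U2 a b) = K1 a \<otimes>\<^bsub>?U\<^esub> K2 b"
    using tensor_lift[OF U1 U2 U K1 K2 K_comm] by blast

  \<comment> \<open>\<open>F\<close> and \<open>K\<close> are mutually inverse\<close>
  have K_i: "K (?i1 a) = K1 a" "K (?i2 b) = K2 b" if "a \<in> carrier ?U1" "b \<in> carrier ?U2" for a b
    using that by (simp_all add: K_elt alg_homD(1,4)[OF K1] alg_homD(1,4)[OF K2])
  have KF: "K (F u) = u" if "u \<in> carrier ?U" for u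
  proof -
    \<comment> \<open>Additivity of the generators is applied to the splitting
      \<open>x = (fst x, 0) + (0, snd x)\<close>.\<close>
    have K_gen: "K (?c x) = G.gen_alpha x" "K (?d x) = G.gen_beta x" for x
      using c(3,4)[of "(fst x, 0)" "(0, snd x)"]
      by (simp_all add: alg_homD(3)[OF K] alg_homD(1)[OF i1] alg_homD(1)[OF i2] c1(1,2) c2(1,2)
          K_i(1)[OF _ U2.one_closed] K_i(2)[OF U1.one_closed] K1\<alpha> K1\<beta> K2\<alpha> K2\<beta>)
    have "(K \<circ> F) u = id u"
      by (rule G.env_hom_eqI[OF alg_hom_comp[OF F K] _ _ _ that])
        (simp_all add: F\<alpha> F\<beta> K_gen alg_homI)
    then show ?thesis by simp
  qed
  have FK: "F (K t) = t" if "t \<in> carrier ?T" for t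
  proof -
    \<comment> \<open>\<open>F\<close> sends a generator at \<open>(x, 0)\<close> or
      \<open>(0, y)\<close> to a sum of two terms; the term from the zero component
      vanishes.\<close>
    have inc0: "?i1 (G1.gen_alpha 0) = \<zero>\<^bsub>?T\<^esub>" "?i1 (G1.gen_beta 0) = \<zero>\<^bsub>?T\<^esub>"
      "?i2 (G2.gen_alpha 0) = \<zero>\<^bsub>?T\<^esub>" "?i2 (G2.gen_beta 0) = \<zero>\<^bsub>?T\<^esub>"
      using c1(5,6)[of 0 0] c1(1,2)[of 0] c2(5,6)[of 0 0] c2(1,2)[of 0]
        alg_hom_zero[OF U1 T i1] alg_hom_zero[OF U2 T i2] by simp_all
    have F1: "(F \<circ> K1) a = ?i1 a" if "a \<in> carrier ?U1" for a
      by (rule G1.env_hom_eqI[OF alg_hom_comp[OF K1 F] i1 _ _ that])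
        (simp_all add: K1\<alpha> K1\<beta> F\<alpha> F\<beta> inc0 alg_homD(1)[OF i1] c1(1,2))
    have F2: "(F \<circ> K2) b = ?i2 b" if "b \<in> carrier ?U2" for b
      by (rule G2.env_hom_eqI[OF alg_hom_comp[OF K2 F] i2 _ _ that])
        (simp_all add: K2\<alpha> K2\<beta> F\<alpha> F\<beta> inc0 alg_homD(1)[OF i2] c2(1,2))
    \<comment> \<open>Homomorphisms out of the tensor product are determined on pure tensors, where
      \<open>F1\<close> and \<open>F2\<close> handle the two factors.\<close>
    have "(F \<circ> K) t = id t"
    proof (rule tensor_hom_eqI[OF U1 U2 T alg_hom_comp[OF K F] _ _ that])
      fix a b assume ab: "a \<in> carrier ?U1" "b \<in> carrier ?U2"
      then have "F (K1 a \<otimes>\<^bsub>?U\<^esub> K2 b) = ?i1 a \<otimes>\<^bsub>?T\<^esub> ?i2 b"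
        using F1[of a] F2[of b] by (simp add: alg_homD(2)[OF F] alg_homD(1)[OF K1] alg_homD(1)[OF K2])
      then show "(F \<circ> K) (tensor_elt ?U1 ?U2 a b) = id (tensor_elt ?U1 ?U2 a b)"
        using ab by (simp add: K_elt i_mult)
    qed (auto intro: alg_homI)
    then show ?thesis by simp
  qed
  have "bij_betw F (carrier ?U) (carrier ?T)"
    by (rule bij_betw_byWitness[where f' = K]) (auto simp: KF FK alg_homD(1)[OF F] alg_homD(1)[OF K])
  then show ?thesis unfolding alg_isomorphic_def using F by blast
qed

end
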